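(* Assume that $S$ satisfies (A1). Then for each $z\in\mathbb H$ the equation $$-\frac1m = z+a+Sm$$ has a unique solution $m=m(z)\in\mathcal B_+$. The solutions for different values of $z$ constitute an analytic function $z\mapsto m(z)$ from $\mathbb H$ to $\mathcal B_+$. Moreover, for each $x\in\mathfrak X$ there exists a positive measure $v_x$ on $\mathbb R$ with $$\operatorname{supp} v_x\subset[-\Sigma,\Sigma],\qquad \Sigma:=\|a\|+2\|S\|^{1/2},$$ and $v_x(\mathbb R)=\pi$ (the number $\pi=3.14\ldots$), such that $$m_x(z)=\frac1\pi\int_{\mathbb R}\frac{v_x(d\tau)}{\tau-z},\qquad\forall z\in\mathbb H .$$ The measures $v_x$ constitute a measurable function $x\mapsto v_x$ from $\mathfrak X$ to $\mathcal M(\mathbb R)$, where $\mathcal M(\mathbb R)$ denotes the space of finite Borel measures on $\mathbb R$ equipped with the weak topology. Furthermore, if $a=0$, then $m(z)\in L^2$ with $$\|m(z)\|_2\le\frac{2}{|z|},\qquad\forall z\in\mathbb H,$$ and the measures $v_x$ are symmetric, in the sense that $v_x(-A)=v_x(A)$ for every measurable $A\subset\mathbb R$.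
   Context: $(\mathfrak X,\mathcal S,\pi)$ is a probability space (the symbol $\pi$ also denotes this measure when it is applied to $dx$ or to subsets of $\mathfrak X$). $\mathcal B$ is the Banach space of bounded measurable functions $w:\mathfrak X\to\mathbb C$ with norm $\|w\|=\sup_{x}|w_x|$. $\mathbb H=\{z\in\mathbb C:\operatorname{Im}z>0\}$ and $\mathcal B_+=\{w\in\mathcal B:\operatorname{Im}w_x>0\ \forall x\in\mathfrak X\}$. $\langle u,w\rangle=\int_{\mathfrak X}\overline{u_x}\,w_x\,\pi(dx)$, $\langle w\rangle=\int w_x\pi(dx)$, $\|w\|_2=\langle w,w\rangle^{1/2}$, and $L^2=L^2(\mathfrak X;\mathbb C)$. $S:\mathcal B\to\mathcal B$ is a non-zero bounded linear operator with operator norm $\|S\|$, and $a\in\mathcal B$ is real valued. Expressions such as $1/m$ are understood componentwise. (A1) $S$ is symmetric and positivity preserving: $\langle u,Sw\rangle=\langle Su,w\rangle$ for all $u,w\in\mathcal B$, and $\inf_x(Sp)_x\ge0$ for every real valued non-negative $p\in\mathcal B$. *)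

theory Defs
  imports "HOL-Probability.Probability"
begin

(* Bounded measurable functions are represented by total functions that are 0 outside
   "space M".  This makes the representation unique, so that equality and uniqueness of
   elements of the Banach space are equality and uniqueness in HOL. *)

definition bdd_meas :: "'x measure \<Rightarrow> ('x \<Rightarrow> complex) set" where
  "bdd_meas M = {w \<in> borel_measurable M. bounded (w ` space M) \<and> (\<forall>x. x \<notin> space M \<longrightarrow> w x = 0)}"

definition bdd_meas_plus :: "'x measure \<Rightarrow> ('x \<Rightarrow> complex) set" where
  "bdd_meas_plus M = {w \<in> bdd_meas M. \<forall>x\<in>space M. 0 < Im (w x)}"

definition sup_norm :: "'x measure \<Rightarrow> ('x \<Rightarrow> complex) \<Rightarrow> real" where
  "sup_norm M w = (SUP x\<in>space M. cmod (w x))"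

definition inner_prod :: "'x measure \<Rightarrow> ('x \<Rightarrow> complex) \<Rightarrow> ('x \<Rightarrow> complex) \<Rightarrow> complex" where
  "inner_prod M u w = (LINT x|M. cnj (u x) * w x)"

definition L2 :: "'x measure \<Rightarrow> ('x \<Rightarrow> complex) set" where
  "L2 M = {w \<in> borel_measurable M. integrable M (\<lambda>x. (cmod (w x))\<^sup>2)}"

(* "inner_prod M w w" is real and non-negative *)
definition L2_norm :: "'x measure \<Rightarrow> ('x \<Rightarrow> complex) \<Rightarrow> real" where
  "L2_norm M w = sqrt (Re (inner_prod M w w))"

definition bounded_operator :: "'x measure \<Rightarrow> (('x \<Rightarrow> complex) \<Rightarrow> 'x \<Rightarrow> complex) \<Rightarrow> bool" where
  "bounded_operator M S \<longleftrightarrow>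
     (\<forall>w\<in>bdd_meas M. S w \<in> bdd_meas M) \<and>
     (\<forall>u\<in>bdd_meas M. \<forall>w\<in>bdd_meas M. S (\<lambda>x. u x + w x) = (\<lambda>x. S u x + S w x)) \<and>
     (\<forall>c. \<forall>w\<in>bdd_meas M. S (\<lambda>x. c * w x) = (\<lambda>x. c * S w x)) \<and>
     (\<exists>K. \<forall>w\<in>bdd_meas M. sup_norm M (S w) \<le> K * sup_norm M w)"

definition op_norm :: "'x measure \<Rightarrow> (('x \<Rightarrow> complex) \<Rightarrow> 'x \<Rightarrow> complex) \<Rightarrow> real" where
  "op_norm M S = (SUP w\<in>{w \<in> bdd_meas M. sup_norm M w \<le> 1}. sup_norm M (S w))"

definition symmetric_operator :: "'x measure \<Rightarrow> (('x \<Rightarrow> complex) \<Rightarrow> 'x \<Rightarrow> complex) \<Rightarrow> bool" where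
  "symmetric_operator M S \<longleftrightarrow>
     (\<forall>u\<in>bdd_meas M. \<forall>w\<in>bdd_meas M. inner_prod M u (S w) = inner_prod M (S u) w)"

definition positivity_preserving :: "'x measure \<Rightarrow> (('x \<Rightarrow> complex) \<Rightarrow> 'x \<Rightarrow> complex) \<Rightarrow> bool" where
  "positivity_preserving M S \<longleftrightarrow>
     (\<forall>p\<in>bdd_meas M. (\<forall>x\<in>space M. p x \<in> \<real>\<^sub>\<ge>\<^sub>0) \<longrightarrow> (\<forall>x\<in>space M. S p x \<in> \<real>\<^sub>\<ge>\<^sub>0))"

definition qve_solution ::
    "'x measure \<Rightarrow> (('x \<Rightarrow> complex) \<Rightarrow> 'x \<Rightarrow> complex) \<Rightarrow> ('x \<Rightarrow> complex) \<Rightarrow> complex \<Rightarrow> ('x \<Rightarrow> complex) \<Rightarrow> bool"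
  where
  "qve_solution M S a z m \<longleftrightarrow>
     m \<in> bdd_meas_plus M \<and> (\<forall>x\<in>space M. - (1 / m x) = z + a x + S m x)"

(* Analyticity of a function on an open set D with values in the complex Banach space
   "bdd_meas M": the complex derivative d exists in norm at each point of D. *)
definition banach_analytic_on :: "'x measure \<Rightarrow> (complex \<Rightarrow> 'x \<Rightarrow> complex) \<Rightarrow> complex set \<Rightarrow> bool" where
  "banach_analytic_on M f D \<longleftrightarrow>
     (\<forall>z\<in>D. f z \<in> bdd_meas M) \<and>
     (\<forall>z\<in>D. \<exists>d\<in>bdd_meas M.
        ((\<lambda>w. sup_norm M (\<lambda>x. (f w x - f z x) / (w - z) - d x)) \<longlongrightarrow> 0) (at z within D))"

definition measure_support :: "'t::topological_space measure \<Rightarrow> 't set" where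
  "measure_support \<mu> = {t. \<forall>U. open U \<longrightarrow> t \<in> U \<longrightarrow> 0 < emeasure \<mu> U}"

definition finite_borel_measures :: "real measure set" where
  "finite_borel_measures = {\<mu>. finite_measure \<mu> \<and> sets \<mu> = sets borel}"

(* The coarsest topology for which integration of each bounded continuous function is continuous. *)
definition weak_topology :: "real measure topology" where
  "weak_topology = topology_generated_by
     {{\<mu> \<in> finite_borel_measures. (LINT t|\<mu>. f t) \<in> U} | (f :: real \<Rightarrow> real) U.
        continuous_on UNIV f \<and> bounded (range f) \<and> open U}"

definition borel_of_topology :: "'t topology \<Rightarrow> 't measure" where
  "borel_of_topology T = sigma (topspace T) {U. openin T U}"

lemma topspace_weak_topology: "topspace weak_topology = finite_borel_measures"
proof -
  have "finite_borel_measures \<in> {{\<mu> \<in> finite_borel_measures. (LINT t|\<mu>. f t) \<in> U} | (f :: real \<Rightarrow> real) U.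
        continuous_on UNIV f \<and> bounded (range f) \<and> open U}"
    by (intro CollectI exI[of _ "\<lambda>_. 0"] exI[of _ UNIV]) auto
  then show ?thesis
    unfolding weak_topology_def topology_generated_by_topspace by blast
qed

lemma space_borel_of_weak_topology: "space (borel_of_topology weak_topology) = finite_borel_measures"
  and sets_borel_of_weak_topology:
    "sets (borel_of_topology weak_topology) =
       sigma_sets finite_borel_measures {U. openin weak_topology U}"
proof -
  have "{U. openin weak_topology U} \<subseteq> Pow finite_borel_measures"
    using openin_subset topspace_weak_topology by blast
  then show "space (borel_of_topology weak_topology) = finite_borel_measures"
    "sets (borel_of_topology weak_topology) =
       sigma_sets finite_borel_measures {U. openin weak_topology U}"
    by (simp_all add: borel_of_topology_def topspace_weak_topology)
qed

end

theory Submission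
  imports Defs "HOL-Complex_Analysis.Complex_Analysis"
begin

text \<open>
  For \<open>u\<close> with values in the upper half plane put \<open>\<Phi> u = - 1 / (z + a + S u)\<close>. Cauchy--Schwarz for the
  positive functionals \<open>w \<mapsto> (S w) x\<close> shows that \<open>\<Phi>\<close> contracts the pseudo-distance
  \<open>sup\<^sub>x \<bar>u x - w x\<bar>\<^sup>2 / (Im (u x) Im (w x))\<close>, with a factor that is uniform for \<open>z\<close> in compact sets. Hence the
  iterates from \<open>0\<close> converge locally uniformly in \<open>z\<close> to the unique solution, which is therefore pointwise
  holomorphic, and Cauchy's estimates turn pointwise holomorphy into norm analyticity. For
  \<open>\<bar>z\<bar> > \<Sigma>\<close> the same iterates are bounded by \<open>1 / (\<bar>z\<bar> - \<parallel>a\<parallel> - \<parallel>S\<parallel>\<^sup>1\<^sup>/\<^sup>2)\<close> and their imaginary parts by a multiple of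
  \<open>Im z\<close>. So each \<open>z \<mapsto> m(z) x\<close> is a Nevanlinna function with \<open>m(z) x \<sim> - 1 / z\<close>; it is the Stieltjes
  transform of a probability measure (a weak limit of the densities \<open>Im (m(t + \<i>\<eta>) x) / \<pi>\<close>) that lives on
  \<open>[-\<Sigma>, \<Sigma>]\<close>. Moments are limits of expressions in the Stieltjes transform, hence measurable in \<open>x\<close>, and on
  measures carried by \<open>[-\<Sigma>, \<Sigma>]\<close> they determine the weak topology.
\<close>

section \<open>Stieltjes representation of Nevanlinna functions\<close>

text \<open>Two identities carry the contraction: \<open>\<Phi> z u x - \<Phi> z w x\<close> is S (u
  - w) at x times \<open>\<Phi> z u x * \<Phi> z w x\<close>, and \<open>Im (\<Phi> z u x)\<close>
  is (Im z + S (Im u)) times the squared modulus of \<open>\<Phi> z u x\<close>. In the hyperbolic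
  quotient the moduli cancel, and the summand Im z pushes the factor below one. The obstacle is that
  the quotient degenerates at the starting point 0; one application of \<open>\<Phi>\<close> cures
  this by lifting Im above a positive constant. Another is that \<open>S\<close> need not be an
  integral operator, so pointwise limits and pointwise holomorphy do not pass through it:
  convergence uniform in x and analyticity in norm are kept at every step. The radius \<Sigma> is
  the threshold at which the norm estimate reproduces the bound |u| \<le> 1 / sqrt s, namely |z| - A
  - sqrt s \<ge> sqrt s. For a = 0 the equation reads z m = - (1 + m S m), so the L2 bound reduces
  to ||m S m||_2 \<le> 1; the symmetry of the measures comes from uniqueness applied to - cnj (m z)
  at the point - cnj z.\<close>

lemma rectpath_bottom_integral:
  fixes F :: "complex \<Rightarrow> complex"
  assumes R: "0 < R" and I: "(F has_contour_integral I) (rectpath (of_real (-R)) (Complex R R))"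
    and B: "0 \<le> B"
    and bound: "\<And>w. \<bar>Re w\<bar> = R \<or> Im w = R \<Longrightarrow> \<bar>Re w\<bar> \<le> R \<Longrightarrow> 0 \<le> Im w \<Longrightarrow> Im w \<le> R \<Longrightarrow> cmod (F w) \<le> B"
  shows "\<exists>J. ((\<lambda>x. F (of_real x)) has_integral J) {-R..R} \<and> cmod (I - J) \<le> 4 * R * B"
proof -
  let ?a = "complex_of_real (-R)" and ?b = "Complex R 0" and ?c = "Complex R R" and ?d = "Complex (-R) R"
  have I': "(F has_contour_integral I) (linepath ?a ?b +++ linepath ?b ?c +++ linepath ?c ?d +++ linepath ?d ?a)"
    using I by (simp add: rectpath_def Let_def)
  then have "F contour_integrable_on (linepath ?a ?b +++ linepath ?b ?c +++ linepath ?c ?d +++ linepath ?d ?a)"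
    by (auto simp: contour_integrable_on_def)
  then obtain J1 J2 J3 J4 where J: "(F has_contour_integral J1) (linepath ?a ?b)"
      "(F has_contour_integral J2) (linepath ?b ?c)" "(F has_contour_integral J3) (linepath ?c ?d)"
      "(F has_contour_integral J4) (linepath ?d ?a)"
    by (simp del: linepath_of_real) (auto simp only: contour_integrable_on_def)
  have "(F has_contour_integral (J1 + (J2 + (J3 + J4))))
          (linepath ?a ?b +++ linepath ?b ?c +++ linepath ?c ?d +++ linepath ?d ?a)"
    using J by (intro has_contour_integral_join) auto
  with I' have eq: "I = J1 + (J2 + (J3 + J4))"
    by (rule has_contour_integral_unique)
  have "cmod J2 \<le> B * cmod (?c - ?b)"
    using J(2) B by (rule has_contour_integral_bound_linepath)
      (use R in \<open>auto simp: closed_segment_same_Re closed_segment_eq_real_ivl intro!: bound\<close>)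
  moreover have "cmod J3 \<le> B * cmod (?d - ?c)"
    using J(3) B by (rule has_contour_integral_bound_linepath)
      (use R in \<open>auto simp: closed_segment_same_Im closed_segment_eq_real_ivl intro!: bound\<close>)
  moreover have "cmod J4 \<le> B * cmod (?a - ?d)"
    using J(4) B by (rule has_contour_integral_bound_linepath)
      (use R in \<open>auto simp: closed_segment_same_Re closed_segment_eq_real_ivl intro!: bound\<close>)
  moreover have "cmod (?c - ?b) = R" "cmod (?d - ?c) = 2 * R" "cmod (?a - ?d) = R"
    using R by (auto simp: cmod_def complex_of_real_def real_sqrt_mult)
  moreover have "cmod (J2 + (J3 + J4)) \<le> cmod J2 + (cmod J3 + cmod J4)"
    by (meson add_left_mono norm_triangle_ineq order_trans)
  \<comment> \<open>The sides off the real axis have lengths R, 2 R and R, in total 4 R.\<close>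
  ultimately have "cmod (J2 + (J3 + J4)) \<le> 4 * R * B"
    by (simp add: algebra_simps)
  moreover have "?b = of_real R" by (simp add: complex_of_real_def)
  then have "((\<lambda>x. F (of_real x)) has_integral J1) {-R..R}"
    using J(1) R by (simp add: has_contour_integral_linepath_Reals_iff del: of_real_minus)
  ultimately show ?thesis using eq by auto
qed

text \<open>The decay makes the integrand O(1 / R^2) on the three sides off the axis, so only the
  real side survives as R grows. The margin \<open>\<delta>\<close> puts that side inside the domain
  of \<open>g\<close>; for \<open>\<zeta>\<close> below the axis the integrand is holomorphic on a
  convex set containing the rectangle.\<close>

lemma half_plane_Cauchy:
  fixes g :: "complex \<Rightarrow> complex"
  assumes hol: "g holomorphic_on {w. - \<delta> < Im w}" and \<delta>: "0 < \<delta>"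
    and decay: "\<And>w. 0 \<le> Im w \<Longrightarrow> R0 \<le> cmod w \<Longrightarrow> cmod (g w) \<le> C / cmod w" and C: "0 \<le> C"
    and \<zeta>: "Im \<zeta> \<noteq> 0"
  shows "(\<lambda>n. integral {- real n..real n} (\<lambda>x. g (of_real x) / (of_real x - \<zeta>)))
      \<longlonglongrightarrow> (if 0 < Im \<zeta> then 2 * pi * \<i> * g \<zeta> else 0)"
proof -
  let ?L = "if 0 < Im \<zeta> then 2 * pi * \<i> * g \<zeta> else 0"
  have ev: "\<forall>\<^sub>F n in sequentially. cmod (integral {- real n..real n} (\<lambda>x. g (of_real x) / (of_real x - \<zeta>)) - ?L) \<le> 8 * C / real n"
  proof -
    \<comment> \<open>The bound \<open>2 * cmod \<zeta>\<close> keeps |w - \<zeta>| at least R / 2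
      on the three sides; with |g w| \<le> C / R the error is 4 R * 2 C / R^2 = 8 C / R.\<close>
    have "\<forall>\<^sub>F n in sequentially. real n > max (max R0 1) (2 * cmod \<zeta>)"
      using filterlim_real_sequentially unfolding filterlim_at_top_dense by blast
    then show ?thesis
    proof eventually_elim
      case (elim n)
      define R where "R = real n"
      have R: "R > R0" "R > 1" "R > 2 * cmod \<zeta>" using elim by (auto simp: R_def)
      let ?F = "\<lambda>w. g w / (w - \<zeta>)"
      let ?p = "rectpath (of_real (-R)) (Complex R R)"
      have sub: "path_image ?p \<subseteq> {w. \<bar>Re w\<bar> \<le> R \<and> 0 \<le> Im w \<and> Im w \<le> R}"
        using R by (auto simp: path_image_rectpath)
      have re: "\<bar>Re \<zeta>\<bar> < R" "Im \<zeta> < R" "cmod \<zeta> < R"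
        using R abs_Re_le_cmod[of \<zeta>] abs_Im_le_cmod[of \<zeta>] by linarith+
      have I: "(?F has_contour_integral ?L) ?p"
      proof (cases "0 < Im \<zeta>")
        case True
        have "\<zeta> \<in> box (of_real (-R)) (Complex R R)"
          using re True by (auto simp: in_box_complex_iff)
        then have wn: "winding_number ?p \<zeta> = 1" and notin: "\<zeta> \<notin> path_image ?p"
          using path_image_rectpath_inter_box[of "of_real (-R)" "Complex R R"] R
          by (auto simp: winding_number_rectpath)
        have "(?F has_contour_integral (2 * pi * \<i> * winding_number ?p \<zeta> * g \<zeta>)) ?p"
        proof (rule Cauchy_integral_formula_convex_simple[OF _ hol])
          show "convex {w. - \<delta> < Im w}" by (rule convex_halfspace_Im_gt)
          show "\<zeta> \<in> interior {w. - \<delta> < Im w}"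
            using True \<delta> by (subst interior_open) (auto simp: open_halfspace_Im_gt)
          show "path_image ?p \<subseteq> {w. - \<delta> < Im w} - {\<zeta>}"
            using sub notin \<delta> by fastforce
        qed auto
        then show ?thesis using wn True by simp
      next
        case False
        have "(?F has_contour_integral 0) ?p"
        proof (rule Cauchy_theorem_convex_simple)
          show "?F holomorphic_on {w. - \<delta> < Im w} \<inter> {w. Im \<zeta> < Im w}"
            using hol by (auto intro!: holomorphic_intros intro: holomorphic_on_subset)
          show "convex ({w. - \<delta> < Im w} \<inter> {w. Im \<zeta> < Im w})"
            by (intro convex_Int convex_halfspace_Im_gt)
          show "path_image ?p \<subseteq> {w. - \<delta> < Im w} \<inter> {w. Im \<zeta> < Im w}"
            using sub \<delta> False \<zeta> by fastforce
        qed auto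
        then show ?thesis using False by simp
      qed
      have "\<exists>J. ((\<lambda>x. ?F (of_real x)) has_integral J) {-R..R} \<and> cmod (?L - J) \<le> 4 * R * (2 * C / R^2)"
      proof (rule rectpath_bottom_integral[OF _ I])
        show "0 < R" "0 \<le> 2 * C / R\<^sup>2" using R C by auto
        fix w assume w: "\<bar>Re w\<bar> = R \<or> Im w = R" "\<bar>Re w\<bar> \<le> R" "0 \<le> Im w" "Im w \<le> R"
        have wR: "R \<le> cmod w"
          using w abs_Re_le_cmod[of w] abs_Im_le_cmod[of w] by auto
        have "cmod (g w) \<le> C / cmod w" using decay[of w] w wR R by auto
        also have "\<dots> \<le> C / R" using wR R C by (intro divide_left_mono mult_pos_pos) auto
        finally have 1: "cmod (g w) \<le> C / R" .
        have "cmod w \<le> cmod (w - \<zeta>) + cmod \<zeta>"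
          by (metis diff_add_cancel norm_triangle_ineq)
        then have 2: "R / 2 \<le> cmod (w - \<zeta>)" using wR R by linarith
        have "cmod (?F w) = cmod (g w) / cmod (w - \<zeta>)" by (simp add: norm_divide)
        also have "\<dots> \<le> (C / R) / (R / 2)"
          using 1 2 R C by (intro frac_le) auto
        also have "\<dots> = 2 * C / R\<^sup>2" by (simp add: power2_eq_square)
        finally show "cmod (?F w) \<le> 2 * C / R\<^sup>2" .
      qed
      then obtain J where J: "((\<lambda>x. ?F (of_real x)) has_integral J) {-R..R}"
          "cmod (?L - J) \<le> 4 * R * (2 * C / R^2)" by blast
      have "4 * R * (2 * C / R^2) = 8 * C / R" using R by (simp add: power2_eq_square)
      then show ?case using J by (simp add: integral_unique R_def norm_minus_commute)
    qed
  qed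
  have "(\<lambda>n. integral {- real n..real n} (\<lambda>x. g (of_real x) / (of_real x - \<zeta>)) - ?L) \<longlonglongrightarrow> 0"
  proof (rule Lim_null_comparison[OF ev])
    show "(\<lambda>n. 8 * C / real n) \<longlonglongrightarrow> 0" by (rule lim_const_over_n)
  qed
  then show ?thesis by (rule LIM_zero_cancel)
qed

text \<open>On the real line the conjugate of g / (x - cnj \<zeta>) is cnj g / (x - \<zeta>), and
  its integral tends to 0 because cnj \<zeta> lies below the axis. Subtracting it from the Cauchy
  integral leaves 2 i Im g over x - \<zeta>.\<close>

lemma half_plane_Poisson:
  fixes g :: "complex \<Rightarrow> complex"
  assumes hol: "g holomorphic_on {w. - \<delta> < Im w}" and \<delta>: "0 < \<delta>"
    and decay: "\<And>w. 0 \<le> Im w \<Longrightarrow> R0 \<le> cmod w \<Longrightarrow> cmod (g w) \<le> C / cmod w" and C: "0 \<le> C"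
    and \<zeta>: "0 < Im \<zeta>"
  shows "(\<lambda>n. integral {- real n..real n} (\<lambda>x. of_real (Im (g (of_real x))) / (of_real x - \<zeta>)))
      \<longlonglongrightarrow> pi * g \<zeta>"
proof -
  let ?A = "\<lambda>n. integral {- real n..real n} (\<lambda>x. g (of_real x) / (of_real x - \<zeta>))"
  let ?B = "\<lambda>n. integral {- real n..real n} (\<lambda>x. g (of_real x) / (of_real x - cnj \<zeta>))"
  have cg: "continuous_on UNIV (\<lambda>x::real. g (of_real x))"
    by (rule continuous_on_compose2[OF holomorphic_on_imp_continuous_on[OF hol]])
      (use \<delta> in \<open>auto intro!: continuous_intros\<close>)
  have ne: "complex_of_real x - \<zeta> \<noteq> 0" "complex_of_real x - cnj \<zeta> \<noteq> 0" for x
    using \<zeta> by (auto simp: complex_eq_iff)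
  have int: "(\<lambda>x. g (of_real x) / (of_real x - w)) integrable_on {- real n..real n}"
    if "w = \<zeta> \<or> w = cnj \<zeta>" for w n
    using ne that by (intro integrable_continuous_interval continuous_intros continuous_on_subset[OF cg]) auto
  have eq: "integral {- real n..real n} (\<lambda>x. of_real (Im (g (of_real x))) / (of_real x - \<zeta>))
      = (?A n - cnj (?B n)) / (2 * \<i>)" for n
  proof (rule integral_unique)
    have "((\<lambda>x. cnj (g (of_real x) / (of_real x - cnj \<zeta>))) has_integral cnj (?B n)) {- real n..real n}"
      using has_integral_linear[OF integrable_integral[OF int[of "cnj \<zeta>"]] bounded_linear_cnj] by (simp add: o_def)
    then have "((\<lambda>x. (g (of_real x) / (of_real x - \<zeta>) - cnj (g (of_real x) / (of_real x - cnj \<zeta>))) / (2 * \<i>)) has_integral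
          (?A n - cnj (?B n)) / (2 * \<i>)) {- real n..real n}"
      by (intro has_integral_divide has_integral_diff integrable_integral int) auto
    moreover have "(g (complex_of_real x) / (complex_of_real x - \<zeta>) - cnj (g (complex_of_real x) / (complex_of_real x - cnj \<zeta>))) / (2 * \<i>)
        = complex_of_real (Im (g (complex_of_real x))) / (complex_of_real x - \<zeta>)" for x :: real
    proof -
      define w d where "w = g (complex_of_real x)" and "d = complex_of_real x - \<zeta>"
      have "w / d - cnj w / d = (2 * \<i>) * (complex_of_real (Im w) / d)"
        unfolding diff_divide_distrib[symmetric] complex_diff_cnj by (simp add: mult_ac)
      then have "(w / d - cnj w / d) / (2 * \<i>) = complex_of_real (Im w) / d"
        by (metis nonzero_mult_div_cancel_left complex_i_not_zero mult_eq_0_iff zero_neq_numeral)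
      moreover have "cnj (w / (complex_of_real x - cnj \<zeta>)) = cnj w / d" by (simp add: d_def)
      ultimately show ?thesis by (simp only: w_def d_def)
    qed
    ultimately show "((\<lambda>x. of_real (Im (g (of_real x))) / (of_real x - \<zeta>)) has_integral
          (?A n - cnj (?B n)) / (2 * \<i>)) {- real n..real n}"
      by simp
  qed
  have "?A \<longlonglongrightarrow> 2 * pi * \<i> * g \<zeta>"
    using half_plane_Cauchy[OF hol \<delta> decay C, where \<zeta> = "\<zeta>"] \<zeta> by simp
  moreover have "?B \<longlonglongrightarrow> 0"
    using half_plane_Cauchy[OF hol \<delta> decay C, where \<zeta> = "cnj \<zeta>"] \<zeta> by simp
  ultimately have "(\<lambda>n. (?A n - cnj (?B n)) / (2 * \<i>)) \<longlonglongrightarrow> (2 * pi * \<i> * g \<zeta> - cnj 0) / (2 * \<i>)"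
    by (intro tendsto_intros) auto
  moreover have "(2 * pi * \<i> * g \<zeta> - cnj 0) / (2 * \<i>) = pi * g \<zeta>" by (simp add: algebra_simps)
  ultimately show ?thesis by (simp only: eq)
qed


section \<open>From densities on horizontal lines to the representing measure\<close>

lemma integrable_lborel_inverse_1_plus_square: "integrable lborel (\<lambda>x::real. inverse (1 + x\<^sup>2))"
  using integrable_inverse_1_plus_square
  unfolding einterval_def set_integrable_def by simp

lemma LIMSEQ_integral_intervals:
  fixes F :: "real \<Rightarrow> 'b::euclidean_space"
  assumes "integrable lborel F"
  shows "(\<lambda>n. integral {- real n..real n} F) \<longlonglongrightarrow> (LINT x|lborel. F x)"
proof -
  have "integral {- real n..real n} F = (LINT x|lborel. indicator {- real n..real n} x *\<^sub>R F x)" for n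
    using assms set_borel_integral_eq_integral(2)[of "{- real n..real n}" F]
    by (simp add: set_integrable_def set_lebesgue_integral_def integrable_mult_indicator)
  moreover have "(\<lambda>n. LINT x|lborel. indicator {- real n..real n} x *\<^sub>R F x) \<longlonglongrightarrow> (LINT x|lborel. F x)"
  proof (rule integral_dominated_convergence)
    show "integrable lborel (\<lambda>x. norm (F x))" using assms by simp
    show "AE x in lborel. (\<lambda>n. indicator {- real n..real n} x *\<^sub>R F x) \<longlonglongrightarrow> F x"
    proof (rule AE_I2)
      fix x :: real
      have "\<forall>\<^sub>F n in sequentially. real n > \<bar>x\<bar>"
        using filterlim_real_sequentially unfolding filterlim_at_top_dense by blast
      then have "\<forall>\<^sub>F n in sequentially. indicator {- real n..real n} x *\<^sub>R F x = F x"
        by eventually_elim (auto simp: indicator_def)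
      then show "(\<lambda>n. indicator {- real n..real n} x *\<^sub>R F x) \<longlonglongrightarrow> F x"
        by (rule tendsto_eventually)
    qed
  qed (use assms in \<open>auto simp: indicator_def\<close>)
  ultimately show ?thesis by simp
qed

lemma LIMSEQ_inverse_real_Suc: "(\<lambda>n. 1 / real (Suc n)) \<longlonglongrightarrow> 0"
  by (rule LIMSEQ_Suc[OF lim_const_over_n])

lemma Im_minus_inverse: "Im (- (1 / z)) = Im z / (cmod z)\<^sup>2"
  by (simp add: Im_divide cmod_power2)

text \<open>The hypothesis \<open>decay\<close> is what forces the representing measure to have total mass one.\<close>

locale Nevanlinna_function =
  fixes f :: "complex \<Rightarrow> complex" and R0 C :: real
  assumes hol: "f holomorphic_on {z. 0 < Im z}"
    and nonneg: "\<And>z. 0 < Im z \<Longrightarrow> 0 \<le> Im (f z)"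
    and C: "0 \<le> C"
    and decay: "\<And>z. 0 < Im z \<Longrightarrow> R0 \<le> cmod z \<Longrightarrow> cmod (f z + 1 / z) \<le> C / (cmod z)\<^sup>2"
begin

text \<open>Up to the factor 1 / pi, the density that Stieltjes inversion uses at height
  \<open>\<eta>\<close>.\<close>

definition slice :: "real \<Rightarrow> real \<Rightarrow> real" where
  "slice \<eta> t = Im (f (Complex t \<eta>))"

lemma continuous_on_slice:
  assumes "0 < \<eta>" shows "continuous_on UNIV (slice \<eta>)"
  unfolding slice_def
  by (intro continuous_on_Im continuous_on_compose2[OF holomorphic_on_imp_continuous_on[OF hol]])
    (use assms in \<open>auto intro!: continuous_intros simp: Complex_eq\<close>)

lemma slice_borel [measurable]: "0 < \<eta> \<Longrightarrow> slice \<eta> \<in> borel_measurable borel"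
  by (intro borel_measurable_continuous_onI continuous_on_slice)

lemma slice_nonneg: "0 < \<eta> \<Longrightarrow> 0 \<le> slice \<eta> t"
  by (simp add: slice_def nonneg)

text \<open>Since Im (- 1 / z) = \<eta> / |z|^2 on this line, the leading term decays quadratically,
  just like the error in \<open>decay\<close>; integrability of \<open>slice \<eta>\<close> rests on
  it.\<close>

lemma slice_tail:
  assumes "0 < \<eta>" "max R0 1 \<le> \<bar>t\<bar>"
  shows "slice \<eta> t \<le> (\<eta> + C) / t\<^sup>2"
proof -
  let ?z = "Complex t \<eta>"
  have z: "\<bar>t\<bar> \<le> cmod ?z" using abs_Re_le_cmod[of ?z] by simp
  have t2: "t\<^sup>2 \<le> (cmod ?z)\<^sup>2" using z by (simp add: cmod_power2)
  have t0: "0 < t\<^sup>2" using assms by auto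
  have "slice \<eta> t = Im (f ?z + 1 / ?z) + Im (- (1 / ?z))" by (simp add: slice_def)
  also have "\<dots> \<le> C / (cmod ?z)\<^sup>2 + \<eta> / (cmod ?z)\<^sup>2"
    using decay[of ?z] assms z abs_Im_le_cmod[of "f ?z + 1 / ?z"]
    unfolding Im_minus_inverse by (intro add_mono) auto
  also have "\<dots> = (\<eta> + C) / (cmod ?z)\<^sup>2" by (simp add: add_divide_distrib)
  also have "\<dots> \<le> (\<eta> + C) / t\<^sup>2"
    using t2 t0 assms C by (intro divide_left_mono) (auto intro!: mult_pos_pos)
  finally show ?thesis .
qed

lemma integrable_slice:
  assumes \<eta>: "0 < \<eta>"
  shows "integrable lborel (slice \<eta>)"
proof -
  define K where "K = max R0 1"
  have "compact (slice \<eta> ` {-K..K})"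
    by (intro compact_continuous_image continuous_on_subset[OF continuous_on_slice[OF \<eta>]]) auto
  then obtain B0 where B0: "\<And>t. t \<in> {-K..K} \<Longrightarrow> slice \<eta> t \<le> B0"
    by (meson bounded_imp_bdd_above bdd_above.unfold compact_imp_bounded imageI)
  define B where "B = max (max B0 0 * (1 + K\<^sup>2)) (2 * (\<eta> + C))"
  have bound: "slice \<eta> t \<le> B * inverse (1 + t\<^sup>2)" for t
  proof (cases "\<bar>t\<bar> \<le> K")
    case True
    then have "t\<^sup>2 \<le> K\<^sup>2" by (meson abs_le_square_iff abs_ge_self order_trans)
    then have "max B0 0 * (1 + t\<^sup>2) \<le> B"
      unfolding B_def by (intro order_trans[OF mult_left_mono max.cobounded1]) auto
    moreover have "slice \<eta> t \<le> max B0 0" using B0[of t] True by (simp add: abs_le_iff le_max_iff_disj)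
    then have "slice \<eta> t * (1 + t\<^sup>2) \<le> max B0 0 * (1 + t\<^sup>2)" by (intro mult_right_mono) auto
    ultimately have "slice \<eta> t * (1 + t\<^sup>2) \<le> B" by linarith
    moreover have "0 < 1 + t\<^sup>2" by (simp add: add_pos_nonneg)
    ultimately show ?thesis by (simp add: field_simps)
  next
    case False
    then have t: "K \<le> \<bar>t\<bar>" "1 \<le> \<bar>t\<bar>" by (auto simp: K_def)
    have "1 \<le> t\<^sup>2" using t(2) by (metis abs_le_square_iff abs_one one_power2)
    have "slice \<eta> t \<le> (\<eta> + C) / t\<^sup>2" using slice_tail[OF \<eta>, of t] t by (simp add: K_def)
    also have "\<dots> \<le> 2 * (\<eta> + C) / (1 + t\<^sup>2)"
      using \<open>1 \<le> t\<^sup>2\<close> \<eta> C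
    proof -
      have "(\<eta> + C) * (1 + t\<^sup>2) \<le> 2 * (\<eta> + C) * t\<^sup>2"
        using mult_left_mono[of "1 + t\<^sup>2" "2 * t\<^sup>2" "\<eta> + C"] \<open>1 \<le> t\<^sup>2\<close> \<eta> C by (simp add: algebra_simps)
      then show ?thesis using \<open>1 \<le> t\<^sup>2\<close>
        by (subst frac_le_eq) (auto simp: divide_le_0_iff)
    qed
    also have "\<dots> \<le> B / (1 + t\<^sup>2)" by (intro divide_right_mono) (auto simp: B_def)
    finally show ?thesis by (simp add: divide_inverse)
  qed
  show ?thesis
  proof (rule Bochner_Integration.integrable_bound)
    show "integrable lborel (\<lambda>t. B * inverse (1 + t\<^sup>2))"
      using integrable_lborel_inverse_1_plus_square by simp
    show "AE t in lborel. norm (slice \<eta> t) \<le> norm (B * inverse (1 + t\<^sup>2))"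
      using bound slice_nonneg[OF \<eta>] by (auto intro: order_trans[OF _ abs_ge_self])
  qed (use \<eta> in auto)
qed

lemma integrable_slice_Cauchy:
  assumes \<eta>: "0 < \<eta>" and \<zeta>: "0 < Im \<zeta>"
  shows "integrable lborel (\<lambda>t. of_real (slice \<eta> t) / (of_real t - \<zeta>))"
proof (rule Bochner_Integration.integrable_bound)
  show "integrable lborel (\<lambda>t. slice \<eta> t / Im \<zeta>)" using integrable_slice[OF \<eta>] by simp
  have "Im \<zeta> \<le> cmod (of_real t - \<zeta>)" for t
    using abs_Im_le_cmod[of "of_real t - \<zeta>"] by simp
  then have "cmod (of_real (slice \<eta> t) / (of_real t - \<zeta>)) \<le> slice \<eta> t / Im \<zeta>" for t
    using \<zeta> slice_nonneg[OF \<eta>, of t] unfolding norm_divide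
    by (intro frac_le) auto
  then show "AE t in lborel. norm (of_real (slice \<eta> t) / (of_real t - \<zeta>)) \<le> norm (slice \<eta> t / Im \<zeta>)"
    unfolding real_norm_def by (intro AE_I2 order_trans[OF _ abs_ge_self])
qed (use \<eta> in measurable)

text \<open>The shift of \<open>f\<close> by i \<eta> is holomorphic on Im w > - \<eta>, so
  \<open>half_plane_Poisson\<close> applies with margin \<eta> although \<open>f\<close> itself need
  not extend to the real axis.\<close>

lemma slice_Cauchy:
  assumes \<eta>: "0 < \<eta>" and \<zeta>: "0 < Im \<zeta>"
  shows "(LINT t|lborel. of_real (slice \<eta> t) / (of_real t - \<zeta>)) = pi * f (\<zeta> + \<i> * \<eta>)"
proof -
  let ?g = "\<lambda>w. f (w + \<i> * \<eta>)"
  have g_hol: "?g holomorphic_on {w. - \<eta> < Im w}"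
    by (rule holomorphic_on_compose_gen[OF _ hol, unfolded o_def]) (auto intro!: holomorphic_intros)
  have g_decay: "cmod (?g w) \<le> (1 + C) / cmod w" if w: "0 \<le> Im w" "max R0 1 \<le> cmod w" for w
  proof -
    let ?z = "w + \<i> * \<eta>"
    have "(cmod w)\<^sup>2 \<le> (cmod ?z)\<^sup>2" using w \<eta> by (simp add: cmod_power2 power_mono)
    then have wz: "cmod w \<le> cmod ?z" using norm_ge_zero power2_le_imp_le by blast
    then have z1: "1 \<le> cmod ?z" "R0 \<le> cmod ?z" using w by auto
    have "cmod (?g w) = cmod ((f ?z + 1 / ?z) - 1 / ?z)" by simp
    also have "\<dots> \<le> cmod (f ?z + 1 / ?z) + cmod (1 / ?z)" by (rule norm_triangle_ineq4)
    also have "\<dots> \<le> C / (cmod ?z)\<^sup>2 + 1 / cmod ?z"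
      using decay[of ?z] z1 w \<eta> by (intro add_mono) (auto simp: norm_divide)
    also have "\<dots> \<le> C / cmod ?z + 1 / cmod ?z"
    proof -
      have "cmod ?z \<le> (cmod ?z)\<^sup>2" "0 < cmod ?z" using z1 by (auto intro: self_le_power)
      then show ?thesis using C by (intro add_mono divide_left_mono mult_pos_pos) auto
    qed
    also have "\<dots> = (1 + C) / cmod ?z" by (simp add: add_divide_distrib)
    also have "\<dots> \<le> (1 + C) / cmod w"
      using wz w C by (intro divide_left_mono) (auto intro!: mult_pos_pos)
    finally show ?thesis .
  qed
  have "(\<lambda>n. integral {- real n..real n} (\<lambda>x. of_real (Im (?g (of_real x))) / (of_real x - \<zeta>))) \<longlonglongrightarrow> pi * ?g \<zeta>"
    by (rule half_plane_Poisson[OF g_hol \<eta> _ _ \<zeta>, of "max R0 1" "1 + C"]) (use C g_decay in auto)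
  moreover have "of_real x + \<i> * \<eta> = Complex x \<eta>" for x :: real by (simp add: complex_eq_iff)
  ultimately have "(\<lambda>n. integral {- real n..real n} (\<lambda>x. of_real (slice \<eta> x) / (of_real x - \<zeta>))) \<longlonglongrightarrow> pi * ?g \<zeta>"
    by (simp add: slice_def)
  then show ?thesis
    using LIMSEQ_integral_intervals[OF integrable_slice_Cauchy[OF \<eta> \<zeta>]] LIMSEQ_unique by blast
qed



text \<open>Put \<zeta> = i y in \<open>slice_Cauchy\<close>, multiply by y and let y grow: y / (t -
  i y) tends to i with modulus at most 1, whereas y f (i (y + \<eta>)) tends to i because f z
  behaves like - 1 / z.\<close>

lemma integral_slice:
  assumes \<eta>: "0 < \<eta>"
  shows "(LINT t|lborel. slice \<eta> t) = pi"
proof -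
  let ?y = "\<lambda>n. real (Suc n)"
  let ?F = "\<lambda>n t. of_real (?y n) * (of_real (slice \<eta> t) / (of_real t - \<i> * of_real (?y n)))"
  have L1: "(\<lambda>n. LINT t|lborel. ?F n t) \<longlonglongrightarrow> (LINT t|lborel. \<i> * of_real (slice \<eta> t))"
  proof (rule integral_dominated_convergence)
    show "integrable lborel (slice \<eta>)" by (rule integrable_slice[OF \<eta>])
    show "AE t in lborel. (\<lambda>n. ?F n t) \<longlonglongrightarrow> \<i> * of_real (slice \<eta> t)"
    proof (rule AE_I2)
      fix t
      have "(\<lambda>n. of_real (slice \<eta> t) / (of_real t * of_real (1 / ?y n) - \<i>)) \<longlonglongrightarrow> of_real (slice \<eta> t) / (of_real t * of_real 0 - \<i>)"
        by (intro tendsto_intros LIMSEQ_inverse_real_Suc) auto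
      moreover have "of_real (slice \<eta> t) / (of_real t * of_real (1 / ?y n) - \<i>) = ?F n t" for n
      proof -
        have "of_real t * of_real (1 / ?y n) - \<i> = (of_real t - \<i> * of_real (?y n)) / of_real (?y n)"
          by (simp add: diff_divide_distrib del: of_nat_Suc)
        then show ?thesis by (simp del: of_nat_Suc)
      qed
      ultimately have "(\<lambda>n. ?F n t) \<longlonglongrightarrow> of_real (slice \<eta> t) / (of_real t * of_real 0 - \<i>)"
        by (simp only:)
      then show "(\<lambda>n. ?F n t) \<longlonglongrightarrow> \<i> * of_real (slice \<eta> t)"
        by (simp add: mult.commute del: of_nat_Suc)
    qed
    fix n
    have "cmod (?F n t) \<le> slice \<eta> t" for t
    proof -
      have "?y n \<le> cmod (of_real t - \<i> * of_real (?y n))"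
        using abs_Im_le_cmod[of "of_real t - \<i> * of_real (?y n)"] by (simp del: of_nat_Suc)
      moreover have "cmod (?F n t) = slice \<eta> t * (?y n / cmod (of_real t - \<i> * of_real (?y n)))"
        using slice_nonneg[OF \<eta>, of t] by (simp add: norm_mult norm_divide del: of_nat_Suc)
      moreover have "slice \<eta> t * (?y n / cmod (of_real t - \<i> * of_real (?y n))) \<le> slice \<eta> t * 1"
        using slice_nonneg[OF \<eta>, of t] calculation(1)
        by (intro mult_left_mono) (auto simp: divide_le_eq_1 simp del: of_nat_Suc)
      ultimately show ?thesis by linarith
    qed
    then show "AE t in lborel. cmod (?F n t) \<le> slice \<eta> t" by simp
  qed (use \<eta> in measurable)
  have L2: "(LINT t|lborel. ?F n t) = of_real (?y n) * (pi * f (\<i> * of_real (?y n + \<eta>)))" for n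
    using slice_Cauchy[OF \<eta>, of "\<i> * of_real (?y n)"] unfolding integral_mult_right_zero
    by (simp add: distrib_left del: of_nat_Suc)
  have L3: "(\<lambda>n. of_real (?y n) * (pi * f (\<i> * of_real (?y n + \<eta>)))) \<longlonglongrightarrow> pi * \<i>"
  proof -
    have "(\<lambda>n. of_real (?y n) * f (\<i> * of_real (?y n + \<eta>)) - \<i> * of_real (?y n / (?y n + \<eta>))) \<longlonglongrightarrow> 0"
    proof (rule Lim_null_comparison)
      have "\<forall>\<^sub>F n in sequentially. real n > R0"
        using filterlim_real_sequentially unfolding filterlim_at_top_dense by blast
      then show "\<forall>\<^sub>F n in sequentially. cmod (of_real (?y n) * f (\<i> * of_real (?y n + \<eta>)) - \<i> * of_real (?y n / (?y n + \<eta>))) \<le> C * (1 / ?y n)"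
      proof eventually_elim
        case (elim n)
        let ?z = "\<i> * complex_of_real (?y n + \<eta>)"
        have z: "cmod ?z = ?y n + \<eta>" using \<eta> unfolding norm_mult norm_of_real by simp
        have y: "0 < ?y n" "?y n \<le> ?y n + \<eta>" using \<eta> by auto
        have "\<i> * of_real (?y n / (?y n + \<eta>)) = - (of_real (?y n) * (1 / ?z))"
          by (simp add: divide_inverse del: of_nat_Suc of_real_of_nat_eq)
        then have "of_real (?y n) * f ?z - \<i> * of_real (?y n / (?y n + \<eta>)) = of_real (?y n) * (f ?z + 1 / ?z)"
          by (simp add: distrib_left del: of_nat_Suc of_real_of_nat_eq)
        then have "cmod (of_real (?y n) * f ?z - \<i> * of_real (?y n / (?y n + \<eta>))) = ?y n * cmod (f ?z + 1 / ?z)"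
          by (simp add: norm_mult del: of_nat_Suc)
        also have "\<dots> \<le> ?y n * (C / (?y n + \<eta>)\<^sup>2)"
          using decay[of ?z] z y \<eta> elim by (intro mult_left_mono) (auto simp del: of_real_add of_nat_Suc)
        also have "\<dots> \<le> ?y n * (C / (?y n)\<^sup>2)"
          using y C by (intro mult_left_mono divide_left_mono power_mono mult_pos_pos zero_less_power) auto
        also have "\<dots> = C * (1 / ?y n)" by (simp add: power2_eq_square del: of_nat_Suc)
        finally show ?case .
      qed
      show "(\<lambda>n. C * (1 / ?y n)) \<longlonglongrightarrow> 0"
        using tendsto_mult_right_zero[OF LIMSEQ_inverse_real_Suc] .
    qed
    moreover have "(\<lambda>n. \<i> * of_real (?y n / (?y n + \<eta>))) \<longlonglongrightarrow> \<i> * of_real 1"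
    proof -
      have "(\<lambda>n. 1 / (1 + \<eta> * (1 / ?y n))) \<longlonglongrightarrow> 1 / (1 + \<eta> * 0)"
        by (intro tendsto_intros LIMSEQ_inverse_real_Suc) auto
      moreover have "1 / (1 + \<eta> * (1 / ?y n)) = ?y n / (?y n + \<eta>)" for n
        using \<eta> by (simp add: field_simps)
      ultimately show ?thesis by (intro tendsto_intros) (simp del: of_nat_Suc)
    qed
    ultimately have "(\<lambda>n. of_real (?y n) * f (\<i> * of_real (?y n + \<eta>))) \<longlonglongrightarrow> 0 + \<i> * of_real 1"
      using tendsto_add by fastforce
    then have "(\<lambda>n. pi * (of_real (?y n) * f (\<i> * of_real (?y n + \<eta>)))) \<longlonglongrightarrow> pi * (0 + \<i> * of_real 1)"
      by (rule tendsto_mult_left)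
    then show ?thesis by (simp add: mult_ac del: of_nat_Suc)
  qed
  have "(LINT t|lborel. \<i> * of_real (slice \<eta> t)) = pi * \<i>"
    by (rule LIMSEQ_unique[OF L1]) (simp only: L2 L3)
  then show ?thesis by (simp add: integral_complex_of_real complex_eq_iff)
qed


definition slice_measure :: "real \<Rightarrow> real measure" where
  "slice_measure \<eta> = density lborel (\<lambda>t. ennreal (slice \<eta> t / pi))"

lemma real_distribution_slice_measure:
  assumes \<eta>: "0 < \<eta>"
  shows "real_distribution (slice_measure \<eta>)"
proof -
  have "emeasure (slice_measure \<eta>) UNIV = (\<integral>\<^sup>+t. ennreal (slice \<eta> t / pi) \<partial>lborel)"
    using \<eta> by (simp add: slice_measure_def emeasure_density)
  also have "\<dots> = ennreal (LINT t|lborel. slice \<eta> t / pi)"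
    using integrable_slice[OF \<eta>] slice_nonneg[OF \<eta>] by (intro nn_integral_eq_integral) auto
  also have "\<dots> = 1" using integral_slice[OF \<eta>] by simp
  finally have "prob_space (slice_measure \<eta>)"
    by (intro prob_spaceI) (simp add: slice_measure_def)
  then show ?thesis
    by (simp add: real_distribution_def real_distribution_axioms_def slice_measure_def)
qed

lemma Stieltjes_slice_measure:
  assumes \<eta>: "0 < \<eta>" and \<zeta>: "0 < Im \<zeta>"
  shows "(LINT t|slice_measure \<eta>. 1 / (of_real t - \<zeta>)) = f (\<zeta> + \<i> * \<eta>)"
proof -
  have "(LINT t|slice_measure \<eta>. 1 / (of_real t - \<zeta>))
      = (LINT t|lborel. (slice \<eta> t / pi) *\<^sub>R (1 / (of_real t - \<zeta>)))"
    unfolding slice_measure_def using \<eta> slice_nonneg[OF \<eta>] by (intro integral_density) auto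
  also have "\<dots> = (LINT t|lborel. of_real (slice \<eta> t) / (of_real t - \<zeta>) / pi)"
    by (simp add: scaleR_conv_of_real mult.commute)
  also have "\<dots> = f (\<zeta> + \<i> * \<eta>)"
    using slice_Cauchy[OF \<eta> \<zeta>] unfolding integral_divide_zero by simp
  finally show ?thesis .
qed

lemma Im_lower_bound:
  assumes Y: "0 < Y" "R0 \<le> Y" and \<eta>: "0 \<le> \<eta>"
  shows "1 - (\<eta> + C) / Y \<le> Y * Im (f (\<i> * of_real (Y + \<eta>)))"
proof -
  let ?z = "\<i> * complex_of_real (Y + \<eta>)"
  have z: "cmod ?z = Y + \<eta>" "Im ?z = Y + \<eta>" using assms unfolding norm_mult norm_of_real by auto
  have "- cmod (f ?z + 1 / ?z) \<le> Im (f ?z + 1 / ?z)"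
    using abs_Im_le_cmod[of "f ?z + 1 / ?z"] by linarith
  moreover have "cmod (f ?z + 1 / ?z) \<le> C / (Y + \<eta>)\<^sup>2"
    using decay[of ?z] z assms by (simp only: z)
  moreover have "Im (f ?z + 1 / ?z) = Im (f ?z) - Im (- (1 / ?z))" by simp
  moreover have "Im (- (1 / ?z)) = 1 / (Y + \<eta>)"
    unfolding Im_minus_inverse z by (simp add: power2_eq_square)
  ultimately have "1 / (Y + \<eta>) - C / (Y + \<eta>)\<^sup>2 \<le> Im (f ?z)" by linarith
  then have "Y * (1 / (Y + \<eta>) - C / (Y + \<eta>)\<^sup>2) \<le> Y * Im (f ?z)"
    using Y by (intro mult_left_mono) auto
  moreover have "Y * (1 / (Y + \<eta>)) = 1 - \<eta> / (Y + \<eta>)" using Y \<eta> by (simp add: field_simps)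
  moreover have "\<eta> / (Y + \<eta>) \<le> \<eta> / Y" using Y \<eta> by (intro divide_left_mono mult_pos_pos) auto
  moreover have "Y * (C / (Y + \<eta>)\<^sup>2) \<le> Y * (C / Y\<^sup>2)"
    using Y \<eta> C by (intro mult_left_mono divide_left_mono power_mono mult_pos_pos zero_less_power) auto
  moreover have "Y * (C / Y\<^sup>2) = C / Y" using Y by (simp add: power2_eq_square)
  ultimately show ?thesis by (simp add: right_diff_distrib add_divide_distrib)
qed

text \<open>Y Im (1 / (t - i Y)) = Y^2 / (t^2 + Y^2) is at most 1 everywhere and at most 1 / 2 off
  the interval, so its mean is at most (1 + mass) / 2; this mean equals Y Im f (i (Y + \<eta>)),
  which is near 1. The bound does not involve \<eta>, as tightness requires.\<close>

lemma slice_measure_interval: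
  assumes \<eta>: "0 < \<eta>" "\<eta> \<le> 1" and Y: "0 < Y" "R0 \<le> Y"
  shows "1 - 2 * (1 + C) / Y \<le> measure (slice_measure \<eta>) {-Y<..Y}"
proof -
  interpret real_distribution "slice_measure \<eta>" by (rule real_distribution_slice_measure[OF \<eta>(1)])
  let ?\<phi> = "\<lambda>t. Y * Im (1 / (of_real t - \<i> * of_real Y))"
  have \<phi>: "?\<phi> t = Y\<^sup>2 / (t\<^sup>2 + Y\<^sup>2)" for t by (simp add: Im_divide power2_eq_square)
  have pos: "0 < t\<^sup>2 + Y\<^sup>2" for t using Y by (simp add: add_nonneg_pos)
  have bound: "cmod (1 / (of_real t - \<i> * of_real Y)) \<le> 1 / Y" for t
    using abs_Im_le_cmod[of "of_real t - \<i> * of_real Y"] Y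
    by (simp add: norm_divide frac_le)
  have int: "integrable (slice_measure \<eta>) (\<lambda>t. 1 / (of_real t - \<i> * of_real Y))"
    by (rule integrable_const_bound[of _ "1 / Y"]) (use bound in auto)
  have "1 - (1 + C) / Y \<le> 1 - (\<eta> + C) / Y"
    using \<eta> Y by (simp add: divide_right_mono)
  also have "\<dots> \<le> Y * Im (f (\<i> * of_real (Y + \<eta>)))"
    using Im_lower_bound[OF Y, of \<eta>] \<eta> by simp
  also have "\<dots> = Y * Im (LINT t|slice_measure \<eta>. 1 / (of_real t - \<i> * of_real Y))"
    using Stieltjes_slice_measure[OF \<eta>(1), of "\<i> * of_real Y"] Y by (simp add: distrib_left)
  also have "\<dots> = (LINT t|slice_measure \<eta>. ?\<phi> t)"
    using int by (simp del: Im_complex_of_real)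
  also have "\<dots> \<le> (LINT t|slice_measure \<eta>. 1 / 2 + 1 / 2 * indicator {-Y<..Y} t)"
  proof (rule integral_mono)
    show "integrable (slice_measure \<eta>) ?\<phi>" using int by simp
    show "integrable (slice_measure \<eta>) (\<lambda>t. 1 / 2 + 1 / 2 * indicator {-Y<..Y} t :: real)"
      by (intro Bochner_Integration.integrable_add integrable_mult_right integrable_const integrable_real_indicator)
        (auto simp: emeasure_eq_measure)
    fix t
    show "?\<phi> t \<le> 1 / 2 + 1 / 2 * indicator {-Y<..Y} t"
    proof (cases "t \<in> {-Y<..Y}")
      case True
      then show ?thesis unfolding \<phi> using pos[of t] by (simp add: divide_le_eq_1)
    next
      case False
      then have "\<bar>Y\<bar> \<le> \<bar>t\<bar>" using Y by auto
      then have "Y\<^sup>2 \<le> t\<^sup>2" by (simp add: abs_le_square_iff)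
      then show ?thesis unfolding \<phi> using pos[of t] False by (simp add: divide_simps)
    qed
  qed
  also have "\<dots> = 1 / 2 + 1 / 2 * measure (slice_measure \<eta>) {-Y<..Y}"
    by (subst Bochner_Integration.integral_add) (use prob_space in \<open>auto simp: emeasure_eq_measure\<close>)
  finally show ?thesis by (simp add: field_simps)
qed

text \<open>Tightness supplies the weakly convergent subsequence. For fixed z the Cauchy kernel is
  bounded and continuous, so the transforms converge too; being values of \<open>f\<close> at z + i
  \<eta>, they also converge to f z.\<close>

theorem Stieltjes_representation:
  "\<exists>\<mu>. real_distribution \<mu> \<and> (\<forall>z. 0 < Im z \<longrightarrow> f z = (LINT t|\<mu>. 1 / (of_real t - z)))"
proof -
  let ?\<eta> = "\<lambda>n. 1 / real (Suc n)"
  let ?\<nu> = "\<lambda>n. slice_measure (?\<eta> n)"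
  have \<eta>: "0 < ?\<eta> n" "?\<eta> n \<le> 1" for n by auto
  have rd: "real_distribution (?\<nu> n)" for n by (rule real_distribution_slice_measure[OF \<eta>(1)])
  have "tight ?\<nu>"
    unfolding tight_def
  proof (intro conjI allI impI rd)
    fix e :: real assume e: "0 < e"
    define Y where "Y = max (max R0 1) (2 * (1 + C) / e + 1)"
    have Y: "0 < Y" "R0 \<le> Y" "2 * (1 + C) / e < Y" by (auto simp: Y_def)
    then have "2 * (1 + C) / Y < e" using e by (simp add: divide_simps mult.commute)
    then have "1 - e < measure (?\<nu> n) {-Y<..Y}" for n
      using slice_measure_interval[OF \<eta> Y(1,2), of n] by linarith
    then show "\<exists>a b. a < b \<and> (\<forall>n. 1 - e < measure (?\<nu> n) {a<..b})"
      using Y(1) by (intro exI[of _ "-Y"] exI[of _ Y]) auto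
  qed
  then obtain r \<mu> where r: "strict_mono (r :: nat \<Rightarrow> nat)" and \<mu>: "real_distribution \<mu>"
      and conv: "weak_conv_m (?\<nu> \<circ> id \<circ> r) \<mu>"
    using tight_imp_convergent_subsubsequence[OF _ strict_mono_id] by blast
  have "f z = (LINT t|\<mu>. 1 / (of_real t - z))" if z: "0 < Im z" for z
  proof (rule LIMSEQ_unique)
    have ne: "complex_of_real t \<noteq> z" for t using z by auto
    have "cmod (1 / (of_real t - z)) \<le> 1 / Im z" for t
      using abs_Im_le_cmod[of "of_real t - z"] z by (simp add: norm_divide frac_le)
    then have "(\<lambda>n. LINT t|(?\<nu> \<circ> id \<circ> r) n. 1 / (of_real t - z)) \<longlonglongrightarrow> (LINT t|\<mu>. 1 / (of_real t - z))"
      by (intro weak_conv_imp_integral_bdd_continuous_conv[OF _ \<mu> conv]) (use rd ne in auto)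
    then show "(\<lambda>n. f (z + \<i> * of_real (?\<eta> (r n)))) \<longlonglongrightarrow> (LINT t|\<mu>. 1 / (of_real t - z))"
      using Stieltjes_slice_measure[OF \<eta>(1) z] by simp
    have "isCont f z"
      using holomorphic_on_imp_continuous_on[OF hol] z
      by (simp add: continuous_on_eq_continuous_at open_halfspace_Im_gt)
    moreover have "(\<lambda>n. z + \<i> * of_real (?\<eta> (r n))) \<longlonglongrightarrow> z + \<i> * of_real 0"
      using LIMSEQ_subseq_LIMSEQ[OF LIMSEQ_inverse_real_Suc r] unfolding o_def
      by (intro tendsto_intros)
    ultimately show "(\<lambda>n. f (z + \<i> * of_real (?\<eta> (r n)))) \<longlonglongrightarrow> f z"
      using isCont_tendsto_compose by fastforce
  qed
  with \<mu> show ?thesis by blast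
qed

end

section \<open>Compactly supported distributions and their moments\<close>

abbreviation Stieltjes :: "real measure \<Rightarrow> complex \<Rightarrow> complex" where
  "Stieltjes \<mu> z \<equiv> (LINT t|\<mu>. 1 / (of_real t - z))"

lemma cmod_Cauchy_kernel_le:
  assumes "0 < Im z"
  shows "cmod (1 / (of_real t - z)) \<le> 1 / Im z"
  using abs_Im_le_cmod[of "of_real t - z"] assms by (simp add: norm_divide frac_le)

section \<open>Locating the support of a distribution from its Stieltjes transform\<close>

context real_distribution
begin

lemma integrable_Cauchy_kernel:
  assumes "0 < Im z"
  shows "integrable M (\<lambda>t. 1 / (of_real t - z))"
  by (rule integrable_const_bound[of _ "1 / Im z"]) (use cmod_Cauchy_kernel_le[OF assms] in auto)

text \<open>The Poisson kernel \<eta> / ((s - t)^2 + \<eta>^2) is at least 1 / (2 \<eta>) on the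
  interval and nonnegative elsewhere.\<close>

lemma prob_interval_le_Stieltjes:
  assumes \<eta>: "0 < \<eta>"
  shows "prob {t - \<eta>..t + \<eta>} \<le> 2 * \<eta> * Im (Stieltjes M (Complex t \<eta>))"
proof -
  let ?z = "Complex t \<eta>"
  have "prob {t - \<eta>..t + \<eta>} = (LINT s|M. indicator {t - \<eta>..t + \<eta>} s)"
    by simp
  also have "\<dots> \<le> (LINT s|M. 2 * \<eta> * Im (1 / (of_real s - ?z)))"
  proof (rule integral_mono)
    show "integrable M (\<lambda>s. 2 * \<eta> * Im (1 / (of_real s - ?z)))"
      using integrable_Cauchy_kernel[of ?z] \<eta> by simp
    fix s
    have k: "Im (1 / (of_real s - ?z)) = \<eta> / ((s - t)\<^sup>2 + \<eta>\<^sup>2)"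
      by (simp add: Im_divide)
    have pos: "0 < (s - t)\<^sup>2 + \<eta>\<^sup>2" using \<eta> by (simp add: add_nonneg_pos)
    show "indicator {t - \<eta>..t + \<eta>} s \<le> 2 * \<eta> * Im (1 / (of_real s - ?z))"
    proof (cases "s \<in> {t - \<eta>..t + \<eta>}")
      case True
      then have "(s - t)\<^sup>2 \<le> \<eta>\<^sup>2" by (intro power2_le_iff_abs_le[THEN iffD2]) (use \<eta> in auto)
      then show ?thesis unfolding k using pos True \<eta> by (simp add: pos_le_divide_eq power2_eq_square)
    next
      case False
      then show ?thesis unfolding k using pos \<eta> by simp
    qed
  qed (auto simp: emeasure_eq_measure)
  also have "\<dots> = 2 * \<eta> * Im (Stieltjes M ?z)"
    using integrable_Cauchy_kernel[of ?z] \<eta> by simp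
  finally show ?thesis .
qed

text \<open>Covering \<open>[c, d]\<close> by about \<open>n\<close> intervals of length of order \<open>1 / n\<close>, each of measure of order \<open>1 / n\<^sup>2\<close>.\<close>

lemma prob_interval_eq_0:
  assumes K: "\<And>t \<eta>. t \<in> {c..d} \<Longrightarrow> 0 < \<eta> \<Longrightarrow> Im (Stieltjes M (Complex t \<eta>)) \<le> K * \<eta>"
    and cd: "c < d"
  shows "prob {c..d} = 0"
proof -
  have K0: "0 \<le> K"
    using order_trans[OF measure_nonneg prob_interval_le_Stieltjes[of 1 c]] K[of c 1] cd by auto
  have "prob {c..d} \<le> 4 * K * (d - c)\<^sup>2 * (1 / real (Suc n))" for n
  proof -
    define N where "N = Suc n"
    define h where "h = (d - c) / N"
    have N: "1 \<le> real N" by (simp add: N_def)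
    have h: "0 < h" "N * h = d - c" using cd N by (auto simp: h_def)
    have sub: "{c..d} \<subseteq> (\<Union>i\<le>N. {(c + i * h) - h..(c + i * h) + h})"
    proof
      fix s assume s: "s \<in> {c..d}"
      define i where "i = nat \<lfloor>(s - c) / h\<rfloor>"
      have "0 \<le> (s - c) / h" using s h by simp
      then have i: "real i \<le> (s - c) / h" "(s - c) / h < real i + 1"
        unfolding i_def by linarith+
      have "real i * h \<le> s - c" "s - c < real i * h + h"
        using i h by (auto simp: pos_le_divide_eq pos_divide_less_eq algebra_simps)
      \<comment> \<open>Keeps the centre c + i h inside [c, d], where the bound \<open>K\<close> is
        available.\<close>
      moreover have "real i \<le> N"
      proof -
        have "(s - c) / h \<le> (d - c) / h" using s h by (intro divide_right_mono) auto
        also have "\<dots> = N" using h by (simp flip: h(2))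
        finally show ?thesis using i by linarith
      qed
      ultimately show "s \<in> (\<Union>i\<le>N. {(c + i * h) - h..(c + i * h) + h})"
        using h by (intro UN_I[of i]) auto
    qed
    have "prob {c..d} \<le> prob (\<Union>i\<le>N. {(c + i * h) - h..(c + i * h) + h})"
      by (rule finite_measure_mono[OF sub]) auto
    also have "\<dots> \<le> (\<Sum>i\<le>N. prob {(c + i * h) - h..(c + i * h) + h})"
      by (rule finite_measure_subadditive_finite) auto
    also have "\<dots> \<le> (\<Sum>i\<le>N. 2 * h * (K * h))"
    proof (rule sum_mono)
      fix i assume "i \<in> {..N}"
      then have "real i * h \<le> N * h" using h by (intro mult_right_mono) auto
      then have "c + i * h \<in> {c..d}" using h by auto
      then have "Im (Stieltjes M (Complex (c + i * h) h)) \<le> K * h" using K h by blast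
      then have "2 * h * Im (Stieltjes M (Complex (c + i * h) h)) \<le> 2 * h * (K * h)"
        using h by (intro mult_left_mono) auto
      then show "prob {(c + i * h) - h..(c + i * h) + h} \<le> 2 * h * (K * h)"
        using prob_interval_le_Stieltjes[OF h(1), of "c + i * h"] by linarith
    qed
    also have "\<dots> = (real N + 1) * (2 * K * h\<^sup>2)" by (simp add: power2_eq_square)
    also have "\<dots> \<le> (2 * real N) * (2 * K * h\<^sup>2)" using N K0 by (intro mult_right_mono) auto
    also have "\<dots> = 4 * K * (d - c)\<^sup>2 * (1 / real N)"
      using N by (simp add: h_def power_divide power2_eq_square)
    finally show ?thesis by (simp add: N_def)
  qed
  moreover have "(\<lambda>n. 4 * K * (d - c)\<^sup>2 * (1 / real (Suc n))) \<longlonglongrightarrow> 0"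
    by (intro tendsto_mult_right_zero LIMSEQ_Suc[OF lim_const_over_n])
  ultimately have "prob {c..d} \<le> 0"
    by (intro LIMSEQ_le_const) auto
  then show ?thesis by (simp add: measure_le_0_iff)
qed

text \<open>Compact intervals in |t| > b are null by \<open>prob_interval_eq_0\<close>, and
  countably many of them exhaust that set. The constant may depend on \<open>\<delta>\<close>
  because each interval keeps a positive distance from [-b, b].\<close>

lemma AE_support:
  assumes K: "\<And>\<delta>. 0 < \<delta> \<Longrightarrow> \<exists>K. \<forall>z. 0 < Im z \<longrightarrow> b + \<delta> \<le> cmod z \<longrightarrow> Im (Stieltjes M z) \<le> K * Im z"
    and b: "0 \<le> b"
  shows "AE t in M. \<bar>t\<bar> \<le> b"
proof -
  \<comment> \<open>The far end b + 1 + (n + 1) exceeds the near end for every n, so no interval is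
    degenerate.\<close>
  let ?A = "\<lambda>n. {b + 1 / real (Suc n)..b + 1 + real (Suc n)}"
  let ?B = "\<lambda>n. {- (b + 1 + real (Suc n)).. - (b + 1 / real (Suc n))}"
  have null: "?A n \<in> null_sets M \<and> ?B n \<in> null_sets M" for n
  proof -
    obtain K where K: "\<And>z. 0 < Im z \<Longrightarrow> b + 1 / real (Suc n) \<le> cmod z \<Longrightarrow> Im (Stieltjes M z) \<le> K * Im z"
      using assms(1)[of "1 / real (Suc n)"] by auto
    have *: "Im (Stieltjes M (Complex t \<eta>)) \<le> K * \<eta>" if "b + 1 / real (Suc n) \<le> \<bar>t\<bar>" "0 < \<eta>" for t \<eta>
      using K[of "Complex t \<eta>"] that abs_Re_le_cmod[of "Complex t \<eta>"] by auto
    have "1 / real (Suc n) \<le> 1" by simp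
    then have "1 / real (Suc n) < 1 + real (Suc n)" by linarith
    moreover have "0 < 1 / real (Suc n)" by simp
    ultimately have "prob (?A n) = 0" "prob (?B n) = 0"
      using b by (auto intro!: prob_interval_eq_0[where K = K] * simp del: of_nat_Suc)
    then show ?thesis by (auto simp: null_sets_def emeasure_eq_measure)
  qed
  have "(\<Union>n. ?A n \<union> ?B n) \<in> null_sets M"
    using null by (intro null_sets_UN) auto
  then have "AE t in M. t \<notin> (\<Union>n. ?A n \<union> ?B n)" by (rule AE_not_in)
  then show ?thesis
  proof eventually_elim
    case (elim t)
    show "\<bar>t\<bar> \<le> b"
    proof (rule ccontr)
      assume "\<not> \<bar>t\<bar> \<le> b"
      then obtain n1 where n1: "inverse (real (Suc n1)) < \<bar>t\<bar> - b"
        using reals_Archimedean[of "\<bar>t\<bar> - b"] by auto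
      obtain n2 where n2: "\<bar>t\<bar> < real n2" using reals_Archimedean2 by blast
      define n where "n = max n1 n2"
      have "inverse (real (Suc n)) \<le> inverse (real (Suc n1))"
        by (intro le_imp_inverse_le) (auto simp: n_def)
      then have "b + 1 / real (Suc n) \<le> \<bar>t\<bar>" using n1 by (simp add: inverse_eq_divide)
      moreover have "\<bar>t\<bar> \<le> b + 1 + real (Suc n)" using n2 b by (simp add: n_def)
      ultimately have "t \<in> ?A n \<union> ?B n" by (auto simp: abs_if split: if_splits)
      with elim show False by blast
    qed
  qed
qed

end

section \<open>Moments and their recovery from the Stieltjes transform\<close>

locale compactly_supported_distribution = real_distribution +
  fixes b :: real
  assumes AE_bounded: "AE t in M. \<bar>t\<bar> \<le> b"
begin

definition moment :: "nat \<Rightarrow> real" where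
  "moment k = (LINT t|M. t ^ k)"

text \<open>Serves a recursion: \<open>moment_LIMSEQ\<close> reads the k-th moment off this
  transform and \<open>moment_transform_Suc\<close> then gives the next transform. From the
  Stieltjes transform at k = 0 all moments arise by algebra and limits of sequences.\<close>

definition moment_transform :: "nat \<Rightarrow> complex \<Rightarrow> complex" where
  "moment_transform k z = (LINT t|M. of_real (t ^ k) / (of_real t - z))"

lemma b_nonneg: "0 \<le> b"
proof (rule ccontr)
  assume "\<not> 0 \<le> b"
  then have "\<bar>t\<bar> \<le> b \<longleftrightarrow> False" for t :: real by auto
  then show False using AE_bounded by simp
qed

lemma AE_power_le: "AE t in M. \<bar>t ^ k\<bar> \<le> b ^ k"
  using AE_bounded by eventually_elim (simp add: power_abs power_mono)

lemma integrable_continuous: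
  fixes f :: "real \<Rightarrow> real"
  assumes "continuous_on UNIV f"
  shows "integrable M f"
proof -
  have "compact (f ` {-b..b})"
    by (intro compact_continuous_image continuous_on_subset[OF assms]) auto
  then have "bounded (f ` {-b..b})" by (rule compact_imp_bounded)
  then obtain B where "\<forall>t \<in> {-b..b}. \<bar>f t\<bar> \<le> B"
    unfolding bounded_iff by auto
  then have B: "\<And>t. t \<in> {-b..b} \<Longrightarrow> \<bar>f t\<bar> \<le> B" by blast
  have "AE t in M. norm (f t) \<le> B"
    using AE_bounded by eventually_elim (auto intro!: B)
  then show ?thesis
    using borel_measurable_continuous_onI[OF assms]
    by (intro integrable_const_bound) (simp_all add: measurable_cong_sets[OF events_eq_borel refl])
qed

lemma AE_moment_kernel_le:
  assumes "0 < Im z"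
  shows "AE t in M. cmod (of_real (t ^ k) / (of_real t - z)) \<le> b ^ k / Im z"
  using AE_power_le[of k]
proof eventually_elim
  case (elim t)
  have "cmod (of_real (t ^ k) / (of_real t - z)) = \<bar>t ^ k\<bar> * cmod (1 / (of_real t - z))"
    by (simp add: norm_divide power_abs norm_power)
  also have "\<dots> \<le> b ^ k * (1 / Im z)"
    using elim cmod_Cauchy_kernel_le[OF assms] b_nonneg by (intro mult_mono) auto
  finally show ?case by simp
qed

lemma integrable_moment_kernel:
  assumes "0 < Im z"
  shows "integrable M (\<lambda>t. of_real (t ^ k) / (of_real t - z))"
  by (rule integrable_const_bound[OF AE_moment_kernel_le[OF assms]]) simp

lemma moment_transform_Suc:
  assumes z: "0 < Im z"
  shows "moment_transform (Suc k) z = of_real (moment k) + z * moment_transform k z"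
proof -
  have "of_real (t ^ Suc k) / (of_real t - z) = of_real (t ^ k) + z * (of_real (t ^ k) / (of_real t - z))" for t :: real
  proof -
    have "of_real t - z \<noteq> 0" using z by auto
    then show ?thesis by (simp add: field_simps)
  qed
  then have "moment_transform (Suc k) z = (LINT t|M. of_real (t ^ k) + z * (of_real (t ^ k) / (of_real t - z)))"
    unfolding moment_transform_def by simp
  also have "\<dots> = (LINT t|M. of_real (t ^ k)) + (LINT t|M. z * (of_real (t ^ k) / (of_real t - z)))"
  proof (rule Bochner_Integration.integral_add)
    show "integrable M (\<lambda>t. complex_of_real (t ^ k))"
      by (intro integrable_of_real integrable_continuous continuous_intros)
    show "integrable M (\<lambda>t. z * (of_real (t ^ k) / (of_real t - z)))"
      by (intro integrable_mult_right integrable_moment_kernel z)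
  qed
  also have "\<dots> = (LINT t|M. of_real (t ^ k)) + z * moment_transform k z"
    unfolding moment_transform_def by (simp only: integral_mult_right_zero)
  finally show ?thesis by (simp add: moment_def flip: of_real_power)
qed

lemma moment_transform_0: "moment_transform 0 z = Stieltjes M z"
  by (simp add: moment_transform_def)

text \<open>The integrand - i y t^k / (t - i y) tends to t^k as y grows and is dominated by |t^k|,
  since |t - i y| \<ge> y. Integer heights make it a limit of a sequence, which preserves
  measurability.\<close>

lemma moment_LIMSEQ:
  "(\<lambda>n. - (\<i> * of_real (real (Suc n)) * moment_transform k (\<i> * of_real (real (Suc n))))) \<longlonglongrightarrow> of_real (moment k)"
proof -
  let ?y = "\<lambda>n. real (Suc n)"
  let ?F = "\<lambda>n t. - (\<i> * of_real (?y n)) * (of_real (t ^ k) / (of_real t - \<i> * of_real (?y n)))"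
  have "(\<lambda>n. LINT t|M. ?F n t) \<longlonglongrightarrow> (LINT t|M. complex_of_real (t ^ k))"
  proof (rule integral_dominated_convergence)
    show "integrable M (\<lambda>t. \<bar>t ^ k\<bar>)" by (intro integrable_continuous continuous_intros)
    show "AE t in M. (\<lambda>n. ?F n t) \<longlonglongrightarrow> of_real (t ^ k)"
    proof (rule AE_I2)
      fix t
      have "(\<lambda>n. \<i> * of_real (t ^ k) / (\<i> - of_real t * of_real (1 / ?y n))) \<longlonglongrightarrow> \<i> * of_real (t ^ k) / (\<i> - of_real t * of_real 0)"
        by (intro tendsto_intros LIMSEQ_Suc[OF lim_const_over_n]) auto
      moreover have "\<i> * of_real (t ^ k) / (\<i> - of_real t * of_real (1 / ?y n)) = ?F n t" for n
      proof -
        have "\<i> - of_real t * of_real (1 / ?y n) = - (of_real t - \<i> * of_real (?y n)) / of_real (?y n)"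
          by (simp add: diff_divide_distrib del: of_nat_Suc)
        then show ?thesis by (simp del: of_nat_Suc of_real_power minus_diff_eq)
      qed
      ultimately have "(\<lambda>n. ?F n t) \<longlonglongrightarrow> \<i> * of_real (t ^ k) / (\<i> - of_real t * of_real 0)"
        by (simp only:)
      then show "(\<lambda>n. ?F n t) \<longlonglongrightarrow> of_real (t ^ k)"
        by simp
    qed
    fix n
    have "cmod (?F n t) \<le> \<bar>t ^ k\<bar>" for t
    proof -
      have "cmod (?F n t) = \<bar>t ^ k\<bar> * (?y n * cmod (1 / (of_real t - \<i> * of_real (?y n))))"
        by (simp add: norm_mult norm_divide norm_power power_abs del: of_nat_Suc)
      moreover have "?y n * cmod (1 / (of_real t - \<i> * of_real (?y n))) \<le> ?y n * (1 / ?y n)"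
        using cmod_Cauchy_kernel_le[of "\<i> * of_real (?y n)" t] by (intro mult_left_mono) auto
      then have "\<bar>t ^ k\<bar> * (?y n * cmod (1 / (of_real t - \<i> * of_real (?y n)))) \<le> \<bar>t ^ k\<bar> * 1"
        by (intro mult_left_mono) (auto simp del: of_nat_Suc)
      ultimately show ?thesis by linarith
    qed
    then show "AE t in M. cmod (?F n t) \<le> \<bar>t ^ k\<bar>" by simp
  qed auto
  moreover have "(LINT t|M. ?F n t) = - (\<i> * of_real (?y n) * moment_transform k (\<i> * of_real (?y n)))" for n
    unfolding moment_transform_def integral_mult_right_zero by simp
  moreover have "(LINT t|M. complex_of_real (t ^ k)) = of_real (moment k)"
    unfolding moment_def by (rule integral_complex_of_real)
  ultimately show ?thesis by (simp only:)
qed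

lemma integral_polynomial:
  "(LINT t|M. (\<Sum>i\<le>n. a i * t ^ i)) = (\<Sum>i\<le>n. a i * moment i)"
proof -
  have "integrable M (\<lambda>t. a i * t ^ i)" for i
    by (intro integrable_continuous continuous_intros)
  then show ?thesis
    unfolding moment_def by (subst Bochner_Integration.integral_sum) auto
qed

text \<open>Approximation on [-b, b] is enough because t lies there almost surely; integrals of
  continuous functions thus become finite linear expressions in moments up to
  \<open>e\<close>.\<close>

lemma integral_close:
  fixes f :: "real \<Rightarrow> real"
  assumes f: "continuous_on UNIV f"
    and close: "\<And>t. t \<in> {-b..b} \<Longrightarrow> \<bar>f t - (\<Sum>i\<le>n. a i * t ^ i)\<bar> < e"
  shows "\<bar>(LINT t|M. f t) - (\<Sum>i\<le>n. a i * moment i)\<bar> \<le> e"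
proof -
  let ?p = "\<lambda>t. \<Sum>i\<le>n. a i * t ^ i"
  have p: "continuous_on UNIV ?p" by (intro continuous_intros)
  have "AE t in M. \<bar>f t - ?p t\<bar> \<le> e"
    using AE_bounded by eventually_elim (intro less_imp_le close, auto)
  then have "\<bar>LINT t|M. f t - ?p t\<bar> \<le> e"
    by (intro integral_abs_bound[THEN order_trans] integral_le_const) 
      (auto intro!: integrable_continuous continuous_intros f)
  then show ?thesis
    using integrable_continuous[OF f] integrable_continuous[OF p]
    by (simp add: integral_polynomial)
qed

end

abbreviation "moment \<equiv> compactly_supported_distribution.moment"
abbreviation "moment_transform \<equiv> compactly_supported_distribution.moment_transform"

lemma moments_measurable:
  fixes \<mu> :: "'x \<Rightarrow> real measure"
  assumes \<mu>: "\<And>x. x \<in> space M \<Longrightarrow> compactly_supported_distribution (\<mu> x) b"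
    and meas: "\<And>z. 0 < Im z \<Longrightarrow> (\<lambda>x. Stieltjes (\<mu> x) z) \<in> borel_measurable M"
  shows "(\<lambda>x. moment (\<mu> x) k) \<in> borel_measurable M"
proof -
  \<comment> \<open>Half of the recursion step: the k-th transform gives the k-th moment. The
    induction below combines it with \<open>moment_transform_Suc\<close> to reach k + 1.\<close>
  have mom: "(\<lambda>x. moment (\<mu> x) k) \<in> borel_measurable M"
    if tr: "\<And>z. 0 < Im z \<Longrightarrow> (\<lambda>x. moment_transform (\<mu> x) k z) \<in> borel_measurable M" for k
  proof -
    have "(\<lambda>x. complex_of_real (moment (\<mu> x) k)) \<in> borel_measurable M"
    proof (rule borel_measurable_LIMSEQ_metric)
      fix n
      have "(\<lambda>x. moment_transform (\<mu> x) k (\<i> * of_real (real (Suc n)))) \<in> borel_measurable M"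
        by (rule tr) simp
      then show "(\<lambda>x. - (\<i> * of_real (real (Suc n)) * moment_transform (\<mu> x) k (\<i> * of_real (real (Suc n))))) \<in> borel_measurable M"
        by measurable
    qed (rule compactly_supported_distribution.moment_LIMSEQ[OF \<mu>])
    from measurable_compose[OF this borel_measurable_Re] show ?thesis by simp
  qed
  have "(\<lambda>x. moment_transform (\<mu> x) k z) \<in> borel_measurable M" if "0 < Im z" for k z
    using that
  proof (induction k arbitrary: z)
    case 0
    then show ?case
      using meas measurable_cong[of M "\<lambda>x. moment_transform (\<mu> x) 0 z" "\<lambda>x. Stieltjes (\<mu> x) z" borel]
        compactly_supported_distribution.moment_transform_0[OF \<mu>] by simp
  next
    case (Suc k)
    have "(\<lambda>x. of_real (moment (\<mu> x) k) + z * moment_transform (\<mu> x) k z) \<in> borel_measurable M"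
      using mom[OF Suc.IH] Suc by measurable
    then show ?case
      using measurable_cong[of M "\<lambda>x. moment_transform (\<mu> x) (Suc k) z"
          "\<lambda>x. of_real (moment (\<mu> x) k) + z * moment_transform (\<mu> x) k z" borel]
        compactly_supported_distribution.moment_transform_Suc[OF \<mu> Suc.prems] by simp
  qed
  then show ?thesis by (rule mom)
qed

text \<open>The same recursion as in \<open>moments_measurable\<close>, carrying equality instead of
  measurability.\<close>

lemma moment_eqI:
  assumes \<mu>: "compactly_supported_distribution \<mu> b" and \<nu>: "compactly_supported_distribution \<nu> b"
    and eq: "\<And>z. 0 < Im z \<Longrightarrow> Stieltjes \<mu> z = Stieltjes \<nu> z"
  shows "moment \<mu> k = moment \<nu> k"
proof -
  interpret \<mu>: compactly_supported_distribution \<mu> b by fact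
  interpret \<nu>: compactly_supported_distribution \<nu> b by fact
  have mom: "\<mu>.moment k = \<nu>.moment k"
    if tr: "\<And>z. 0 < Im z \<Longrightarrow> \<mu>.moment_transform k z = \<nu>.moment_transform k z" for k
  proof -
    have "complex_of_real (\<mu>.moment k) = of_real (\<nu>.moment k)"
      by (rule LIMSEQ_unique[OF \<mu>.moment_LIMSEQ]) (subst tr, simp, rule \<nu>.moment_LIMSEQ)
    then show ?thesis by simp
  qed
  have "\<mu>.moment_transform k z = \<nu>.moment_transform k z" if "0 < Im z" for k z
    using that
  proof (induction k arbitrary: z)
    case 0
    then show ?case by (simp add: \<mu>.moment_transform_0 \<nu>.moment_transform_0 eq)
  next
    case (Suc k)
    then show ?case by (simp add: \<mu>.moment_transform_Suc \<nu>.moment_transform_Suc mom)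
  qed
  then show ?thesis by (rule mom)
qed

lemma ex_polynomial_close:
  fixes f :: "real \<Rightarrow> real"
  assumes "continuous_on UNIV f" "0 < e"
  shows "\<exists>a n. \<forall>t\<in>{-b..b}. \<bar>f t - (\<Sum>i\<le>n. a i * t ^ i)\<bar> < e"
proof -
  obtain g where g: "real_polynomial_function g" "\<And>t. t \<in> {-b..b} \<Longrightarrow> \<bar>f t - g t\<bar> < e"
    using Stone_Weierstrass_real_polynomial_function[of "{-b..b}" f e] assms
    by (auto intro: continuous_on_subset)
  then obtain a n where "g = (\<lambda>x. \<Sum>i\<le>n. a i * x ^ i)"
    unfolding real_polynomial_function_iff_sum by blast
  with g(2) show ?thesis by (intro exI[of _ a] exI[of _ n]) auto
qed

text \<open>Equal moments give equal integrals of polynomials and, by uniform approximation on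
  [-b, b], of all continuous functions; cosine and sine then yield equal characteristic
  functions.\<close>

lemma compactly_supported_distribution_eqI:
  assumes \<mu>: "compactly_supported_distribution \<mu> b" and \<nu>: "compactly_supported_distribution \<nu> b"
    and eq: "\<And>z. 0 < Im z \<Longrightarrow> Stieltjes \<mu> z = Stieltjes \<nu> z"
  shows "\<mu> = \<nu>"
proof -
  interpret \<mu>: compactly_supported_distribution \<mu> b by fact
  interpret \<nu>: compactly_supported_distribution \<nu> b by fact
  have int: "(LINT t|\<mu>. f t) = (LINT t|\<nu>. f t)" if f: "continuous_on UNIV f" for f :: "real \<Rightarrow> real"
  proof -
    have "\<bar>(LINT t|\<mu>. f t) - (LINT t|\<nu>. f t)\<bar> \<le> e" if "0 < e" for e
    proof -
      obtain a n where p: "\<And>t. t \<in> {-b..b} \<Longrightarrow> \<bar>f t - (\<Sum>i\<le>n. a i * t ^ i)\<bar> < e / 2"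
        using ex_polynomial_close[OF f, of "e / 2" b] \<open>0 < e\<close> by (metis half_gt_zero)
      have "\<bar>(LINT t|\<mu>. f t) - (\<Sum>i\<le>n. a i * moment \<nu> i)\<bar> \<le> e / 2"
        using \<mu>.integral_close[OF f, of a n "e / 2"] p by (simp add: moment_eqI[OF \<mu> \<nu> eq])
      moreover have "\<bar>(LINT t|\<nu>. f t) - (\<Sum>i\<le>n. a i * moment \<nu> i)\<bar> \<le> e / 2"
        using \<nu>.integral_close[OF f, of a n "e / 2"] p by simp
      ultimately show ?thesis by linarith
    qed
    then have "\<bar>(LINT t|\<mu>. f t) - (LINT t|\<nu>. f t)\<bar> \<le> 0"
      by (rule field_le_epsilon) simp
    then show ?thesis by simp
  qed
  have "char \<mu> t = char \<nu> t" for t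
  proof -
    have "char \<mu> t = Complex (LINT s|\<mu>. cos (t * s)) (LINT s|\<mu>. sin (t * s))"
      using \<mu>.integrable_iexp[of "\<lambda>s. of_real (t * s)"]
      by (simp add: char_def complex_eq_iff Re_exp Im_exp flip: integral_Re integral_Im)
    moreover have "char \<nu> t = Complex (LINT s|\<nu>. cos (t * s)) (LINT s|\<nu>. sin (t * s))"
      using \<nu>.integrable_iexp[of "\<lambda>s. of_real (t * s)"]
      by (simp add: char_def complex_eq_iff Re_exp Im_exp flip: integral_Re integral_Im)
    ultimately show ?thesis by (simp add: int continuous_intros)
  qed
  then show ?thesis
    using Levy_uniqueness[of \<mu> \<nu>] \<mu>.real_distribution_axioms \<nu>.real_distribution_axioms by auto
qed


text \<open>The reflected measure has the transform - cnj (Stieltjes \<mu> (- cnj z)) at z, which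
  \<open>refl\<close> turns back into that of \<mu>; uniqueness concludes.\<close>

lemma compactly_supported_distribution_symmetric:
  assumes \<mu>: "compactly_supported_distribution \<mu> b"
    and refl: "\<And>z. 0 < Im z \<Longrightarrow> Stieltjes \<mu> (- cnj z) = - cnj (Stieltjes \<mu> z)"
  shows "distr \<mu> borel uminus = \<mu>"
proof (rule compactly_supported_distribution_eqI[OF _ \<mu>])
  interpret \<mu>: compactly_supported_distribution \<mu> b by fact
  have um: "uminus \<in> borel_measurable \<mu>" by measurable
  interpret \<nu>: prob_space "distr \<mu> borel uminus" by (rule \<mu>.prob_space_distr[OF um])
  have "AE t in distr \<mu> borel uminus. \<bar>t\<bar> \<le> b"
    using \<mu>.AE_bounded by (subst AE_distr_iff[OF um]) auto
  then show "compactly_supported_distribution (distr \<mu> borel uminus) b"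
    by unfold_locales auto
  fix z :: complex assume z: "0 < Im z"
  have "Stieltjes (distr \<mu> borel uminus) z = (LINT t|\<mu>. 1 / (of_real (- t) - z))"
    by (rule integral_distr[OF um]) measurable
  also have "\<dots> = (LINT t|\<mu>. - cnj (1 / (of_real t - (- cnj z))))"
  proof -
    have "1 / (of_real (- t) - z) = - cnj (1 / (of_real t - (- cnj z)))" for t :: real
    proof -
      have "cnj (1 / (of_real t - (- cnj z))) = 1 / (of_real t + z)" by simp
      moreover have "of_real (- t) - z = - (of_real t + z)" by simp
      ultimately show ?thesis by (simp only: divide_minus_right)
    qed
    then show ?thesis by simp
  qed
  also have "\<dots> = - cnj (Stieltjes \<mu> (- cnj z))" by (simp only: integral_minus Bochner_Integration.integral_cnj)
  also have "\<dots> = Stieltjes \<mu> z" using refl[OF z] by simp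
  finally show "Stieltjes (distr \<mu> borel uminus) z = Stieltjes \<mu> z" .
qed

section \<open>Measurability for the weak topology\<close>

lemma integral_density_const:
  fixes f :: "'x \<Rightarrow> 'b::{banach, second_countable_topology}"
  assumes "0 \<le> c" "f \<in> borel_measurable M"
  shows "(LINT t|density M (\<lambda>_. ennreal c). f t) = c *\<^sub>R (LINT t|M. f t)"
  using assms by (subst integral_density) auto

lemma density_const_finite_borel:
  assumes "real_distribution \<mu>"
  shows "density \<mu> (\<lambda>_. ennreal c) \<in> finite_borel_measures"
proof -
  interpret real_distribution \<mu> by fact
  show ?thesis
    unfolding finite_borel_measures_def
    by (auto intro!: finite_measureI simp: emeasure_density_const ennreal_mult_eq_top_iff emeasure_eq_measure)
qed

text \<open>On rescaled distributions on \<open>[-b, b]\<close> the weak topology is induced by the moment sequence,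
  a point of the second countable space \<open>nat \<Rightarrow> real\<close>; this makes Borel measurability for the
  (a priori not second countable) weak topology accessible.\<close>

lemma weak_topology_moments:
  assumes U: "openin weak_topology U" and c: "0 < c"
  shows "\<exists>V. open V \<and> (\<forall>\<mu>. compactly_supported_distribution \<mu> b \<longrightarrow>
      (density \<mu> (\<lambda>_. ennreal c) \<in> U \<longleftrightarrow> moment \<mu> \<in> V))"
    (is "\<exists>V. ?P U V")
proof -
  have "generate_topology_on {{\<mu> \<in> finite_borel_measures. (LINT t|\<mu>. f t) \<in> U} | (f :: real \<Rightarrow> real) U.
        continuous_on UNIV f \<and> bounded (range f) \<and> open U} U"
    using U unfolding weak_topology_def by (rule openin_topology_generated_by)
  then show ?thesis
  proof induction
    case Empty
    show ?case by (rule exI[of _ "{}"]) auto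
  next
    case (Int U1 U2)
    then obtain V1 V2 where "?P U1 V1" "?P U2 V2" by blast
    then show ?case by (intro exI[of _ "V1 \<inter> V2"]) auto
  next
    case (UN K)
    then obtain V where "\<And>k. k \<in> K \<Longrightarrow> ?P k (V k)" by metis
    then show ?case by (intro exI[of _ "\<Union>k\<in>K. V k"]) auto
  next
    case (Basis W)
    then obtain f :: "real \<Rightarrow> real" and T where W: "W = {\<mu> \<in> finite_borel_measures. (LINT t|\<mu>. f t) \<in> T}"
        and f: "continuous_on UNIV f" and T: "open T" by blast
    \<comment> \<open>The largest admissible open set: one direction becomes immediate, and for the
      other it remains to find some admissible neighbourhood of each good moment sequence.\<close>
    define V where "V = \<Union>{V. open V \<and>
      (\<forall>\<mu>. compactly_supported_distribution \<mu> b \<longrightarrow> moment \<mu> \<in> V \<longrightarrow> c * (LINT t|\<mu>. f t) \<in> T)}"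
    have mem: "density \<mu> (\<lambda>_. ennreal c) \<in> W \<longleftrightarrow> c * (LINT t|\<mu>. f t) \<in> T"
      if \<mu>: "compactly_supported_distribution \<mu> b" for \<mu>
    proof -
      interpret compactly_supported_distribution \<mu> b by fact
      show ?thesis
        using integral_density_const[of c f \<mu>] density_const_finite_borel[OF real_distribution_axioms, of c] c f
        by (simp add: W borel_measurable_continuous_onI)
    qed
    have "moment \<mu> \<in> V" if \<mu>: "compactly_supported_distribution \<mu> b" and T': "c * (LINT t|\<mu>. f t) \<in> T" for \<mu>
    proof -
      obtain e where e: "0 < e" "\<And>y. dist y (c * (LINT t|\<mu>. f t)) < e \<Longrightarrow> y \<in> T"
        using T T' unfolding open_dist by blast
      \<comment> \<open>Two polynomial approximations and one difference of moment combinations cost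
        less than 3 d; after scaling by \<open>c\<close> this stays below 4 c d = e.\<close>
      define d where "d = e / (4 * c)"
      have d: "0 < d" using e c by (simp add: d_def)
      obtain a n where p: "\<And>t. t \<in> {-b..b} \<Longrightarrow> \<bar>f t - (\<Sum>i\<le>n. a i * t ^ i)\<bar> < d"
        using ex_polynomial_close[OF f d, of b] by blast
      let ?L = "\<lambda>s::nat \<Rightarrow> real. \<Sum>i\<le>n. a i * s i"
      let ?V = "{s. \<bar>?L s - ?L (moment \<mu>)\<bar> < d}"
      have "open ?V"
        by (intro open_Collect_less continuous_intros continuous_on_product_coordinates)
      moreover have "c * (LINT t|\<nu>. f t) \<in> T"
        if \<nu>: "compactly_supported_distribution \<nu> b" and s: "moment \<nu> \<in> ?V" for \<nu>
      proof (rule e(2))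
        have "\<bar>(LINT t|\<nu>. f t) - (LINT t|\<mu>. f t)\<bar> < 4 * d"
          using compactly_supported_distribution.integral_close[OF \<nu> f p]
            compactly_supported_distribution.integral_close[OF \<mu> f p] s d by simp
        then have "c * \<bar>(LINT t|\<nu>. f t) - (LINT t|\<mu>. f t)\<bar> < c * (4 * d)"
          using c by (rule mult_strict_left_mono)
        moreover have "dist (c * (LINT t|\<nu>. f t)) (c * (LINT t|\<mu>. f t)) = c * \<bar>(LINT t|\<nu>. f t) - (LINT t|\<mu>. f t)\<bar>"
          using c by (simp add: dist_real_def abs_mult flip: right_diff_distrib)
        ultimately show "dist (c * (LINT t|\<nu>. f t)) (c * (LINT t|\<mu>. f t)) < e"
          using c by (simp add: d_def)
      qed
      moreover have "moment \<mu> \<in> ?V" using d by simp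
      ultimately show ?thesis unfolding V_def by blast
    qed
    then show ?case
      using mem by (intro exI[of _ V]) (auto simp: V_def)
  qed
qed

text \<open>Weakly open sets generate the target sigma algebra, and on these measures each of them
  is the preimage of an open set of moment sequences; measurability of every single moment then
  suffices.\<close>

lemma measurable_weak_topology:
  fixes \<mu> :: "'x \<Rightarrow> real measure"
  assumes \<mu>: "\<And>x. x \<in> space M \<Longrightarrow> compactly_supported_distribution (\<mu> x) b"
    and meas: "\<And>z. 0 < Im z \<Longrightarrow> (\<lambda>x. Stieltjes (\<mu> x) z) \<in> borel_measurable M"
    and c: "0 < c"
  shows "(\<lambda>x. density (\<mu> x) (\<lambda>_. ennreal c)) \<in> measurable M (borel_of_topology weak_topology)"
proof (rule measurable_sigma_sets[OF sets_borel_of_weak_topology])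
  show "{U. openin weak_topology U} \<subseteq> Pow finite_borel_measures"
    using openin_subset topspace_weak_topology by blast
  show "(\<lambda>x. density (\<mu> x) (\<lambda>_. ennreal c)) \<in> space M \<rightarrow> finite_borel_measures"
    using density_const_finite_borel compactly_supported_distribution.axioms(1)[OF \<mu>] by blast
  fix U assume "U \<in> {U. openin weak_topology U}"
  then obtain V where V: "open V"
    "\<And>\<mu>. compactly_supported_distribution \<mu> b \<Longrightarrow> density \<mu> (\<lambda>_. ennreal c) \<in> U \<longleftrightarrow> moment \<mu> \<in> V"
    using weak_topology_moments[of U c b] c by blast
  have "(\<lambda>x. moment (\<mu> x)) \<in> borel_measurable M"
    by (rule measurable_coordinatewise_then_product) (rule moments_measurable[OF \<mu> meas])
  then have "(\<lambda>x. moment (\<mu> x)) -` V \<inter> space M \<in> sets M"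
    using V(1) by (intro measurable_sets[of _ M borel]) auto
  moreover have "(\<lambda>x. density (\<mu> x) (\<lambda>_. ennreal c)) -` U \<inter> space M = (\<lambda>x. moment (\<mu> x)) -` V \<inter> space M"
    using V(2) \<mu> by auto
  ultimately show "(\<lambda>x. density (\<mu> x) (\<lambda>_. ennreal c)) -` U \<inter> space M \<in> sets M" by simp
qed

section \<open>Bounded measurable functions\<close>

context prob_space
begin

lemma bdd_measI:
  assumes "w \<in> borel_measurable M" "\<And>x. x \<in> space M \<Longrightarrow> cmod (w x) \<le> B" "\<And>x. x \<notin> space M \<Longrightarrow> w x = 0"
  shows "w \<in> bdd_meas M"
  using assms unfolding bdd_meas_def bounded_iff by auto

lemma bdd_meas_measurable: "w \<in> bdd_meas M \<Longrightarrow> w \<in> borel_measurable M"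
  by (simp add: bdd_meas_def)

lemma bdd_above_bdd_meas: "w \<in> bdd_meas M \<Longrightarrow> bdd_above ((\<lambda>x. cmod (w x)) ` space M)"
  by (auto simp: bdd_meas_def bounded_iff bdd_above_def)

lemma sup_norm_ge: "w \<in> bdd_meas M \<Longrightarrow> x \<in> space M \<Longrightarrow> cmod (w x) \<le> sup_norm M w"
  unfolding sup_norm_def by (intro cSUP_upper bdd_above_bdd_meas)

lemma sup_norm_le: "(\<And>x. x \<in> space M \<Longrightarrow> cmod (w x) \<le> B) \<Longrightarrow> sup_norm M w \<le> B"
  unfolding sup_norm_def using not_empty by (intro cSUP_least) auto

lemma sup_norm_nonneg: "w \<in> bdd_meas M \<Longrightarrow> 0 \<le> sup_norm M w"
  using not_empty sup_norm_ge norm_ge_zero order_trans by (metis ex_in_conv)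

lemma bdd_meas_add:
  assumes "u \<in> bdd_meas M" "w \<in> bdd_meas M"
  shows "(\<lambda>x. u x + w x) \<in> bdd_meas M"
proof (rule bdd_measI)
  show "(\<lambda>x. u x + w x) \<in> borel_measurable M"
    using assms[THEN bdd_meas_measurable] by measurable
  show "cmod (u x + w x) \<le> sup_norm M u + sup_norm M w" if "x \<in> space M" for x
    using norm_triangle_mono sup_norm_ge assms that by blast
qed (use assms in \<open>auto simp: bdd_meas_def\<close>)

lemma bdd_meas_cmult:
  assumes "w \<in> bdd_meas M"
  shows "(\<lambda>x. c * w x) \<in> bdd_meas M"
proof (rule bdd_measI)
  show "(\<lambda>x. c * w x) \<in> borel_measurable M"
    using assms[THEN bdd_meas_measurable] by measurable
  show "cmod (c * w x) \<le> cmod c * sup_norm M w" if "x \<in> space M" for x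
    using sup_norm_ge[OF assms that] by (simp add: norm_mult mult_left_mono)
qed (use assms in \<open>auto simp: bdd_meas_def\<close>)

lemma bdd_meas_diff:
  assumes "u \<in> bdd_meas M" "w \<in> bdd_meas M"
  shows "(\<lambda>x. u x - w x) \<in> bdd_meas M"
  using bdd_meas_add[OF assms(1) bdd_meas_cmult[OF assms(2), of "-1"]] by simp

lemma zero_bdd_meas: "(\<lambda>x. 0) \<in> bdd_meas M"
  by (rule bdd_measI[where B = 0]) auto

definition bdd_real :: "('a \<Rightarrow> real) \<Rightarrow> bool" where
  "bdd_real p \<longleftrightarrow> p \<in> borel_measurable M \<and> (\<exists>B. \<forall>x\<in>space M. \<bar>p x\<bar> \<le> B)"

text \<open>Cutting off outside \<open>space M\<close> brings functions such as nonzero constants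
  into \<open>bdd_meas M\<close>, whose elements vanish there.\<close>

definition embed :: "('a \<Rightarrow> real) \<Rightarrow> 'a \<Rightarrow> complex" where
  "embed p = (\<lambda>x. if x \<in> space M then of_real (p x) else 0)"

lemma embed_eq: "x \<in> space M \<Longrightarrow> embed p x = of_real (p x)"
  by (simp add: embed_def)

lemma embed_bdd_meas:
  assumes "bdd_real p" shows "embed p \<in> bdd_meas M"
proof -
  obtain B where B: "\<forall>x\<in>space M. \<bar>p x\<bar> \<le> B" and p: "p \<in> borel_measurable M"
    using assms by (auto simp: bdd_real_def)
  have "(\<lambda>x. complex_of_real (p x)) \<in> borel_measurable M" using p by measurable
  then have "embed p \<in> borel_measurable M"
    by (subst measurable_cong[of M _ "\<lambda>x. complex_of_real (p x)"]) (auto simp: embed_def)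
  then show ?thesis by (rule bdd_measI) (use B in \<open>auto simp: embed_def\<close>)
qed

lemma bdd_realI: "p \<in> borel_measurable M \<Longrightarrow> (\<And>x. x \<in> space M \<Longrightarrow> \<bar>p x\<bar> \<le> B) \<Longrightarrow> bdd_real p"
  by (auto simp: bdd_real_def)

lemma bdd_real_const: "bdd_real (\<lambda>_. c)"
  by (rule bdd_realI[where B = "\<bar>c\<bar>"]) auto

lemma bdd_real_add: "bdd_real p \<Longrightarrow> bdd_real q \<Longrightarrow> bdd_real (\<lambda>x. p x + q x)"
  unfolding bdd_real_def by (auto intro!: exI[of _ "_ + _"] abs_triangle_ineq[THEN order_trans] add_mono)

lemma bdd_real_mult: "bdd_real p \<Longrightarrow> bdd_real q \<Longrightarrow> bdd_real (\<lambda>x. p x * q x)"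
  unfolding bdd_real_def by (force simp: abs_mult intro!: exI[of _ "_ * _"] mult_mono)

lemma bdd_real_diff: "bdd_real p \<Longrightarrow> bdd_real q \<Longrightarrow> bdd_real (\<lambda>x. p x - q x)"
  using bdd_real_add[of p "\<lambda>x. -1 * q x"] bdd_real_mult[OF bdd_real_const[of "-1"]] by simp

lemma bdd_real_Re: "w \<in> bdd_meas M \<Longrightarrow> bdd_real (\<lambda>x. Re (w x))"
  by (rule bdd_realI[where B = "sup_norm M w"])
    (auto dest: bdd_meas_measurable intro: order_trans[OF abs_Re_le_cmod sup_norm_ge])

lemma bdd_real_Im: "w \<in> bdd_meas M \<Longrightarrow> bdd_real (\<lambda>x. Im (w x))"
  by (rule bdd_realI[where B = "sup_norm M w"])
    (auto dest: bdd_meas_measurable intro: order_trans[OF abs_Im_le_cmod sup_norm_ge])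

lemma bdd_real_cmod: "w \<in> bdd_meas M \<Longrightarrow> bdd_real (\<lambda>x. cmod (w x))"
  by (rule bdd_realI[where B = "sup_norm M w"])
    (auto dest: bdd_meas_measurable intro: sup_norm_ge)

lemma bdd_real_integrable: "bdd_real p \<Longrightarrow> integrable M p"
  unfolding bdd_real_def by (elim conjE exE, rule integrable_const_bound) auto

end

section \<open>Norm analyticity from pointwise holomorphy\<close>

text \<open>A Taylor remainder whose constant depends on \<open>r\<close> and \<open>B\<close>
  alone: used for all x at once, it makes difference quotients converge uniformly.\<close>

lemma holomorphic_difference_quotient_bound:
  assumes hol: "f holomorphic_on ball z r" and B: "\<And>w. w \<in> ball z r \<Longrightarrow> cmod (f w) \<le> B"
    and r: "0 < r" and w: "dist w z < r / 2" "w \<noteq> z"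
  shows "cmod ((f w - f z) / (w - z) - deriv f z) \<le> 32 * B / r\<^sup>2 * cmod (w - z)"
proof -
  let ?S = "ball z (r / 2)"
  have B2: "cmod ((deriv ^^ 2) f \<xi>) \<le> 32 * B / r\<^sup>2" if \<xi>: "\<xi> \<in> ?S" for \<xi>
  proof -
    have sub: "cball \<xi> (r / 4) \<subseteq> ball z r"
      using \<xi> r by (intro cball_subset_ball_iff[THEN iffD2]) (auto simp: dist_commute)
    \<comment> \<open>Circles of radius r / 4 about points of the half ball stay in the ball, and 2!
      * B / (r / 4)^2 is the constant 32 * B / r^2.\<close>
    have "cmod ((deriv ^^ 2) f \<xi>) \<le> fact 2 * B / (r / 4) ^ 2"
    proof (rule Cauchy_inequality)
      show "f holomorphic_on ball \<xi> (r / 4)"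
        using hol sub ball_subset_cball by (meson holomorphic_on_subset order_trans)
      show "continuous_on (cball \<xi> (r / 4)) f"
        using hol sub by (meson holomorphic_on_imp_continuous_on holomorphic_on_subset)
      fix v assume "cmod (\<xi> - v) = r / 4"
      then have "v \<in> cball \<xi> (r / 4)" by (simp add: dist_norm)
      then show "cmod (f v) \<le> B" using B sub by blast
    qed (use r in simp)
    then show ?thesis by (simp add: power_divide fact_numeral)
  qed
  have "cmod ((deriv ^^ 0) f w - (\<Sum>i\<le>1. (deriv ^^ i) f z * (w - z) ^ i / fact i))
      \<le> 32 * B / r\<^sup>2 * cmod (w - z) ^ Suc 1 / fact 1"
  proof (rule complex_Taylor[of ?S 1 "\<lambda>i. (deriv ^^ i) f"])
    fix i v assume v: "v \<in> ?S"
    have "((deriv ^^ i) f has_field_derivative (deriv ^^ Suc i) f v) (at v)"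
      by (rule has_field_derivative_higher_deriv[OF hol open_ball]) (use v r in auto)
    then show "((deriv ^^ i) f has_field_derivative (deriv ^^ Suc i) f v) (at v within ?S)"
      by (rule has_field_derivative_at_within)
  next
    show "cmod ((deriv ^^ Suc 1) f v) \<le> 32 * B / r\<^sup>2" if "v \<in> ?S" for v
      using B2[OF that] by (simp add: numeral_2_eq_2)
  qed (use w r in \<open>auto simp: dist_commute\<close>)
  then have "cmod (f w - f z - deriv f z * (w - z)) \<le> 32 * B / r\<^sup>2 * cmod (w - z) * cmod (w - z)"
    by (simp add: power2_eq_square diff_diff_eq)
  moreover have "(f w - f z) / (w - z) - deriv f z = (f w - f z - deriv f z * (w - z)) / (w - z)"
    using w by (simp add: field_simps)
  ultimately show ?thesis using w by (simp add: norm_divide divide_le_eq)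
qed

context prob_space
begin

text \<open>The pointwise derivative is the derivative in norm: it is measurable as a limit of
  difference quotients along a sequence, bounded by comparison with one of them, and the common
  local bound makes the Taylor error uniform in x.\<close>

lemma banach_analytic_on_pointwise:
  assumes D: "open D" and bdd: "\<And>z. z \<in> D \<Longrightarrow> F z \<in> bdd_meas M"
    and hol: "\<And>x. x \<in> space M \<Longrightarrow> (\<lambda>z. F z x) holomorphic_on D"
    and loc: "\<And>z. z \<in> D \<Longrightarrow> \<exists>r B. 0 < r \<and> (\<forall>w\<in>ball z r. \<forall>x\<in>space M. cmod (F w x) \<le> B)"
  shows "banach_analytic_on M F D"
  unfolding banach_analytic_on_def
proof (intro conjI ballI bdd)
  fix z assume z: "z \<in> D"
  obtain r0 B where r0: "0 < r0" "\<And>w x. w \<in> ball z r0 \<Longrightarrow> x \<in> space M \<Longrightarrow> cmod (F w x) \<le> B"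
    using loc[OF z] by blast
  obtain r1 where r1: "0 < r1" "ball z r1 \<subseteq> D" using D z openE by blast
  define r where "r = min r0 r1"
  have r: "0 < r" "ball z r \<subseteq> D" and B: "\<And>w x. w \<in> ball z r \<Longrightarrow> x \<in> space M \<Longrightarrow> cmod (F w x) \<le> B"
    using r0 r1 by (auto simp: r_def)
  define C where "C = 32 * B / r\<^sup>2"
  define d where "d = (\<lambda>x. if x \<in> space M then deriv (\<lambda>z. F z x) z else 0)"
  have est: "cmod ((F w x - F z x) / (w - z) - d x) \<le> C * cmod (w - z)"
    if w: "dist w z < r / 2" "w \<noteq> z" and x: "x \<in> space M" for w x
    using holomorphic_difference_quotient_bound[OF holomorphic_on_subset[OF hol[OF x] r(2)] B[OF _ x] r(1) w] x
    by (simp add: C_def d_def)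
  have quot: "(\<lambda>x. (F w x - F z x) / (w - z)) \<in> bdd_meas M" if "w \<in> D" for w
    using bdd_meas_cmult[OF bdd_meas_diff[OF bdd[OF that] bdd[OF z]], of "1 / (w - z)"] by simp
  define e where "e = (\<lambda>n. r / 4 * (1 / real (Suc n)))"
  have e: "0 < e n" "e n < r / 2" for n
  proof -
    show "0 < e n" unfolding e_def using r by (intro mult_pos_pos) auto
    have "e n \<le> r / 4 * 1" unfolding e_def using r by (intro mult_left_mono) auto
    then show "e n < r / 2" using r by simp
  qed
  define w where "w = (\<lambda>n. z + of_real (e n))"
  have we: "dist (w n) z = e n" for n using e(1)[of n] by (simp add: w_def dist_norm)
  have w: "dist (w n) z < r / 2" "w n \<noteq> z" "w n \<in> D" for n
  proof -
    show "dist (w n) z < r / 2" "w n \<noteq> z" using e[of n] we[of n] by auto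
    then have "w n \<in> ball z r" using r by (simp add: dist_commute)
    then show "w n \<in> D" using r(2) by auto
  qed
  have wlim: "(\<lambda>n. C * cmod (w n - z)) \<longlonglongrightarrow> 0"
    unfolding dist_norm[symmetric] we unfolding e_def
    by (intro tendsto_mult_right_zero LIMSEQ_inverse_real_Suc)
  have d: "d \<in> bdd_meas M"
  proof (rule bdd_measI)
    show "d \<in> borel_measurable M"
    proof (rule borel_measurable_LIMSEQ_metric)
      show "(\<lambda>x. (F (w n) x - F z x) / (w n - z)) \<in> borel_measurable M" for n
        by (rule bdd_meas_measurable[OF quot[OF w(3)]])
      fix x assume x: "x \<in> space M"
      show "(\<lambda>n. (F (w n) x - F z x) / (w n - z)) \<longlonglongrightarrow> d x"
        by (rule LIM_zero_cancel, rule Lim_null_comparison[OF _ wlim])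
          (use est[OF w(1,2) x] in \<open>simp add: always_eventually\<close>)
    qed
    fix x assume x: "x \<in> space M"
    have "cmod (d x) \<le> cmod ((F (w 0) x - F z x) / (w 0 - z)) + cmod ((F (w 0) x - F z x) / (w 0 - z) - d x)"
      using norm_triangle_ineq4[of "(F (w 0) x - F z x) / (w 0 - z)" "(F (w 0) x - F z x) / (w 0 - z) - d x"] by simp
    also have "\<dots> \<le> sup_norm M (\<lambda>x. (F (w 0) x - F z x) / (w 0 - z)) + C * cmod (w 0 - z)"
      by (intro add_mono sup_norm_ge[OF quot[OF w(3)] x] est w x)
    finally show "cmod (d x) \<le> sup_norm M (\<lambda>x. (F (w 0) x - F z x) / (w 0 - z)) + C * cmod (w 0 - z)" .
  qed (simp add: d_def)
  have ev: "\<forall>\<^sub>F w in at z within D. w \<in> D \<and> dist w z < r / 2 \<and> w \<noteq> z"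
    unfolding eventually_at using r by (intro exI[of _ "r / 2"]) auto
  have "((\<lambda>w. sup_norm M (\<lambda>x. (F w x - F z x) / (w - z) - d x)) \<longlongrightarrow> 0) (at z within D)"
  proof (rule Lim_null_comparison)
    show "\<forall>\<^sub>F w in at z within D. norm (sup_norm M (\<lambda>x. (F w x - F z x) / (w - z) - d x)) \<le> C * cmod (w - z)"
      using ev
    proof eventually_elim
      case (elim w)
      then have "0 \<le> sup_norm M (\<lambda>x. (F w x - F z x) / (w - z) - d x)"
        by (intro sup_norm_nonneg bdd_meas_diff[OF quot d]) auto
      moreover have "sup_norm M (\<lambda>x. (F w x - F z x) / (w - z) - d x) \<le> C * cmod (w - z)"
        using elim by (intro sup_norm_le est) auto
      ultimately show ?case by simp
    qed
    have "((\<lambda>w. C * cmod (w - z)) \<longlongrightarrow> C * cmod (z - z)) (at z within D)"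
      by (intro tendsto_intros)
    then show "((\<lambda>w. C * cmod (w - z)) \<longlongrightarrow> 0) (at z within D)" by simp
  qed
  with d show "\<exists>d\<in>bdd_meas M. ((\<lambda>w. sup_norm M (\<lambda>x. (F w x - F z x) / (w - z) - d x)) \<longlongrightarrow> 0) (at z within D)"
    by blast
qed

end

section \<open>The quadratic vector equation\<close>

locale qve = prob_space M for M :: "'x measure" +
  fixes S :: "('x \<Rightarrow> complex) \<Rightarrow> 'x \<Rightarrow> complex" and a :: "'x \<Rightarrow> complex"
  assumes bounded: "bounded_operator M S"
    and nonzero: "\<exists>w\<in>bdd_meas M. S w \<noteq> (\<lambda>x. 0)"
    and a: "a \<in> bdd_meas M"
    and a_real: "\<forall>x\<in>space M. a x \<in> \<real>"
    and symmetric: "symmetric_operator M S"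
    and positive: "positivity_preserving M S"
begin

section \<open>The operator norm and the positive functionals given by \<open>S\<close>\<close>

abbreviation "s \<equiv> op_norm M S"
abbreviation "A \<equiv> sup_norm M a"

lemma S_bdd: "w \<in> bdd_meas M \<Longrightarrow> S w \<in> bdd_meas M"
  and S_add: "u \<in> bdd_meas M \<Longrightarrow> w \<in> bdd_meas M \<Longrightarrow> S (\<lambda>x. u x + w x) = (\<lambda>x. S u x + S w x)"
  and S_cmult: "w \<in> bdd_meas M \<Longrightarrow> S (\<lambda>x. c * w x) = (\<lambda>x. c * S w x)"
  using bounded unfolding bounded_operator_def by blast+

lemma S_diff: "u \<in> bdd_meas M \<Longrightarrow> w \<in> bdd_meas M \<Longrightarrow> S (\<lambda>x. u x - w x) = (\<lambda>x. S u x - S w x)"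
  using S_add[of u "\<lambda>x. -1 * w x"] S_cmult[of w "-1"] bdd_meas_cmult[of w "-1"] by simp

text \<open>Normalisation reduces the claim to the unit ball, where \<open>bounded_operator\<close>
  makes the supremum finite; a function of norm zero cannot be normalised and is settled by the
  constant \<open>K\<close> directly.\<close>

lemma op_norm_bound:
  assumes w: "w \<in> bdd_meas M"
  shows "sup_norm M (S w) \<le> s * sup_norm M w"
proof -
  obtain K where K: "\<And>w. w \<in> bdd_meas M \<Longrightarrow> sup_norm M (S w) \<le> K * sup_norm M w"
    using bounded unfolding bounded_operator_def by blast
  show ?thesis
  proof (cases "sup_norm M w = 0")
    case True
    then show ?thesis using K[OF w] by simp
  next
    case False
    then have pos: "0 < sup_norm M w" using sup_norm_nonneg[OF w] by simp
    let ?c = "inverse (sup_norm M w)"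
    let ?w = "\<lambda>x. of_real ?c * w x"
    have w': "?w \<in> bdd_meas M" by (rule bdd_meas_cmult[OF w])
    have "sup_norm M ?w \<le> 1"
    proof (rule sup_norm_le)
      fix x assume "x \<in> space M"
      have "cmod (?w x) = ?c * cmod (w x)" using pos by (simp only: norm_mult norm_of_real) simp
      also have "\<dots> \<le> ?c * sup_norm M w"
        using sup_norm_ge[OF w \<open>x \<in> space M\<close>] pos by (intro mult_left_mono) auto
      also have "\<dots> = 1" using pos by simp
      finally show "cmod (?w x) \<le> 1" .
    qed
    then have "sup_norm M (S ?w) \<le> s"
      unfolding op_norm_def
    proof (intro cSUP_upper)
      show "bdd_above ((\<lambda>w. sup_norm M (S w)) ` {w \<in> bdd_meas M. sup_norm M w \<le> 1})"
      proof (rule bdd_aboveI2)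
        fix v assume v: "v \<in> {w \<in> bdd_meas M. sup_norm M w \<le> 1}"
        have "sup_norm M (S v) \<le> K * sup_norm M v" using K v by simp
        also have "\<dots> \<le> \<bar>K\<bar> * 1" using v sup_norm_nonneg by (intro mult_mono) auto
        finally show "sup_norm M (S v) \<le> \<bar>K\<bar>" by simp
      qed
    qed (use w' in auto)
    have "cmod (S w x) \<le> s * sup_norm M w" if x: "x \<in> space M" for x
    proof -
      have "cmod (S ?w x) \<le> s"
        using sup_norm_ge[OF S_bdd[OF w'] x] \<open>sup_norm M (S ?w) \<le> s\<close> by simp
      moreover have "cmod (S ?w x) = ?c * cmod (S w x)"
        using pos by (simp only: S_cmult[OF w] norm_mult norm_of_real) simp
      ultimately have "?c * cmod (S w x) \<le> s" by (simp only:)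
      then show ?thesis using pos by (simp add: field_simps)
    qed
    then show ?thesis by (rule sup_norm_le)
  qed
qed

lemma cmod_S_le:
  assumes w: "w \<in> bdd_meas M" and B: "\<And>y. y \<in> space M \<Longrightarrow> cmod (w y) \<le> B" and x: "x \<in> space M" and s: "0 \<le> s"
  shows "cmod (S w x) \<le> s * B"
proof -
  have "cmod (S w x) \<le> s * sup_norm M w"
    using sup_norm_ge[OF S_bdd[OF w] x] op_norm_bound[OF w] by linarith
  also have "\<dots> \<le> s * B" using sup_norm_le[OF B] s by (intro mult_left_mono) auto
  finally show ?thesis .
qed

lemma s_pos: "0 < s"
proof (rule ccontr)
  assume s: "\<not> 0 < s"
  obtain w where w: "w \<in> bdd_meas M" "S w \<noteq> (\<lambda>x. 0)" using nonzero by blast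
  have "sup_norm M (S w) \<le> 0"
    using op_norm_bound[OF w(1)] s sup_norm_nonneg[OF w(1)] by (meson mult_nonpos_nonneg not_le order_trans)
  then have "S w x = 0" if "x \<in> space M" for x
    using sup_norm_ge[OF S_bdd[OF w(1)] that] by (metis norm_le_zero_iff order_trans)
  moreover have "S w x = 0" if "x \<notin> space M" for x
    using S_bdd[OF w(1)] that by (simp add: bdd_meas_def)
  ultimately show False using w(2) by blast
qed

lemma A_nonneg: "0 \<le> A"
  by (rule sup_norm_nonneg[OF a])

text \<open>The positive linear functional sending p to (S p)(x); it stands in for integration
  against a row of a kernel.\<close>

definition L :: "'x \<Rightarrow> ('x \<Rightarrow> real) \<Rightarrow> real" where
  "L x p = Re (S (embed p) x)"

lemma S_embed_nonneg:
  assumes "bdd_real p" "\<And>y. y \<in> space M \<Longrightarrow> 0 \<le> p y" "x \<in> space M"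
  shows "S (embed p) x \<in> \<real>\<^sub>\<ge>\<^sub>0"
  using positive embed_bdd_meas[OF assms(1)] assms(2,3) unfolding positivity_preserving_def
  by (auto simp: embed_eq)

lemma embed_add: "embed (\<lambda>y. p y + q y) = (\<lambda>y. embed p y + embed q y)"
  and embed_cmult: "embed (\<lambda>y. c * p y) = (\<lambda>y. of_real c * embed p y)"
  by (auto simp: embed_def)

lemma L_add: "bdd_real p \<Longrightarrow> bdd_real q \<Longrightarrow> L x (\<lambda>y. p y + q y) = L x p + L x q"
  by (simp add: L_def embed_add S_add embed_bdd_meas)

lemma L_cmult: "bdd_real p \<Longrightarrow> L x (\<lambda>y. c * p y) = c * L x p"
  by (simp add: L_def embed_cmult S_cmult embed_bdd_meas)

lemma L_diff: "bdd_real p \<Longrightarrow> bdd_real q \<Longrightarrow> L x (\<lambda>y. p y - q y) = L x p - L x q"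
  using L_add[of p "\<lambda>y. -1 * q y" x] L_cmult[of q x "-1"] bdd_real_mult[OF bdd_real_const[of "-1"], of q] by simp

lemma L_nonneg:
  assumes "bdd_real p" "\<And>y. y \<in> space M \<Longrightarrow> 0 \<le> p y" "x \<in> space M"
  shows "0 \<le> L x p"
  using S_embed_nonneg[OF assms] by (simp add: L_def complex_nonneg_Reals_iff)

lemma L_mono:
  assumes "bdd_real p" "bdd_real q" "\<And>y. y \<in> space M \<Longrightarrow> p y \<le> q y" "x \<in> space M"
  shows "L x p \<le> L x q"
  using L_nonneg[of "\<lambda>y. q y - p y" x] bdd_real_diff assms by (simp add: L_diff)

text \<open>Positivity forces reality: if B bounds |p|, then p + B and the constant B are
  nonnegative, so their images are nonnegative reals, and these differ by the image of p.\<close>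

lemma S_embed:
  assumes p: "bdd_real p" and x: "x \<in> space M"
  shows "S (embed p) x = of_real (L x p)"
proof -
  obtain B where B: "\<And>y. y \<in> space M \<Longrightarrow> \<bar>p y\<bar> \<le> B" using p by (auto simp: bdd_real_def)
  obtain y where "y \<in> space M" using not_empty by blast
  with B[of y] have B0: "0 \<le> B" by simp
  let ?q = "\<lambda>y. p y + B"
  have q: "bdd_real ?q" by (intro bdd_real_add p bdd_real_const)
  have "S (embed ?q) x = S (embed p) x + S (embed (\<lambda>_. B)) x"
    by (simp add: embed_add S_add embed_bdd_meas p bdd_real_const)
  moreover have "S (embed ?q) x \<in> \<real>\<^sub>\<ge>\<^sub>0"
    by (rule S_embed_nonneg[OF q _ x]) (use B in \<open>force simp: abs_le_iff\<close>)
  moreover have "S (embed (\<lambda>_. B)) x \<in> \<real>\<^sub>\<ge>\<^sub>0"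
    by (rule S_embed_nonneg[OF bdd_real_const _ x]) (rule B0)
  ultimately have "Im (S (embed p) x) = 0"
    by (simp add: complex_nonneg_Reals_iff)
  then show ?thesis by (simp add: L_def complex_eq_iff)
qed

lemma S_eq_Complex:
  assumes w: "w \<in> bdd_meas M" and x: "x \<in> space M"
  shows "S w x = Complex (L x (\<lambda>y. Re (w y))) (L x (\<lambda>y. Im (w y)))"
proof -
  have eq: "w = (\<lambda>y. embed (\<lambda>y. Re (w y)) y + \<i> * embed (\<lambda>y. Im (w y)) y)"
    using w by (auto simp: embed_def bdd_meas_def complex_eq_iff)
  have "S w x = S (embed (\<lambda>y. Re (w y))) x + \<i> * S (embed (\<lambda>y. Im (w y))) x"
    by (subst eq) (simp add: S_add S_cmult bdd_meas_cmult embed_bdd_meas bdd_real_Re bdd_real_Im w)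
  then show ?thesis
    by (simp add: S_embed bdd_real_Re bdd_real_Im w x complex_eq_iff)
qed

lemma Im_S: "w \<in> bdd_meas M \<Longrightarrow> x \<in> space M \<Longrightarrow> Im (S w x) = L x (\<lambda>y. Im (w y))"
  by (simp add: S_eq_Complex)

text \<open>A unimodular \<open>c\<close> makes c S w x nonnegative; moved inside \<open>S\<close>
  it leaves the real part of c w, which is at most |w|.\<close>

lemma cmod_S_le_L:
  assumes w: "w \<in> bdd_meas M" and x: "x \<in> space M"
  shows "cmod (S w x) \<le> L x (\<lambda>y. cmod (w y))"
proof -
  define c where "c = (if S w x = 0 then 1 else cnj (sgn (S w x)))"
  have c: "cmod c = 1" by (auto simp: c_def norm_sgn)
  have "c * S w x = of_real (cmod (S w x))"
    by (auto simp: c_def sgn_eq complex_eq_iff cmod_def power2_eq_square field_simps)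
  then have "cmod (S w x) = Re (S (\<lambda>y. c * w y) x)"
    by (simp add: S_cmult[OF w])
  also have "\<dots> = L x (\<lambda>y. Re (c * w y))"
    by (simp only: S_eq_Complex[OF bdd_meas_cmult[OF w] x] complex.sel)
  also have "\<dots> \<le> L x (\<lambda>y. cmod (w y))"
  proof (rule L_mono[OF bdd_real_Re[OF bdd_meas_cmult[OF w]] bdd_real_cmod[OF w] _ x])
    fix y
    show "Re (c * w y) \<le> cmod (w y)"
      using complex_Re_le_cmod[of "c * w y"] c by (simp add: norm_mult)
  qed
  finally show ?thesis .
qed

lemma L_le:
  assumes p: "bdd_real p" and B: "\<And>y. y \<in> space M \<Longrightarrow> \<bar>p y\<bar> \<le> B" and x: "x \<in> space M"
  shows "L x p \<le> s * B"
proof -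
  have "L x p \<le> cmod (S (embed p) x)" unfolding L_def by (rule complex_Re_le_cmod)
  also have "\<dots> \<le> s * B"
    by (rule cmod_S_le[OF embed_bdd_meas[OF p] _ x]) (use B s_pos in \<open>auto simp: embed_eq\<close>)
  finally show ?thesis .
qed

lemma bdd_real_sqrt:
  assumes "bdd_real p" shows "bdd_real (\<lambda>y. sqrt (p y))"
proof -
  obtain B where B: "\<forall>y\<in>space M. \<bar>p y\<bar> \<le> B" and p: "p \<in> borel_measurable M"
    using assms by (auto simp: bdd_real_def)
  show ?thesis
  proof (rule bdd_realI)
    show "(\<lambda>y. sqrt (p y)) \<in> borel_measurable M" using p by measurable
    show "\<bar>sqrt (p y)\<bar> \<le> sqrt B" if "y \<in> space M" for y
    proof -
      have "\<bar>sqrt (p y)\<bar> = sqrt \<bar>p y\<bar>" by (auto simp: abs_if real_sqrt_minus)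
      then show ?thesis using B that by simp
    qed
  qed
qed

text \<open>The functional applied to (t sqrt p - sqrt q)^2 gives a quadratic in t that is
  nonnegative for every real t, so its discriminant is not positive.\<close>

lemma L_Cauchy_Schwarz:
  assumes p: "bdd_real p" "\<And>y. y \<in> space M \<Longrightarrow> 0 \<le> p y"
    and q: "bdd_real q" "\<And>y. y \<in> space M \<Longrightarrow> 0 \<le> q y" and x: "x \<in> space M"
  shows "(L x (\<lambda>y. sqrt (p y * q y)))\<^sup>2 \<le> L x p * L x q"
proof -
  let ?r = "\<lambda>y. sqrt (p y * q y)"
  let ?c = "L x ?r"
  have r: "bdd_real ?r" by (intro bdd_real_sqrt bdd_real_mult p q)
  have quad: "0 \<le> t\<^sup>2 * L x p - 2 * t * ?c + L x q" for t
  proof -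
    have tp: "bdd_real (\<lambda>y. t\<^sup>2 * p y)" "bdd_real (\<lambda>y. (2 * t) * ?r y)"
      by (intro bdd_real_mult bdd_real_const p r)+
    have "0 \<le> L x (\<lambda>y. t\<^sup>2 * p y - (2 * t) * ?r y + q y)"
    proof (rule L_nonneg[OF _ _ x])
      show "bdd_real (\<lambda>y. t\<^sup>2 * p y - (2 * t) * ?r y + q y)"
        by (intro bdd_real_add bdd_real_diff tp q)
      fix y assume y: "y \<in> space M"
      have "t\<^sup>2 * p y - (2 * t) * ?r y + q y = (t * sqrt (p y) - sqrt (q y))\<^sup>2"
        using p(2)[OF y] q(2)[OF y] by (simp add: power2_diff power_mult_distrib real_sqrt_mult)
      then show "0 \<le> t\<^sup>2 * p y - (2 * t) * ?r y + q y" by simp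
    qed
    also have "\<dots> = L x (\<lambda>y. t\<^sup>2 * p y) - L x (\<lambda>y. (2 * t) * ?r y) + L x q"
      by (simp only: L_add[OF bdd_real_diff[OF tp] q(1)] L_diff[OF tp])
    finally show ?thesis by (simp only: L_cmult[OF p(1)] L_cmult[OF r])
  qed
  have nn: "0 \<le> L x p" "0 \<le> L x q" using L_nonneg p q x by auto
  show ?thesis
  proof (cases "L x p = 0")
    case True
    have "?c = 0"
    proof (rule ccontr)
      assume "?c \<noteq> 0"
      \<comment> \<open>With L x p = 0 the quadratic is affine in t, and this t gives it the value
        -1.\<close>
      then show False using quad[of "(L x q + 1) / (2 * ?c)"] True by simp
    qed
    then show ?thesis using True by simp
  next
    case False
    then have "0 < L x p" using nn by simp
    moreover have "0 \<le> (?c / L x p)\<^sup>2 * L x p - 2 * (?c / L x p) * ?c + L x q" by (rule quad)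
    ultimately show ?thesis by (simp add: power2_eq_square field_simps)
  qed
qed


section \<open>The fixed point map and its contraction\<close>

text \<open>The closed half plane, unlike \<open>bdd_meas_plus\<close>, admits the zero function
  that starts the iteration; by \<open>\<Phi>_plus\<close> one step reaches the open half
  plane.\<close>

definition upper :: "('x \<Rightarrow> complex) set" where
  "upper = {u \<in> bdd_meas M. \<forall>x\<in>space M. 0 \<le> Im (u x)}"

definition denom :: "complex \<Rightarrow> ('x \<Rightarrow> complex) \<Rightarrow> 'x \<Rightarrow> complex" where
  "denom z u x = z + a x + S u x"

definition \<Phi> :: "complex \<Rightarrow> ('x \<Rightarrow> complex) \<Rightarrow> 'x \<Rightarrow> complex" where
  "\<Phi> z u = (\<lambda>x. if x \<in> space M then - (1 / denom z u x) else 0)"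

lemma upper_bdd: "u \<in> upper \<Longrightarrow> u \<in> bdd_meas M"
  and upper_Im: "u \<in> upper \<Longrightarrow> x \<in> space M \<Longrightarrow> 0 \<le> Im (u x)"
  by (auto simp: upper_def)

lemma plus_upper: "u \<in> bdd_meas_plus M \<Longrightarrow> u \<in> upper"
  by (auto simp: upper_def bdd_meas_plus_def less_imp_le)

lemma \<Phi>_eq: "x \<in> space M \<Longrightarrow> \<Phi> z u x = - (1 / denom z u x)"
  by (simp add: \<Phi>_def)

lemma Im_a: "x \<in> space M \<Longrightarrow> Im (a x) = 0"
  using a_real by (auto simp: complex_is_Real_iff)

lemma Im_denom: "u \<in> upper \<Longrightarrow> x \<in> space M \<Longrightarrow> Im (denom z u x) = Im z + L x (\<lambda>y. Im (u y))"
  by (simp add: denom_def Im_a Im_S upper_bdd)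

lemma L_Im_nonneg: "u \<in> upper \<Longrightarrow> x \<in> space M \<Longrightarrow> 0 \<le> L x (\<lambda>y. Im (u y))"
  by (intro L_nonneg bdd_real_Im upper_bdd upper_Im)

lemma Im_denom_ge: "u \<in> upper \<Longrightarrow> x \<in> space M \<Longrightarrow> Im z \<le> Im (denom z u x)"
  using L_Im_nonneg by (simp add: Im_denom)

lemma cmod_denom_ge: "u \<in> upper \<Longrightarrow> x \<in> space M \<Longrightarrow> Im z \<le> cmod (denom z u x)"
  using Im_denom_ge[of u x z] abs_Im_le_cmod[of "denom z u x"] by linarith

lemma cmod_denom_le:
  assumes u: "u \<in> bdd_meas M" and B: "\<And>y. y \<in> space M \<Longrightarrow> cmod (u y) \<le> B" and x: "x \<in> space M"
  shows "cmod (denom z u x) \<le> cmod z + A + s * B" "cmod z - A - s * B \<le> cmod (denom z u x)"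
proof -
  have 1: "cmod (a x) \<le> A" by (rule sup_norm_ge[OF a x])
  have 2: "cmod (S u x) \<le> s * B" using cmod_S_le[OF u B x] s_pos by simp
  have "cmod (denom z u x) \<le> cmod z + cmod (a x) + cmod (S u x)"
    unfolding denom_def using norm_triangle_ineq[of "z + a x" "S u x"] norm_triangle_ineq[of z "a x"] by linarith
  with 1 2 show "cmod (denom z u x) \<le> cmod z + A + s * B" by linarith
  have "cmod (denom z u x - a x - S u x) \<le> cmod (denom z u x) + cmod (a x) + cmod (S u x)"
    using norm_triangle_ineq4[of "denom z u x - a x" "S u x"] norm_triangle_ineq4[of "denom z u x" "a x"] by linarith
  then have "cmod z \<le> cmod (denom z u x) + cmod (a x) + cmod (S u x)" by (simp add: denom_def)
  with 1 2 show "cmod z - A - s * B \<le> cmod (denom z u x)" by linarith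
qed

lemma cmod_\<Phi>_le:
  assumes "u \<in> upper" "x \<in> space M" "0 < Im z"
  shows "cmod (\<Phi> z u x) \<le> 1 / Im z"
  using cmod_denom_ge[OF assms(1,2), of z] assms by (simp add: \<Phi>_eq norm_divide frac_le)

text \<open>From Im (- 1 / d) = Im d |1 / d|^2. This exact balance between imaginary part and
  modulus yields the contraction, the control of Im for large |z| and the L2 bound.\<close>

lemma Im_\<Phi>:
  assumes "u \<in> upper" "x \<in> space M"
  shows "Im (\<Phi> z u x) = (Im z + L x (\<lambda>y. Im (u y))) * (cmod (\<Phi> z u x))\<^sup>2"
proof -
  have "Im (- (1 / w)) = Im w * (cmod (- (1 / w)))\<^sup>2" for w
    by (simp add: Im_divide cmod_power2 norm_divide power_divide)
  from this[of "denom z u x"] show ?thesis using assms by (simp add: \<Phi>_eq Im_denom)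
qed

lemma denom_measurable: "u \<in> bdd_meas M \<Longrightarrow> denom z u \<in> borel_measurable M"
  using bdd_meas_measurable[OF S_bdd] bdd_meas_measurable[OF a] unfolding denom_def by measurable

lemma \<Phi>_plus:
  assumes u: "u \<in> upper" and z: "0 < Im z"
  shows "\<Phi> z u \<in> bdd_meas_plus M"
proof -
  have [measurable]: "denom z u \<in> borel_measurable M" by (rule denom_measurable[OF upper_bdd[OF u]])
  have "\<Phi> z u \<in> borel_measurable M"
    by (subst measurable_cong[of M _ "\<lambda>x. - (1 / denom z u x)"]) (auto simp: \<Phi>_def)
  then have "\<Phi> z u \<in> bdd_meas M"
    by (rule bdd_measI[OF _ cmod_\<Phi>_le[OF u _ z]]) (auto simp: \<Phi>_def)
  moreover have "0 < Im (\<Phi> z u x)" if x: "x \<in> space M" for x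
  proof -
    have "denom z u x \<noteq> 0" using cmod_denom_ge[OF u x, of z] z by auto
    then have "0 < (cmod (\<Phi> z u x))\<^sup>2" using x by (simp add: \<Phi>_eq)
    moreover have "0 < Im z + L x (\<lambda>y. Im (u y))" using L_Im_nonneg[OF u x] z by simp
    ultimately show ?thesis unfolding Im_\<Phi>[OF u x] by (rule mult_pos_pos[rotated])
  qed
  ultimately show ?thesis by (simp add: bdd_meas_plus_def)
qed

text \<open>A fixed point in the closed half plane has positive imaginary part by
  \<open>\<Phi>_plus\<close>, so existence and uniqueness can be treated in
  \<open>upper\<close>.\<close>

lemma qve_solution_iff_fixed_point:
  assumes z: "0 < Im z"
  shows "qve_solution M S a z m \<longleftrightarrow> m \<in> upper \<and> \<Phi> z m = m"
proof
  assume m: "qve_solution M S a z m"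
  have "\<Phi> z m x = m x" for x
  proof (cases "x \<in> space M")
    case True
    then have "- (1 / m x) = denom z m x" using m by (simp add: qve_solution_def denom_def)
    then have "denom z m x = 1 / (- m x)" by simp
    then have "1 / denom z m x = - m x" by simp
    then show ?thesis using True by (simp add: \<Phi>_eq)
  next
    case False
    then show ?thesis using m by (simp add: \<Phi>_def qve_solution_def bdd_meas_plus_def bdd_meas_def)
  qed
  then show "m \<in> upper \<and> \<Phi> z m = m" using m plus_upper by (auto simp: qve_solution_def)
next
  assume m: "m \<in> upper \<and> \<Phi> z m = m"
  then have "m \<in> bdd_meas_plus M" using \<Phi>_plus[of m z] z by auto
  moreover have "- (1 / m x) = z + a x + S m x" if "x \<in> space M" for x
  proof -
    have "m x = - (1 / denom z m x)" using m \<Phi>_eq[OF that, of z m] by simp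
    then have "- (1 / m x) = denom z m x" by simp
    then show ?thesis by (simp add: denom_def)
  qed
  ultimately show "qve_solution M S a z m" by (simp add: qve_solution_def)
qed

text \<open>Hypothesis \<open>uw\<close> bounds the hyperbolic quantity \<open>\<bar>u - w\<bar>\<^sup>2 / (Im u Im w)\<close> by \<open>k\<^sup>2\<close>.\<close>

lemma \<Phi>_contract:
  assumes \<eta>: "0 < \<eta>" "\<eta> \<le> Im z" and u: "u \<in> upper" and w: "w \<in> upper" and k: "0 \<le> k"
    and uB: "\<And>x. x \<in> space M \<Longrightarrow> cmod (u x) \<le> B" and wB: "\<And>x. x \<in> space M \<Longrightarrow> cmod (w x) \<le> B"
    and uw: "\<And>x. x \<in> space M \<Longrightarrow> cmod (u x - w x) \<le> k * sqrt (Im (u x) * Im (w x))"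
    and x: "x \<in> space M"
  shows "cmod (\<Phi> z u x - \<Phi> z w x) \<le> k * (s * B / (\<eta> + s * B)) * sqrt (Im (\<Phi> z u x) * Im (\<Phi> z w x))"
proof -
  let ?p = "L x (\<lambda>y. Im (u y))" and ?q = "L x (\<lambda>y. Im (w y))"
  let ?y = "Im z"
  define c where "c = s * B / (\<eta> + s * B)"
  have B0: "0 \<le> B" using order_trans[OF norm_ge_zero uB[OF x]] .
  have sB: "0 \<le> s * B" using s_pos B0 by simp
  have c0: "0 \<le> c" using sB \<eta> by (simp add: c_def)
  have ub: "u \<in> bdd_meas M" and wb: "w \<in> bdd_meas M" using u w upper_bdd by auto
  have pq0: "0 \<le> ?p" "0 \<le> ?q" using L_Im_nonneg u w x by auto
  \<comment> \<open>The factor below one arises here: t \<le> s * B gives t (\<eta> + s * B) \<le> s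
    * B (\<eta> + t), and \<eta> \<le> Im z.\<close>
  have Lc: "L x (\<lambda>y. Im (v y)) \<le> c * (?y + L x (\<lambda>y. Im (v y)))"
    if v: "v \<in> upper" and vB: "\<And>x. x \<in> space M \<Longrightarrow> cmod (v x) \<le> B" for v
  proof -
    let ?t = "L x (\<lambda>y. Im (v y))"
    have t: "0 \<le> ?t" "?t \<le> s * B"
      using L_Im_nonneg[OF v x] L_le[OF bdd_real_Im[OF upper_bdd[OF v]] order_trans[OF abs_Im_le_cmod vB] x] by auto
    have "?t * (\<eta> + s * B) \<le> s * B * (\<eta> + ?t)"
      using mult_right_mono[OF t(2), of \<eta>] \<eta> by (simp add: algebra_simps)
    also have "\<dots> \<le> s * B * (?y + ?t)" using \<eta> sB by (intro mult_left_mono) auto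
    finally have "?t \<le> s * B * (?y + ?t) / (\<eta> + s * B)" using \<eta> sB by (simp add: pos_le_divide_eq)
    then show ?thesis by (simp add: c_def)
  qed
  have "cmod (S (\<lambda>y. u y - w y) x) \<le> L x (\<lambda>y. cmod (u y - w y))"
    by (rule cmod_S_le_L[OF bdd_meas_diff[OF ub wb] x])
  also have "\<dots> \<le> L x (\<lambda>y. k * sqrt (Im (u y) * Im (w y)))"
    by (intro L_mono[OF bdd_real_cmod[OF bdd_meas_diff[OF ub wb]] _ uw x] bdd_real_mult[OF bdd_real_const]
        bdd_real_sqrt bdd_real_mult bdd_real_Im ub wb)
  also have "\<dots> = k * L x (\<lambda>y. sqrt (Im (u y) * Im (w y)))"
    by (intro L_cmult bdd_real_sqrt bdd_real_mult bdd_real_Im ub wb)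
  also have "\<dots> \<le> k * sqrt (?p * ?q)"
    using L_Cauchy_Schwarz[OF bdd_real_Im[OF ub] upper_Im[OF u] bdd_real_Im[OF wb] upper_Im[OF w] x] k
    by (intro mult_left_mono real_le_rsqrt)
  also have "\<dots> \<le> k * (c * sqrt ((?y + ?p) * (?y + ?q)))"
  proof (intro mult_left_mono k)
    have "?p * ?q \<le> (c * (?y + ?p)) * (c * (?y + ?q))"
      using Lc[OF u uB] Lc[OF w wB] pq0 by (intro mult_mono) auto
    also have "\<dots> = c\<^sup>2 * ((?y + ?p) * (?y + ?q))" by (simp add: power2_eq_square)
    finally have "sqrt (?p * ?q) \<le> sqrt (c\<^sup>2 * ((?y + ?p) * (?y + ?q)))" by simp
    then show "sqrt (?p * ?q) \<le> c * sqrt ((?y + ?p) * (?y + ?q))"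
      using c0 by (simp add: real_sqrt_mult)
  qed
  finally have Sd: "cmod (S (\<lambda>y. u y - w y) x) \<le> k * c * sqrt ((?y + ?p) * (?y + ?q))" by (simp add: mult_ac)
  have ne: "denom z u x \<noteq> 0" "denom z w x \<noteq> 0"
    using cmod_denom_ge[OF u x, of z] cmod_denom_ge[OF w x, of z] \<eta> by auto
  \<comment> \<open>A difference of reciprocals; the two factors \<open>\<Phi>\<close> are absorbed
    below into the imaginary parts by \<open>Im_\<Phi>\<close>.\<close>
  have "\<Phi> z u x - \<Phi> z w x = (denom z u x - denom z w x) * (\<Phi> z u x * \<Phi> z w x)"
    using ne x by (simp add: \<Phi>_eq field_simps)
  also have "denom z u x - denom z w x = S (\<lambda>y. u y - w y) x"
    by (simp add: denom_def S_diff[OF ub wb])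
  finally have "cmod (\<Phi> z u x - \<Phi> z w x) = cmod (S (\<lambda>y. u y - w y) x) * (cmod (\<Phi> z u x) * cmod (\<Phi> z w x))"
    by (simp add: norm_mult)
  also have "\<dots> \<le> k * c * sqrt ((?y + ?p) * (?y + ?q)) * (cmod (\<Phi> z u x) * cmod (\<Phi> z w x))"
    using Sd by (intro mult_right_mono) auto
  also have "\<dots> = k * c * sqrt (Im (\<Phi> z u x) * Im (\<Phi> z w x))"
    unfolding Im_\<Phi>[OF u x, of z] Im_\<Phi>[OF w x, of z] by (simp add: real_sqrt_mult real_sqrt_power)
  finally show ?thesis by (simp add: c_def)
qed

text \<open>A set that every \<open>\<Phi> z\<close> with Im z \<ge> \<eta> maps into itself, so
  that constants can be uniform in z.\<close>

definition cap :: "real \<Rightarrow> ('x \<Rightarrow> complex) set" where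
  "cap \<eta> = {u \<in> upper. \<forall>x\<in>space M. cmod (u x) \<le> 1 / \<eta>}"

lemma cap_upper: "u \<in> cap \<eta> \<Longrightarrow> u \<in> upper"
  by (simp add: cap_def)

lemma zero_cap: "0 < \<eta> \<Longrightarrow> (\<lambda>_. 0) \<in> cap \<eta>"
  by (simp add: cap_def upper_def zero_bdd_meas)

lemma \<Phi>_cap:
  assumes "0 < \<eta>" "\<eta> \<le> Im z" "u \<in> upper"
  shows "\<Phi> z u \<in> cap \<eta>"
proof -
  have "cmod (\<Phi> z u x) \<le> 1 / \<eta>" if "x \<in> space M" for x
    using cmod_\<Phi>_le[OF assms(3) that, of z] assms frac_le[of 1 1 \<eta> "Im z"] by linarith
  then show ?thesis using plus_upper[OF \<Phi>_plus[of u z]] assms by (auto simp: cap_def)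
qed

lemma \<Phi>_pow_cap:
  assumes "0 < \<eta>" "\<eta> \<le> Im z" "u \<in> cap \<eta>"
  shows "(\<Phi> z ^^ n) u \<in> cap \<eta>"
  using assms by (induction n) (auto intro!: \<Phi>_cap cap_upper)

text \<open>In \<open>Im_\<Phi>\<close> the numerator is at least \<eta> and the modulus of the
  denominator at most \<rho> + A + s / \<eta>. After one application the hyperbolic quotient is
  therefore finite.\<close>

lemma Im_\<Phi>_ge:
  assumes \<eta>: "0 < \<eta>" "\<eta> \<le> Im z" and \<rho>: "cmod z \<le> \<rho>" and u: "u \<in> cap \<eta>" and x: "x \<in> space M"
  shows "\<eta> / (\<rho> + A + s / \<eta>)\<^sup>2 \<le> Im (\<Phi> z u x)"
proof -
  have u': "u \<in> upper" using u by (simp add: cap_def)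
  let ?R = "\<rho> + A + s / \<eta>"
  have d: "cmod (denom z u x) \<le> ?R"
    using cmod_denom_le(1)[OF upper_bdd[OF u'], of "1 / \<eta>" x z] u x \<rho> by (simp add: cap_def)
  have d0: "0 < cmod (denom z u x)" using cmod_denom_ge[OF u' x, of z] \<eta> by linarith
  have "\<eta> / ?R\<^sup>2 \<le> (Im z + L x (\<lambda>y. Im (u y))) / (cmod (denom z u x))\<^sup>2"
    using L_Im_nonneg[OF u' x] \<eta> d d0 by (intro frac_le power_mono zero_less_power) auto
  also have "\<dots> = Im (\<Phi> z u x)"
    unfolding Im_\<Phi>[OF u' x] by (simp add: \<Phi>_eq[OF x] norm_divide power_divide)
  finally show ?thesis .
qed

text \<open>The shift between \<open>Suc n\<close> and q^n pays for the first step, which only makes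
  the quotient finite. \<open>K\<close> and \<open>q\<close> are fixed before z, u, w and x, so one
  rate, s / (\<eta>^2 + s), serves the whole region.\<close>

lemma \<Phi>_pow_close:
  assumes \<eta>: "0 < \<eta>"
  shows "\<exists>K q. 0 \<le> q \<and> q < 1 \<and> (\<forall>z u w n x. \<eta> \<le> Im z \<longrightarrow> cmod z \<le> \<rho> \<longrightarrow> u \<in> cap \<eta> \<longrightarrow> w \<in> cap \<eta> \<longrightarrow>
      x \<in> space M \<longrightarrow> cmod ((\<Phi> z ^^ Suc n) u x - (\<Phi> z ^^ Suc n) w x) \<le> K * q ^ n)"
proof -
  define B where "B = 1 / \<eta>"
  define q where "q = s * B / (\<eta> + s * B)"
  define c where "c = \<eta> / (\<rho> + A + s / \<eta>)\<^sup>2"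
  \<comment> \<open>Trivially |u - w| \<le> 2 B, and both imaginary parts are at least c after one
    step, so this k starts the induction.\<close>
  define k where "k = 2 * B / c"
  have B: "0 < B" using \<eta> by (simp add: B_def)
  have q: "0 \<le> q" "q < 1" using \<eta> s_pos B by (auto simp: q_def divide_less_eq_1 add_pos_pos)
  have "cmod ((\<Phi> z ^^ Suc n) u x - (\<Phi> z ^^ Suc n) w x) \<le> k * B * q ^ n"
    if z: "\<eta> \<le> Im z" "cmod z \<le> \<rho>" and u: "u \<in> cap \<eta>" and w: "w \<in> cap \<eta>" and x: "x \<in> space M" for z u w n x
  proof -
    have "0 < \<rho>" using z \<eta> abs_Im_le_cmod[of z] by linarith
    then have R: "0 < \<rho> + A + s / \<eta>" using A_nonneg s_pos \<eta> by (simp add: add_pos_nonneg)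
    then have c: "0 < c" using \<eta> by (simp add: c_def)
    have k: "0 \<le> k" using B c by (simp add: k_def)
    let ?u = "\<lambda>n. (\<Phi> z ^^ n) u" and ?w = "\<lambda>n. (\<Phi> z ^^ n) w"
    have cap: "?u n \<in> cap \<eta>" "?w n \<in> cap \<eta>" for n
      using \<Phi>_pow_cap[OF \<eta> z(1)] u w by auto
    have up: "?u n \<in> upper" "?w n \<in> upper" for n using cap[of n] by (auto simp: cap_def)
    have bd: "cmod (?u n x) \<le> B" "cmod (?w n x) \<le> B" if "x \<in> space M" for n x
      using cap[of n] that by (auto simp: cap_def B_def)
    have main: "cmod (?u (Suc n) x - ?w (Suc n) x) \<le> k * q ^ n * sqrt (Im (?u (Suc n) x) * Im (?w (Suc n) x))"
      if "x \<in> space M" for n x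
      using that
    proof (induction n arbitrary: x)
      case 0
      have "c \<le> Im (?u (Suc 0) x)" "c \<le> Im (?w (Suc 0) x)"
        using Im_\<Phi>_ge[OF \<eta> z _ 0] u w by (auto simp: c_def)
      then have "c * c \<le> Im (?u (Suc 0) x) * Im (?w (Suc 0) x)"
        using c by (intro mult_mono) linarith+
      then have "sqrt (c * c) \<le> sqrt (Im (?u (Suc 0) x) * Im (?w (Suc 0) x))" by (rule real_sqrt_le_mono)
      then have "k * c \<le> k * sqrt (Im (?u (Suc 0) x) * Im (?w (Suc 0) x))"
        using k c by (intro mult_left_mono) auto
      moreover have "k * c = 2 * B" using c by (simp add: k_def)
      moreover have "cmod (?u (Suc 0) x - ?w (Suc 0) x) \<le> 2 * B"
        using norm_triangle_ineq4[of "?u (Suc 0) x" "?w (Suc 0) x"] bd[OF 0, of "Suc 0"] by linarith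
      ultimately show ?case by simp
    next
      case (Suc n)
      have "cmod (\<Phi> z (?u (Suc n)) x - \<Phi> z (?w (Suc n)) x)
          \<le> (k * q ^ n) * (s * B / (\<eta> + s * B)) * sqrt (Im (\<Phi> z (?u (Suc n)) x) * Im (\<Phi> z (?w (Suc n)) x))"
        using q k by (intro \<Phi>_contract[OF \<eta> z(1) up _ bd Suc.IH Suc.prems]) auto
      then show ?case by (simp add: q_def mult_ac)
    qed
    have "sqrt (Im (?u (Suc n) x) * Im (?w (Suc n) x)) \<le> sqrt (B * B)"
    proof (intro real_sqrt_le_mono mult_mono)
      show "Im (?u (Suc n) x) \<le> B" "Im (?w (Suc n) x) \<le> B"
        using bd[OF x, of "Suc n"] abs_Im_le_cmod[of "?u (Suc n) x"] abs_Im_le_cmod[of "?w (Suc n) x"] by linarith+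
      show "0 \<le> Im (?w (Suc n) x)" using upper_Im[OF up(2) x] .
    qed (use B in auto)
    then have "k * q ^ n * sqrt (Im (?u (Suc n) x) * Im (?w (Suc n) x)) \<le> k * q ^ n * B"
      using B q k by (intro mult_left_mono) auto
    then show ?thesis using main[OF x, of n] by (simp add: mult_ac)
  qed
  with q show ?thesis by blast
qed


lemma fixed_points_eq:
  assumes z: "0 < Im z" and u: "u \<in> upper" "\<Phi> z u = u" and w: "w \<in> upper" "\<Phi> z w = w"
  shows "u = w"
proof
  fix x
  have cap: "u \<in> cap (Im z)" "w \<in> cap (Im z)"
    using \<Phi>_cap[OF z order_refl u(1)] \<Phi>_cap[OF z order_refl w(1)] u w by auto
  obtain K q where q: "0 \<le> q" "q < 1" and
    close: "\<And>n. x \<in> space M \<Longrightarrow> cmod ((\<Phi> z ^^ Suc n) u x - (\<Phi> z ^^ Suc n) w x) \<le> K * q ^ n"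
    using \<Phi>_pow_close[OF z, of "cmod z"] cap by blast
  have pow: "(\<Phi> z ^^ n) u = u" "(\<Phi> z ^^ n) w = w" for n
    by (induction n) (auto simp: u w)
  show "u x = w x"
  proof (cases "x \<in> space M")
    case True
    have "(\<lambda>n. K * q ^ n) \<longlonglongrightarrow> 0"
      using q by (intro tendsto_mult_right_zero LIMSEQ_power_zero) auto
    moreover have "cmod (u x - w x) \<le> K * q ^ n" for n using close[OF True, of n] by (simp only: pow)
    ultimately have "cmod (u x - w x) \<le> 0" by (intro LIMSEQ_le_const) auto
    then show ?thesis by simp
  next
    case False
    then show ?thesis using u(1) w(1) by (simp add: upper_def bdd_meas_def)
  qed
qed

section \<open>The iterates and their limit\<close>

definition iterate :: "complex \<Rightarrow> nat \<Rightarrow> 'x \<Rightarrow> complex" where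
  "iterate z n = (\<Phi> z ^^ n) (\<lambda>_. 0)"

definition msol :: "complex \<Rightarrow> 'x \<Rightarrow> complex" where
  "msol z x = lim (\<lambda>n. iterate z n x)"

lemma iterate_0: "iterate z 0 = (\<lambda>_. 0)"
  and iterate_Suc: "iterate z (Suc n) = \<Phi> z (iterate z n)"
  by (simp_all add: iterate_def)

lemma iterate_cap: "0 < \<eta> \<Longrightarrow> \<eta> \<le> Im z \<Longrightarrow> iterate z n \<in> cap \<eta>"
  unfolding iterate_def by (intro \<Phi>_pow_cap zero_cap)

lemma iterate_upper: "0 < Im z \<Longrightarrow> iterate z n \<in> upper"
  using cap_upper[OF iterate_cap[of "Im z" z]] by simp

lemma iterate_outside: "x \<notin> space M \<Longrightarrow> iterate z n x = 0"
  by (cases n) (auto simp: iterate_0 iterate_Suc \<Phi>_def)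

text \<open>\<open>iterate z (m + Suc n)\<close> and \<open>iterate z (Suc n)\<close> are images of
  two points of \<open>cap \<eta>\<close> under one power of \<open>\<Phi> z\<close>, so they differ
  by at most K q^n whatever m is; letting m grow gives the error bound.\<close>

lemma iterate_close:
  assumes \<eta>: "0 < \<eta>"
  shows "\<exists>K q. 0 \<le> q \<and> q < 1 \<and> (\<forall>z n x. \<eta> \<le> Im z \<longrightarrow> cmod z \<le> \<rho> \<longrightarrow> x \<in> space M \<longrightarrow>
      (\<lambda>n. iterate z n x) \<longlonglongrightarrow> msol z x \<and> cmod (msol z x - iterate z (Suc n) x) \<le> K * q ^ n)"
proof -
  obtain K q where q: "0 \<le> q" "q < 1" and close: "\<And>z u w n x. \<eta> \<le> Im z \<Longrightarrow> cmod z \<le> \<rho> \<Longrightarrow> u \<in> cap \<eta> \<Longrightarrow> w \<in> cap \<eta> \<Longrightarrow>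
      x \<in> space M \<Longrightarrow> cmod ((\<Phi> z ^^ Suc n) u x - (\<Phi> z ^^ Suc n) w x) \<le> K * q ^ n"
    using \<Phi>_pow_close[OF \<eta>, of \<rho>] by blast
  have Kq: "(\<lambda>n. K * q ^ n) \<longlonglongrightarrow> 0"
    using q by (intro tendsto_mult_right_zero LIMSEQ_power_zero) auto
  have "(\<lambda>n. iterate z n x) \<longlonglongrightarrow> msol z x \<and> cmod (msol z x - iterate z (Suc n) x) \<le> K * q ^ n"
    if z: "\<eta> \<le> Im z" "cmod z \<le> \<rho>" and x: "x \<in> space M" for z n x
  proof -
    have diff: "cmod (iterate z (m + Suc n) x - iterate z (Suc n) x) \<le> K * q ^ n" for m n
    proof -
      have "iterate z (m + Suc n) = (\<Phi> z ^^ Suc n) (iterate z m)"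
        unfolding iterate_def by (simp only: add.commute[of m] funpow_add o_apply)
      then show ?thesis
        using close[OF z iterate_cap[OF \<eta> z(1)] zero_cap[OF \<eta>] x, of n m] by (simp add: iterate_def)
    qed
    have "Cauchy (\<lambda>n. iterate z n x)"
    proof (rule CauchyI')
      fix e :: real assume "0 < e"
      then have "\<forall>\<^sub>F n in sequentially. K * q ^ n < e" by (intro order_tendstoD(2)[OF Kq])
      then obtain N where N: "\<And>n. N \<le> n \<Longrightarrow> K * q ^ n < e" by (auto simp: eventually_sequentially)
      have "dist (iterate z m x) (iterate z n x) < e" if "Suc N \<le> m" "m < n" for m n
      proof -
        obtain m' where m': "m = Suc m'" "N \<le> m'" using \<open>Suc N \<le> m\<close> by (cases m) auto
        obtain d where d: "n = d + Suc m'" using \<open>m < n\<close> m' by (metis less_imp_add_positive add.commute)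
        show ?thesis using diff[of d m'] N[OF m'(2)] by (simp add: dist_norm norm_minus_commute d m'(1))
      qed
      then show "\<exists>M. \<forall>m\<ge>M. \<forall>n>m. dist (iterate z m x) (iterate z n x) < e" by blast
    qed
    then have lim: "(\<lambda>n. iterate z n x) \<longlonglongrightarrow> msol z x"
      unfolding msol_def by (intro convergent_LIMSEQ_iff[THEN iffD1] Cauchy_convergent)
    have "(\<lambda>m. cmod (iterate z (m + Suc n) x - iterate z (Suc n) x)) \<longlonglongrightarrow> cmod (msol z x - iterate z (Suc n) x)"
      by (intro tendsto_intros LIMSEQ_ignore_initial_segment lim)
    then have "cmod (msol z x - iterate z (Suc n) x) \<le> K * q ^ n"
      by (rule LIMSEQ_le_const2) (use diff in auto)
    with lim show ?thesis by blast
  qed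
  with q show ?thesis by blast
qed

lemma iterate_LIMSEQ:
  assumes "0 < Im z" shows "(\<lambda>n. iterate z n x) \<longlonglongrightarrow> msol z x"
proof (cases "x \<in> space M")
  case True
  then show ?thesis using iterate_close[OF assms, of "cmod z"] by blast
next
  case False
  then show ?thesis by (simp add: msol_def iterate_outside limI)
qed

lemma msol_cap:
  assumes z: "0 < Im z"
  shows "msol z \<in> cap (Im z)"
proof -
  have it: "iterate z n \<in> cap (Im z)" for n by (rule iterate_cap[OF z order_refl])
  have le: "cmod (msol z x) \<le> 1 / Im z" if x: "x \<in> space M" for x
    using it x by (intro LIMSEQ_le_const2[OF tendsto_norm[OF iterate_LIMSEQ[OF z]]]) (auto simp: cap_def)
  have "msol z \<in> borel_measurable M"
    using bdd_meas_measurable[OF upper_bdd[OF iterate_upper[OF z]]] iterate_LIMSEQ[OF z]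
    by (rule borel_measurable_LIMSEQ_metric)
  then have "msol z \<in> bdd_meas M"
    by (rule bdd_measI[OF _ le]) (simp_all add: msol_def iterate_outside limI)
  moreover have "0 \<le> Im (msol z x)" if x: "x \<in> space M" for x
    using upper_Im[OF iterate_upper[OF z] x]
    by (intro LIMSEQ_le_const[OF tendsto_Im[OF iterate_LIMSEQ[OF z]]]) auto
  ultimately show ?thesis using le by (simp add: cap_def upper_def)
qed

lemma msol_fixed_point:
  assumes z: "0 < Im z"
  shows "\<Phi> z (msol z) = msol z"
proof
  fix x
  show "\<Phi> z (msol z) x = msol z x"
  proof (cases "x \<in> space M")
    case x: True
    have ms: "msol z \<in> upper" by (rule cap_upper[OF msol_cap[OF z]])
    have itb: "iterate z n \<in> bdd_meas M" for n by (rule upper_bdd[OF iterate_upper[OF z]])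
    obtain K q where q: "0 \<le> q" "q < 1" and
      close: "\<And>n x. x \<in> space M \<Longrightarrow> cmod (msol z x - iterate z (Suc n) x) \<le> K * q ^ n"
      using iterate_close[OF z, of "cmod z"] by blast
    \<comment> \<open>Boundedness gives continuity of \<open>S\<close> in the sup norm, so the rate
      K q^n must be, and is, uniform over \<open>space M\<close>.\<close>
    have "(\<lambda>n. S (iterate z (Suc n)) x) \<longlonglongrightarrow> S (msol z) x"
    proof (rule LIM_zero_cancel, rule Lim_null_comparison)
      show "\<forall>\<^sub>F n in sequentially. cmod (S (iterate z (Suc n)) x - S (msol z) x) \<le> s * (K * q ^ n)"
      proof (intro always_eventually allI)
        fix n
        have "cmod (S (\<lambda>y. iterate z (Suc n) y - msol z y) x) \<le> s * (K * q ^ n)"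
          using close s_pos by (intro cmod_S_le[OF bdd_meas_diff[OF itb upper_bdd[OF ms]] _ x])
            (auto simp: norm_minus_commute)
        then show "cmod (S (iterate z (Suc n)) x - S (msol z) x) \<le> s * (K * q ^ n)"
          by (simp add: S_diff[OF itb upper_bdd[OF ms]])
      qed
      show "(\<lambda>n. s * (K * q ^ n)) \<longlonglongrightarrow> 0"
        using q by (intro tendsto_mult_right_zero LIMSEQ_power_zero) auto
    qed
    then have "(\<lambda>n. denom z (iterate z (Suc n)) x) \<longlonglongrightarrow> denom z (msol z) x"
      unfolding denom_def by (intro tendsto_intros)
    moreover have "denom z (msol z) x \<noteq> 0" using cmod_denom_ge[OF ms x, of z] z by auto
    ultimately have "(\<lambda>n. - (1 / denom z (iterate z (Suc n)) x)) \<longlonglongrightarrow> - (1 / denom z (msol z) x)"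
      by (intro tendsto_intros)
    then have "(\<lambda>n. iterate z (Suc (Suc n)) x) \<longlonglongrightarrow> \<Phi> z (msol z) x"
      by (simp add: iterate_Suc[of z "Suc _"] \<Phi>_eq[OF x])
    moreover have "(\<lambda>n. iterate z (Suc (Suc n)) x) \<longlonglongrightarrow> msol z x"
      by (intro LIMSEQ_Suc iterate_LIMSEQ z)
    ultimately show ?thesis by (rule LIMSEQ_unique)
  next
    case False
    then show ?thesis using msol_cap[OF z] by (simp add: \<Phi>_def cap_def upper_def bdd_meas_def)
  qed
qed

lemma qve_solution_msol: "0 < Im z \<Longrightarrow> qve_solution M S a z (msol z)"
  by (simp add: qve_solution_iff_fixed_point msol_fixed_point cap_upper[OF msol_cap])

lemma qve_solution_eq_msol: "0 < Im z \<Longrightarrow> qve_solution M S a z m \<Longrightarrow> m = msol z"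
  using fixed_points_eq[of z m "msol z"] msol_fixed_point cap_upper[OF msol_cap]
  by (simp add: qve_solution_iff_fixed_point)

section \<open>Estimates for large |z|\<close>

definition \<sigma> :: real where
  "\<sigma> = sqrt s"

lemma \<sigma>_pos: "0 < \<sigma>" and \<sigma>_mult_self: "\<sigma> * \<sigma> = s"
  using s_pos by (simp_all add: \<sigma>_def)

text \<open>The bound reproduces itself: it is at most 1 / \<sigma>, so \<open>S\<close> applied to
  an iterate is at most s / \<sigma> = \<sigma>, and the next denominator is at least |z| - A -
  \<sigma>. The requirement |z| - A - \<sigma> > \<sigma> is where the radius A + 2 \<sigma> comes
  from.\<close>

lemma iterate_far:
  assumes z: "0 < Im z" and far: "A + 2 * \<sigma> < cmod z" and x: "x \<in> space M"
  shows "cmod (iterate z n x) \<le> 1 / (cmod z - A - \<sigma>)"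
  using x
proof (induction n arbitrary: x)
  case 0
  show ?case using far \<sigma>_pos by (simp add: iterate_0)
next
  case (Suc n)
  note sq = \<sigma>_pos \<sigma>_mult_self
  have "1 / (cmod z - A - \<sigma>) \<le> 1 / \<sigma>" using far sq by (intro frac_le) auto
  then have "s * (1 / (cmod z - A - \<sigma>)) \<le> s * (1 / \<sigma>)" using s_pos by (intro mult_left_mono) auto
  moreover have "s * (1 / \<sigma>) = \<sigma>" using sq by (simp add: field_simps)
  moreover have "cmod z - A - s * (1 / (cmod z - A - \<sigma>)) \<le> cmod (denom z (iterate z n) x)"
    by (rule cmod_denom_le(2)[OF upper_bdd[OF iterate_upper[OF z]] Suc.IH Suc.prems])
  ultimately have "cmod z - A - \<sigma> \<le> cmod (denom z (iterate z n) x)" by linarith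
  then have "1 / cmod (denom z (iterate z n) x) \<le> 1 / (cmod z - A - \<sigma>)" using far sq by (intro frac_le) auto
  then show ?case using Suc.prems by (simp add: iterate_Suc \<Phi>_eq norm_divide)
qed

lemma msol_far:
  assumes z: "0 < Im z" and far: "A + 2 * \<sigma> < cmod z" and x: "x \<in> space M"
  shows "cmod (msol z x) \<le> 1 / (cmod z - A - \<sigma>)"
  using iterate_far[OF assms] by (intro LIMSEQ_le_const2[OF tendsto_norm[OF iterate_LIMSEQ[OF z]]]) auto

text \<open>Here iterates have modulus at most r = 1 / (\<sigma> + \<delta>), so by
  \<open>Im_\<Phi>\<close> a bound y for Im / Im z turns into (1 + s y) r^2. The result is the
  hypothesis of \<open>AE_support\<close>.\<close>

lemma Im_msol_far:
  assumes \<delta>: "0 < \<delta>"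
  shows "\<exists>K. \<forall>z x. 0 < Im z \<longrightarrow> A + 2 * \<sigma> + \<delta> \<le> cmod z \<longrightarrow> x \<in> space M \<longrightarrow> Im (msol z x) \<le> K * Im z"
proof -
  define r where "r = 1 / (\<sigma> + \<delta>)"
  \<comment> \<open>The stationary value of that recursion; it is nonnegative because r^2 s <
    1.\<close>
  define K where "K = r\<^sup>2 / (1 - r\<^sup>2 * s)"
  note sq = \<sigma>_pos
  have r: "0 < r" using sq \<delta> by (simp add: r_def)
  have "\<sigma>\<^sup>2 < (\<sigma> + \<delta>)\<^sup>2" using sq \<delta> by (intro power_strict_mono) auto
  moreover have "0 < (\<sigma> + \<delta>)\<^sup>2" using sq \<delta> by (intro zero_less_power add_pos_pos)
  ultimately have rs: "r\<^sup>2 * s < 1" using \<sigma>_mult_self by (simp add: r_def power_divide divide_less_eq_1 power2_eq_square)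
  then have K: "0 \<le> K" "(1 + s * K) * r\<^sup>2 = K" by (auto simp: K_def field_simps)
  have "Im (msol z x) \<le> K * Im z" if z: "0 < Im z" and far: "A + 2 * \<sigma> + \<delta> \<le> cmod z" and x: "x \<in> space M" for z x
  proof -
    have "Im (iterate z n x) \<le> K * Im z" if "x \<in> space M" for n x
      using that
    proof (induction n arbitrary: x)
      case 0
      then show ?case using K z by (simp add: iterate_0)
    next
      case (Suc n)
      let ?u = "iterate z n"
      have u: "?u \<in> upper" by (rule iterate_upper[OF z])
      have "L x (\<lambda>y. Im (?u y)) \<le> s * (K * Im z)"
        using Suc.IH upper_Im[OF u] by (intro L_le[OF bdd_real_Im[OF upper_bdd[OF u]] _ Suc.prems]) auto
      moreover have "cmod (\<Phi> z ?u x) \<le> r"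
      proof -
        have "cmod (\<Phi> z ?u x) \<le> 1 / (cmod z - A - \<sigma>)"
          using iterate_far[OF z _ Suc.prems, of "Suc n"] far \<delta> by (simp add: iterate_Suc)
        also have "\<dots> \<le> r" unfolding r_def using far \<delta> sq by (intro frac_le) auto
        finally show ?thesis .
      qed
      then have "(cmod (\<Phi> z ?u x))\<^sup>2 \<le> r\<^sup>2" by (intro power_mono) auto
      ultimately have "Im (\<Phi> z ?u x) \<le> (Im z + s * (K * Im z)) * r\<^sup>2"
        unfolding Im_\<Phi>[OF u Suc.prems] using z K s_pos by (intro mult_mono) auto
      also have "\<dots> = ((1 + s * K) * r\<^sup>2) * Im z" by (simp add: algebra_simps)
      also have "\<dots> = K * Im z" by (simp only: K(2))
      finally show ?case by (simp add: iterate_Suc)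
    qed
    then show ?thesis
      using x by (intro LIMSEQ_le_const2[OF tendsto_Im[OF iterate_LIMSEQ[OF z]]]) auto
  qed
  then show ?thesis by blast
qed

text \<open>The equation reads z (m + 1 / z) = - m (a + S m). The threshold gives |z| - A - \<sigma>
  \<ge> |z| / 2, hence |m| \<le> 2 / |z|, while |S m| \<le> s / \<sigma> = \<sigma>.\<close>

lemma msol_decay:
  assumes z: "0 < Im z" and far: "2 * (A + \<sigma>) + 1 \<le> cmod z" and x: "x \<in> space M"
  shows "cmod (msol z x + 1 / z) \<le> 2 * (A + \<sigma>) / (cmod z)\<^sup>2"
proof -
  note sq = \<sigma>_pos \<sigma>_mult_self
  have far': "A + 2 * \<sigma> < cmod z" using far A_nonneg by (simp add: distrib_left)
  have zpos: "0 < cmod z" using z by auto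
  have m: "msol z \<in> upper" by (rule cap_upper[OF msol_cap[OF z]])
  have bnd: "cmod (msol z y) \<le> 1 / (cmod z - A - \<sigma>)" if "y \<in> space M" for y
    by (rule msol_far[OF z far' that])
  have "1 / (cmod z - A - \<sigma>) \<le> 1 / (cmod z / 2)" using far zpos by (intro frac_le) auto
  then have m2: "cmod (msol z x) \<le> 2 / cmod z" using bnd[OF x] by simp
  have "1 / (cmod z - A - \<sigma>) \<le> 1 / \<sigma>" using far' sq by (intro frac_le) auto
  then have "cmod (msol z y) \<le> 1 / \<sigma>" if "y \<in> space M" for y using bnd[OF that] by linarith
  then have "cmod (S (msol z) x) \<le> s * (1 / \<sigma>)"
    using s_pos by (intro cmod_S_le[OF upper_bdd[OF m] _ x]) auto
  also have "\<dots> = \<sigma>" using sq by (simp add: field_simps)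
  finally have Sm: "cmod (a x + S (msol z) x) \<le> A + \<sigma>"
    using norm_triangle_ineq[of "a x" "S (msol z) x"] sup_norm_ge[OF a x] by linarith
  have "denom z (msol z) x \<noteq> 0" using cmod_denom_ge[OF m x, of z] z by auto
  moreover have "msol z x = - (1 / denom z (msol z) x)"
    using msol_fixed_point[OF z] \<Phi>_eq[OF x, of z "msol z"] by simp
  ultimately have "msol z x * denom z (msol z) x = -1" by simp
  then have "z * (msol z x + 1 / z) = - (msol z x * (a x + S (msol z) x))"
    using zpos by (simp add: denom_def algebra_simps eq_neg_iff_add_eq_0)
  then have "cmod z * cmod (msol z x + 1 / z) = cmod (msol z x) * cmod (a x + S (msol z) x)"
    by (metis norm_minus_cancel norm_mult)
  also have "\<dots> \<le> (2 / cmod z) * (A + \<sigma>)" using m2 Sm zpos by (intro mult_mono) auto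
  finally show ?thesis using zpos by (simp add: field_simps power2_eq_square)
qed

end

section \<open>Analyticity in z\<close>

context qve
begin

text \<open>A bounded operator carries norm convergence of difference quotients to convergence at x;
  holomorphy of each \<open>F z x\<close> separately need not pass through \<open>S\<close>.\<close>

lemma S_holomorphic:
  assumes F: "banach_analytic_on M F D" and x: "x \<in> space M"
  shows "(\<lambda>z. S (F z) x) holomorphic_on D"
  unfolding holomorphic_on_def field_differentiable_def
proof
  fix z assume z: "z \<in> D"
  have bdd: "F w \<in> bdd_meas M" if "w \<in> D" for w using F that by (simp add: banach_analytic_on_def)
  obtain d where d: "d \<in> bdd_meas M"
    and lim: "((\<lambda>w. sup_norm M (\<lambda>x. (F w x - F z x) / (w - z) - d x)) \<longlongrightarrow> 0) (at z within D)"
    using F z by (auto simp: banach_analytic_on_def)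
  have "((\<lambda>w. (S (F w) x - S (F z) x) / (w - z) - S d x) \<longlongrightarrow> 0) (at z within D)"
  proof (rule Lim_null_comparison)
    have "\<forall>\<^sub>F w in at z within D. w \<in> D" by (auto simp: eventually_at_topological intro: exI[of _ UNIV])
    then show "\<forall>\<^sub>F w in at z within D. cmod ((S (F w) x - S (F z) x) / (w - z) - S d x)
        \<le> s * sup_norm M (\<lambda>x. (F w x - F z x) / (w - z) - d x)"
    proof eventually_elim
      case (elim w)
      let ?q = "\<lambda>x. (1 / (w - z)) * (F w x - F z x)"
      have diff: "(\<lambda>x. F w x - F z x) \<in> bdd_meas M" by (intro bdd_meas_diff bdd elim z)
      have q: "?q \<in> bdd_meas M" by (rule bdd_meas_cmult[OF diff])
      have "S (\<lambda>x. ?q x - d x) x = (1 / (w - z)) * (S (F w) x - S (F z) x) - S d x"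
        by (simp only: S_diff[OF q d] S_cmult[OF diff] S_diff[OF bdd[OF elim] bdd[OF z]])
      moreover have "cmod (S (\<lambda>x. ?q x - d x) x) \<le> s * sup_norm M (\<lambda>x. ?q x - d x)"
        using sup_norm_ge[OF S_bdd[OF bdd_meas_diff[OF q d]] x] op_norm_bound[OF bdd_meas_diff[OF q d]] by linarith
      ultimately show ?case by simp
    qed
    show "((\<lambda>w. s * sup_norm M (\<lambda>x. (F w x - F z x) / (w - z) - d x)) \<longlongrightarrow> 0) (at z within D)"
      by (rule tendsto_mult_right_zero[OF lim])
  qed
  then have "((\<lambda>z. S (F z) x) has_field_derivative S d x) (at z within D)"
    unfolding has_field_derivative_iff by (rule LIM_zero_cancel)
  then show "\<exists>f'. ((\<lambda>z. S (F z) x) has_field_derivative f') (at z within D)" by blast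
qed

lemma open_upper_half_plane: "open {z. 0 < Im z}"
  by (rule open_halfspace_Im_gt)

lemma ball_half_Im:
  assumes "w \<in> ball z (Im z / 2)"
  shows "Im z / 2 \<le> Im w"
proof -
  have "Im z - Im w \<le> cmod (z - w)" using abs_Im_le_cmod[of "z - w"] by simp
  then show ?thesis using assms by (simp add: dist_norm)
qed

text \<open>On the ball of radius Im z / 2 all values are at most 2 / Im z, uniformly in x, which is
  the local bound that \<open>banach_analytic_on_pointwise\<close> asks for.\<close>

lemma cap_banach_analytic:
  assumes cap: "\<And>\<eta> z. 0 < \<eta> \<Longrightarrow> \<eta> \<le> Im z \<Longrightarrow> F z \<in> cap \<eta>"
    and hol: "\<And>x. x \<in> space M \<Longrightarrow> (\<lambda>z. F z x) holomorphic_on {z. 0 < Im z}"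
  shows "banach_analytic_on M F {z. 0 < Im z}"
proof (rule banach_analytic_on_pointwise[OF open_upper_half_plane _ hol])
  fix z assume z: "z \<in> {z. 0 < Im z}"
  then show "F z \<in> bdd_meas M" using cap[of "Im z" z] upper_bdd[OF cap_upper] by auto
  have "cmod (F w x) \<le> 1 / (Im z / 2)" if "w \<in> ball z (Im z / 2)" "x \<in> space M" for w x
    using cap[of "Im z / 2" w] ball_half_Im[OF that(1)] z that(2) by (simp add: cap_def)
  then show "\<exists>r B. 0 < r \<and> (\<forall>w\<in>ball z r. \<forall>x\<in>space M. cmod (F w x) \<le> B)"
    using z by (intro exI[of _ "Im z / 2"] exI[of _ "1 / (Im z / 2)"]) auto
qed

text \<open>Each induction step upgrades pointwise holomorphy to norm analyticity, so that
  \<open>S\<close> may be applied, and returns to pointwise holomorphy by inverting a denominator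
  without zeros.\<close>

lemma iterate_holomorphic:
  "x \<in> space M \<Longrightarrow> (\<lambda>z. iterate z n x) holomorphic_on {z. 0 < Im z}"
proof (induction n arbitrary: x)
  case 0
  then show ?case by (simp add: iterate_0)
next
  case (Suc n)
  have "banach_analytic_on M (\<lambda>z. iterate z n) {z. 0 < Im z}"
    by (rule cap_banach_analytic[OF iterate_cap Suc.IH])
  then have "(\<lambda>z. denom z (iterate z n) x) holomorphic_on {z. 0 < Im z}"
    unfolding denom_def using S_holomorphic[OF _ Suc.prems] by (intro holomorphic_intros) auto
  moreover have "denom z (iterate z n) x \<noteq> 0" if "0 < Im z" for z
    using cmod_denom_ge[OF iterate_upper[OF that, of n] Suc.prems, of z] that by auto
  ultimately show ?case
    unfolding iterate_Suc \<Phi>_eq[OF Suc.prems] by (intro holomorphic_intros) auto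
qed

lemma msol_holomorphic:
  assumes x: "x \<in> space M"
  shows "(\<lambda>z. msol z x) holomorphic_on {z. 0 < Im z}"
proof (rule holomorphic_uniform_sequence[OF open_upper_half_plane, where f = "\<lambda>n z. iterate z (Suc n) x"])
  show "(\<lambda>z. iterate z (Suc n) x) holomorphic_on {z. 0 < Im z}" for n
    by (rule iterate_holomorphic[OF x])
  fix z assume "z \<in> {z. 0 < Im z}"
  then have z: "0 < Im z" by simp
  let ?d = "Im z / 4"
  have sub: "cball z ?d \<subseteq> ball z (Im z / 2)" using z by (simp add: cball_subset_ball_iff)
  have "0 < Im z / 2" using z by simp
  \<comment> \<open>Constants valid on the whole closed disc, where Im w \<ge> Im z / 2 and |w|
    \<le> |z| + Im z.\<close>
  from iterate_close[OF this, of "cmod z + Im z"]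
  obtain K q where q: "0 \<le> q" "q < 1" and close: "\<And>w n. Im z / 2 \<le> Im w \<Longrightarrow> cmod w \<le> cmod z + Im z \<Longrightarrow>
      cmod (msol w x - iterate w (Suc n) x) \<le> K * q ^ n"
    using x by blast
  have est: "dist (iterate w (Suc n) x) (msol w x) \<le> K * q ^ n" if w: "w \<in> cball z ?d" for w n
  proof -
    have "w \<in> ball z (Im z / 2)" using w sub by blast
    moreover have "cmod w \<le> cmod z + Im z"
      using w norm_triangle_sub[of w z] z by (simp add: dist_norm norm_minus_commute)
    ultimately show ?thesis using close[OF ball_half_Im] by (simp add: dist_norm norm_minus_commute)
  qed
  have "uniform_limit (cball z ?d) (\<lambda>n w. iterate w (Suc n) x) (\<lambda>w. msol w x) sequentially"
  proof (rule uniform_limitI)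
    fix e :: real assume e: "0 < e"
    have "(\<lambda>n. K * q ^ n) \<longlonglongrightarrow> 0"
      using q by (intro tendsto_mult_right_zero LIMSEQ_power_zero) auto
    then have "\<forall>\<^sub>F n in sequentially. K * q ^ n < e" by (rule order_tendstoD(2)[OF _ e])
    then show "\<forall>\<^sub>F n in sequentially. \<forall>w\<in>cball z ?d. dist (iterate w (Suc n) x) (msol w x) < e"
    proof eventually_elim
      case (elim n)
      then show ?case using est le_less_trans by blast
    qed
  qed
  moreover have "cball z ?d \<subseteq> {z. 0 < Im z}"
  proof
    fix w assume "w \<in> cball z ?d"
    then have "Im z / 2 \<le> Im w" using sub ball_half_Im by blast
    then show "w \<in> {z. 0 < Im z}" using z by simp
  qed
  ultimately show "\<exists>d. 0 < d \<and> cball z d \<subseteq> {z. 0 < Im z} \<and>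
      uniform_limit (cball z d) (\<lambda>n w. iterate w (Suc n) x) (\<lambda>w. msol w x) sequentially"
    using z by (intro exI[of _ ?d]) auto
qed

section \<open>The Stieltjes representation of the solution\<close>

lemma msol_cap_le: "0 < \<eta> \<Longrightarrow> \<eta> \<le> Im z \<Longrightarrow> msol z \<in> cap \<eta>"
  using \<Phi>_cap[of \<eta> z "msol z"] msol_fixed_point[of z] cap_upper[OF msol_cap[of z]] by simp

lemma msol_plus: "0 < Im z \<Longrightarrow> msol z \<in> bdd_meas_plus M"
  using qve_solution_msol by (simp add: qve_solution_def)

lemma msol_Nevanlinna:
  assumes x: "x \<in> space M"
  shows "Nevanlinna_function (\<lambda>z. msol z x) (2 * (A + \<sigma>) + 1) (2 * (A + \<sigma>))"
proof
  show "(\<lambda>z. msol z x) holomorphic_on {z. 0 < Im z}" by (rule msol_holomorphic[OF x])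
  show "0 \<le> Im (msol z x)" if "0 < Im z" for z
    using upper_Im[OF cap_upper[OF msol_cap[OF that]] x] .
  show "0 \<le> 2 * (A + \<sigma>)" using A_nonneg \<sigma>_pos by simp
qed (rule msol_decay[OF _ _ x])

lemma msol_Stieltjes:
  assumes x: "x \<in> space M"
  shows "\<exists>\<mu>. compactly_supported_distribution \<mu> (A + 2 * \<sigma>) \<and> (\<forall>z. 0 < Im z \<longrightarrow> msol z x = Stieltjes \<mu> z)"
proof -
  obtain \<mu> where \<mu>: "real_distribution \<mu>" and eq: "\<And>z. 0 < Im z \<Longrightarrow> msol z x = Stieltjes \<mu> z"
    using Nevanlinna_function.Stieltjes_representation[OF msol_Nevanlinna[OF x]] by blast
  interpret \<mu>: real_distribution \<mu> by fact
  have "AE t in \<mu>. \<bar>t\<bar> \<le> A + 2 * \<sigma>"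
  proof (rule \<mu>.AE_support)
    show "\<exists>K. \<forall>z. 0 < Im z \<longrightarrow> A + 2 * \<sigma> + \<delta> \<le> cmod z \<longrightarrow> Im (Stieltjes \<mu> z) \<le> K * Im z" if "0 < \<delta>" for \<delta>
      using Im_msol_far[OF that] x eq by metis
    show "0 \<le> A + 2 * \<sigma>" using A_nonneg \<sigma>_pos by simp
  qed
  then have "compactly_supported_distribution \<mu> (A + 2 * \<sigma>)" by unfold_locales
  with eq show ?thesis by blast
qed

text \<open>Cauchy--Schwarz with the weights \<open>Im m\<close> and \<open>\<bar>m\<bar>\<^sup>2 / Im m\<close>, followed by the symmetry of \<open>S\<close>:
  a Schur test for the operator \<open>f \<mapsto> \<bar>m\<bar> S (\<bar>m\<bar> f)\<close> with the positive test function \<open>Im m / \<bar>m\<bar>\<close>.\<close>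

lemma integral_m_Sm_le_1:
  assumes z: "0 < Im z"
  shows "(LINT x|M. (cmod (msol z x * S (msol z) x))\<^sup>2) \<le> 1"
proof -
  let ?m = "msol z"
  have cap: "?m \<in> cap (Im z)" and up: "?m \<in> upper" by (rule msol_cap[OF z], rule cap_upper[OF msol_cap[OF z]])
  have b: "?m \<in> bdd_meas M" by (rule upper_bdd[OF up])
  have pos: "0 < Im (?m x)" if "x \<in> space M" for x
    using msol_plus[OF z] that by (simp add: bdd_meas_plus_def)
  let ?v = "\<lambda>x. Im (?m x)"
  let ?g = "\<lambda>x. (cmod (?m x))\<^sup>2 / Im (?m x)"
  have v: "bdd_real ?v" by (rule bdd_real_Im[OF b])
  have m2: "bdd_real (\<lambda>x. (cmod (?m x))\<^sup>2)"
    unfolding power2_eq_square by (intro bdd_real_mult bdd_real_cmod b)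
  \<comment> \<open>A positive lower bound for Im m, uniform in x; it makes the weight |m|^2 / Im m
    bounded and so admissible for \<open>L\<close>.\<close>
  define c where "c = Im z / (cmod z + A + s / Im z)\<^sup>2"
  have "0 < cmod z + A + s / Im z"
    using z A_nonneg s_pos abs_Im_le_cmod[of z] by (intro add_nonneg_pos add_nonneg_nonneg) auto
  then have c: "0 < c" using z by (simp add: c_def)
  have cv: "c \<le> ?v x" if "x \<in> space M" for x
    using Im_\<Phi>_ge[OF z order_refl order_refl cap that] msol_fixed_point[OF z] by (simp add: c_def)
  have inv_v: "bdd_real (\<lambda>x. 1 / ?v x)"
  proof (rule bdd_realI)
    show "(\<lambda>x. 1 / ?v x) \<in> borel_measurable M"
      using bdd_meas_measurable[OF b] by measurable
    show "\<bar>1 / ?v x\<bar> \<le> 1 / c" if "x \<in> space M" for x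
      using cv[OF that] c by (simp add: frac_le)
  qed
  have g: "bdd_real ?g" using bdd_real_mult[OF m2 inv_v] by simp
  have gpos: "0 \<le> ?g x" if "x \<in> space M" for x using pos[OF that] by simp
  have Im_eq: "?v x = (Im z + L x ?v) * (cmod (?m x))\<^sup>2" if "x \<in> space M" for x
    using Im_\<Phi>[OF up that, of z] by (simp add: msol_fixed_point[OF z])
  \<comment> \<open>Drops the term Im z |m|^2 from the balance. It serves twice: pointwise in
    \<open>pt\<close>, and divided by Im m after the symmetry step.\<close>
  have Lv: "(cmod (?m x))\<^sup>2 * L x ?v \<le> ?v x" if x: "x \<in> space M" for x
  proof -
    have "(cmod (?m x))\<^sup>2 * L x ?v \<le> (Im z + L x ?v) * (cmod (?m x))\<^sup>2"
      using z by (simp add: algebra_simps)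
    then show ?thesis by (simp only: Im_eq[OF x, symmetric])
  qed
  have L_bdd: "bdd_real (\<lambda>x. L x p)" if "bdd_real p" for p
    unfolding L_def by (intro bdd_real_Re S_bdd embed_bdd_meas that)
  have pt: "(cmod (?m x * S ?m x))\<^sup>2 \<le> ?v x * L x ?g" if x: "x \<in> space M" for x
  proof -
    \<comment> \<open>|m| is the geometric mean of the two weights, the form that
      \<open>L_Cauchy_Schwarz\<close> expects.\<close>
    have "L x (\<lambda>y. cmod (?m y)) = L x (\<lambda>y. sqrt (?v y * ?g y))"
    proof -
      have "cmod (?m y) = sqrt (?v y * ?g y)" if "y \<in> space M" for y using pos[OF that] by simp
      then have "embed (\<lambda>y. cmod (?m y)) = embed (\<lambda>y. sqrt (?v y * ?g y))" by (auto simp: embed_def)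
      then show ?thesis by (simp only: L_def)
    qed
    then have "cmod (S ?m x) \<le> L x (\<lambda>y. sqrt (?v y * ?g y))" using cmod_S_le_L[OF b x] by simp
    then have "(cmod (S ?m x))\<^sup>2 \<le> (L x (\<lambda>y. sqrt (?v y * ?g y)))\<^sup>2" by (intro power_mono) auto
    also have "\<dots> \<le> L x ?v * L x ?g"
      using pos by (intro L_Cauchy_Schwarz v g gpos x) (auto intro: less_imp_le)
    finally have "(cmod (?m x))\<^sup>2 * (cmod (S ?m x))\<^sup>2 \<le> (cmod (?m x))\<^sup>2 * (L x ?v * L x ?g)"
      by (intro mult_left_mono) auto
    also have "\<dots> = (cmod (?m x))\<^sup>2 * L x ?v * L x ?g" by simp
    also have "\<dots> \<le> ?v x * L x ?g"
      by (intro mult_right_mono Lv x L_nonneg g gpos)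
    finally show ?thesis by (simp add: norm_mult power_mult_distrib)
  qed
  have "bdd_real (\<lambda>x. (cmod (?m x * S ?m x))\<^sup>2)"
    unfolding norm_mult power2_eq_square by (intro bdd_real_mult bdd_real_cmod b S_bdd)
  then have "(LINT x|M. (cmod (?m x * S ?m x))\<^sup>2) \<le> (LINT x|M. ?v x * L x ?g)"
    by (intro integral_mono bdd_real_integrable bdd_real_mult v L_bdd g pt)
  \<comment> \<open>Symmetry moves \<open>S\<close> from the weight g, for which no estimate is at
    hand, to Im m, where \<open>Lv\<close> applies.\<close>
  also have "(LINT x|M. ?v x * L x ?g) = (LINT x|M. L x ?v * ?g x)"
  proof -
    have "inner_prod M (embed ?v) (S (embed ?g)) = inner_prod M (S (embed ?v)) (embed ?g)"
      using symmetric embed_bdd_meas v g by (simp add: symmetric_operator_def)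
    moreover have "inner_prod M (embed ?v) (S (embed ?g)) = (LINT x|M. complex_of_real (?v x * L x ?g))"
      unfolding inner_prod_def by (rule Bochner_Integration.integral_cong) (auto simp: embed_eq S_embed[OF g])
    moreover have "inner_prod M (S (embed ?v)) (embed ?g) = (LINT x|M. complex_of_real (L x ?v * ?g x))"
      unfolding inner_prod_def by (rule Bochner_Integration.integral_cong) (auto simp: embed_eq S_embed[OF v])
    ultimately show ?thesis by (simp only: integral_complex_of_real of_real_eq_iff)
  qed
  also have "\<dots> \<le> (LINT x|M. 1)"
  proof (intro integral_mono bdd_real_integrable bdd_real_mult L_bdd v g bdd_real_const)
    fix x assume x: "x \<in> space M"
    show "L x ?v * ?g x \<le> 1" using Lv[OF x] pos[OF x] by (simp add: divide_le_eq mult.commute)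
  qed
  also have "\<dots> = 1" using prob_space by simp
  finally show ?thesis .
qed

section \<open>Square integrability and reflection\<close>

lemma msol_L2:
  assumes z: "0 < Im z"
  shows "msol z \<in> L2 M"
proof -
  have b: "msol z \<in> bdd_meas M" by (rule upper_bdd[OF cap_upper[OF msol_cap[OF z]]])
  then show ?thesis
    using bdd_real_integrable[OF bdd_real_mult[OF bdd_real_cmod[OF b] bdd_real_cmod[OF b]]] bdd_meas_measurable[OF b]
    by (simp add: L2_def power2_eq_square)
qed

text \<open>For a = 0 the equation gives z m = - (1 + m S m); with (1 + h)^2 \<le> 2 + 2 h^2 and
  \<open>integral_m_Sm_le_1\<close> this yields |z|^2 ||m||_2^2 \<le> 4.\<close>

lemma msol_L2_norm:
  assumes z: "0 < Im z" and a0: "a = (\<lambda>x. 0)"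
  shows "L2_norm M (msol z) \<le> 2 / cmod z"
proof -
  let ?m = "msol z"
  have up: "?m \<in> upper" by (rule cap_upper[OF msol_cap[OF z]])
  have b: "?m \<in> bdd_meas M" by (rule upper_bdd[OF up])
  have zpos: "0 < cmod z" using z by auto
  have m2: "bdd_real (\<lambda>x. (cmod (?m x))\<^sup>2)"
    unfolding power2_eq_square by (intro bdd_real_mult bdd_real_cmod b)
  have h2: "bdd_real (\<lambda>x. (cmod (?m x * S ?m x))\<^sup>2)"
    unfolding norm_mult power2_eq_square by (intro bdd_real_mult bdd_real_cmod b S_bdd)
  have pt: "(cmod z)\<^sup>2 * (cmod (?m x))\<^sup>2 \<le> 2 + 2 * (cmod (?m x * S ?m x))\<^sup>2" if x: "x \<in> space M" for x
  proof -
    have "denom z ?m x \<noteq> 0" using cmod_denom_ge[OF up x, of z] z by auto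
    moreover have "?m x = - (1 / denom z ?m x)"
      using msol_fixed_point[OF z] \<Phi>_eq[OF x, of z ?m] by simp
    ultimately have "?m x * denom z ?m x = -1" by simp
    moreover have "a x = 0" by (simp only: a0)
    then have "denom z ?m x = z + S ?m x" by (simp add: denom_def)
    ultimately have "z * ?m x = - (1 + ?m x * S ?m x)" by (simp add: algebra_simps eq_neg_iff_add_eq_0)
    then have "cmod z * cmod (?m x) = cmod (1 + ?m x * S ?m x)" by (metis norm_minus_cancel norm_mult)
    also have "\<dots> \<le> 1 + cmod (?m x * S ?m x)" using norm_triangle_ineq[of 1 "?m x * S ?m x"] by simp
    finally have "(cmod z * cmod (?m x))\<^sup>2 \<le> (1 + cmod (?m x * S ?m x))\<^sup>2" by (intro power_mono) auto
    also have "\<dots> \<le> 2 + 2 * (cmod (?m x * S ?m x))\<^sup>2"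
      using sum_squares_bound[of 1 "cmod (?m x * S ?m x)"] by (simp add: power2_sum)
    finally show ?thesis by (simp add: power_mult_distrib)
  qed
  have "(cmod z)\<^sup>2 * (LINT x|M. (cmod (?m x))\<^sup>2) = (LINT x|M. (cmod z)\<^sup>2 * (cmod (?m x))\<^sup>2)" by simp
  also have "\<dots> \<le> (LINT x|M. 2 + 2 * (cmod (?m x * S ?m x))\<^sup>2)"
    by (intro integral_mono bdd_real_integrable bdd_real_add bdd_real_mult bdd_real_const m2 h2 pt)
  also have "\<dots> = 2 + 2 * (LINT x|M. (cmod (?m x * S ?m x))\<^sup>2)"
    using bdd_real_integrable[OF h2] prob_space by simp
  also have "\<dots> \<le> 4" using integral_m_Sm_le_1[OF z] by simp
  finally have "(LINT x|M. (cmod (?m x))\<^sup>2) \<le> (2 / cmod z)\<^sup>2"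
    using zpos by (simp add: power_divide pos_le_divide_eq mult.commute)
  moreover have "inner_prod M ?m ?m = of_real (LINT x|M. (cmod (?m x))\<^sup>2)"
    unfolding inner_prod_def by (simp only: mult.commute[of "cnj _"] complex_norm_square[symmetric] integral_complex_of_real)
  ultimately show ?thesis
    unfolding L2_norm_def using zpos by (intro real_le_lsqrt) auto
qed

text \<open>\<open>S\<close> preserves real functions and so commutes with conjugation; for a = 0
  conjugating the equation and changing signs gives the equation at - cnj z, and uniqueness
  identifies the solutions.\<close>

lemma msol_reflect:
  assumes z: "0 < Im z" and a0: "a = (\<lambda>x. 0)"
  shows "msol (- cnj z) = (\<lambda>x. - cnj (msol z x))"
proof -
  let ?m = "msol z" and ?w = "\<lambda>x. - cnj (msol z x)"
  have m: "?m \<in> bdd_meas_plus M" by (rule msol_plus[OF z])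
  then have mb: "?m \<in> bdd_meas M" by (simp add: bdd_meas_plus_def)
  have "?w \<in> borel_measurable M"
    using bdd_meas_measurable[OF mb] by (subst borel_measurable_complex_iff) simp
  then have wb: "?w \<in> bdd_meas M"
    by (rule bdd_measI[where B = "sup_norm M ?m"]) (use sup_norm_ge[OF mb] mb in \<open>auto simp: bdd_meas_def\<close>)
  have "qve_solution M S a (- cnj z) ?w"
    unfolding qve_solution_def
  proof (intro conjI ballI)
    show "?w \<in> bdd_meas_plus M" using wb m by (simp add: bdd_meas_plus_def)
    fix x assume x: "x \<in> space M"
    have "L x (\<lambda>y. - Re (?m y)) = - L x (\<lambda>y. Re (?m y))"
      using L_cmult[OF bdd_real_Re[OF mb], of x "-1"] by simp
    then have Sw: "S ?w x = - cnj (S ?m x)"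
      by (simp add: S_eq_Complex[OF wb x] S_eq_Complex[OF mb x] complex_eq_iff)
    have ax: "a x = 0" by (simp only: a0)
    have "- (1 / ?m x) = z + S ?m x"
      using qve_solution_msol[OF z] x by (simp add: qve_solution_def ax)
    then have "cnj (- (1 / ?m x)) = cnj (z + S ?m x)" by (rule arg_cong)
    then have "- (1 / ?w x) = - cnj z - cnj (S ?m x)" by simp
    then show "- (1 / ?w x) = - cnj z + a x + S ?w x" by (simp add: ax Sw)
  qed
  then show ?thesis using qve_solution_eq_msol[of "- cnj z" ?w] z by simp
qed

text \<open>Each \<open>v x\<close> is pi times a distribution from \<open>msol_Stieltjes\<close>.
  Picking one for every x by choice does not endanger measurability, since its moments are
  determined by a transform that is measurable in x.\<close>

lemma representing_measures:
  assumes m: "\<And>z. 0 < Im z \<Longrightarrow> m z = msol z"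
  shows "\<exists>v. (\<forall>x\<in>space M.
          v x \<in> finite_borel_measures \<and>
          measure_support (v x) \<subseteq> {- (A + 2 * sqrt s) .. A + 2 * sqrt s} \<and>
          emeasure (v x) UNIV = ennreal pi \<and>
          (\<forall>z. 0 < Im z \<longrightarrow>
            m z x = complex_of_real (1 / pi) * (LINT t|v x. 1 / (complex_of_real t - z)))) \<and>
        v \<in> measurable M (borel_of_topology weak_topology) \<and>
        (a = (\<lambda>x. 0) \<longrightarrow>
          (\<forall>z. 0 < Im z \<longrightarrow> m z \<in> L2 M \<and> L2_norm M (m z) \<le> 2 / cmod z) \<and>
          (\<forall>x\<in>space M. \<forall>A\<in>sets borel. emeasure (v x) (uminus ` A) = emeasure (v x) A))"
proof -
  let ?b = "A + 2 * sqrt s"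
  have "\<forall>x\<in>space M. \<exists>\<mu>. compactly_supported_distribution \<mu> ?b \<and> (\<forall>z. 0 < Im z \<longrightarrow> msol z x = Stieltjes \<mu> z)"
    using msol_Stieltjes unfolding \<sigma>_def by blast
  then obtain \<mu> where \<mu>: "\<And>x. x \<in> space M \<Longrightarrow> compactly_supported_distribution (\<mu> x) ?b"
    and eq: "\<And>x z. x \<in> space M \<Longrightarrow> 0 < Im z \<Longrightarrow> msol z x = Stieltjes (\<mu> x) z"
    by metis
  define v where "v = (\<lambda>x. density (\<mu> x) (\<lambda>_. ennreal pi))"
  have v_em: "emeasure (v x) B = ennreal pi * emeasure (\<mu> x) B" if "x \<in> space M" "B \<in> sets borel" for x B
  proof -
    interpret D: compactly_supported_distribution "\<mu> x" ?b by (rule \<mu>[OF that(1)])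
    show ?thesis using that(2) by (simp add: v_def emeasure_density_const)
  qed
  show ?thesis
  proof (intro exI[of _ v] conjI ballI impI allI)
    fix x assume x: "x \<in> space M"
    interpret D: compactly_supported_distribution "\<mu> x" ?b by (rule \<mu>[OF x])
    show "v x \<in> finite_borel_measures"
      unfolding v_def by (rule density_const_finite_borel[OF D.real_distribution_axioms])
    show "emeasure (v x) UNIV = ennreal pi"
      using D.emeasure_space_1 by (simp add: v_em[OF x])
    show "measure_support (v x) \<subseteq> {- ?b .. ?b}"
    proof
      fix t assume t: "t \<in> measure_support (v x)"
      \<comment> \<open>The complement of the interval is open and null, so it contains no point of
        the support.\<close>
      have "emeasure (\<mu> x) (- {- ?b .. ?b}) = 0"
        using D.AE_bounded by (subst (asm) AE_iff_measurable[where N = "- {- ?b .. ?b}"]) auto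
      then have "emeasure (v x) (- {- ?b .. ?b}) = 0" by (simp add: v_em[OF x])
      moreover have "open (- {- ?b .. ?b})" by (intro open_Compl closed_atLeastAtMost)
      ultimately have "t \<notin> - {- ?b .. ?b}"
        using t unfolding measure_support_def by (metis (no_types, lifting) less_irrefl mem_Collect_eq)
      then show "t \<in> {- ?b .. ?b}" by simp
    qed
    fix z :: complex assume z: "0 < Im z"
    have "(LINT t|v x. 1 / (complex_of_real t - z)) = pi *\<^sub>R Stieltjes (\<mu> x) z"
      unfolding v_def by (rule integral_density_const) auto
    then show "m z x = complex_of_real (1 / pi) * (LINT t|v x. 1 / (complex_of_real t - z))"
      by (simp add: m[OF z] eq[OF x z] scaleR_conv_of_real)
  next
    show "v \<in> measurable M (borel_of_topology weak_topology)"
      unfolding v_def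
    proof (rule measurable_weak_topology[OF \<mu>])
      fix z :: complex assume z: "0 < Im z"
      have "msol z \<in> borel_measurable M"
        by (rule bdd_meas_measurable[OF upper_bdd[OF cap_upper[OF msol_cap[OF z]]]])
      then show "(\<lambda>x. Stieltjes (\<mu> x) z) \<in> borel_measurable M"
        by (rule measurable_cong[THEN iffD1, rotated]) (rule eq[OF _ z])
    qed auto
  next
    fix z :: complex assume a0: "a = (\<lambda>x. 0)" and z: "0 < Im z"
    show "m z \<in> L2 M" unfolding m[OF z] by (rule msol_L2[OF z])
    show "L2_norm M (m z) \<le> 2 / cmod z" unfolding m[OF z] by (rule msol_L2_norm[OF z a0])
  next
    fix x B assume a0: "a = (\<lambda>x. 0)" and x: "x \<in> space M" and B: "B \<in> sets (borel :: real measure)"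
    interpret D: compactly_supported_distribution "\<mu> x" ?b by (rule \<mu>[OF x])
    have "distr (\<mu> x) borel uminus = \<mu> x"
    proof (rule compactly_supported_distribution_symmetric[OF \<mu>[OF x]])
      fix z :: complex assume z: "0 < Im z"
      then have "0 < Im (- cnj z)" by simp
      then show "Stieltjes (\<mu> x) (- cnj z) = - cnj (Stieltjes (\<mu> x) z)"
        using eq[OF x z] eq[OF x, of "- cnj z"] msol_reflect[OF z a0] by simp
    qed
    have img: "uminus ` B = uminus -` B \<inter> space borel" by force
    have "emeasure (\<mu> x) B = emeasure (distr (\<mu> x) borel uminus) B"
      by (simp only: \<open>distr (\<mu> x) borel uminus = \<mu> x\<close>)
    also have "\<dots> = emeasure (\<mu> x) (uminus ` B)"
      using B unfolding img by (subst emeasure_distr) auto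
    finally have "emeasure (\<mu> x) (uminus ` B) = emeasure (\<mu> x) B" by simp
    moreover have "uminus ` B \<in> sets borel"
      unfolding img using B by (intro measurable_sets[of uminus borel borel]) auto
    ultimately show "emeasure (v x) (uminus ` B) = emeasure (v x) B"
      using B by (simp add: v_em[OF x])
  qed
qed

end

text \<open>\<open>m\<close> ranges over all families that solve the equation in the upper half
  plane, with arbitrary values elsewhere; the properties are transferred from \<open>msol\<close>,
  with which \<open>m\<close> agrees there by uniqueness.\<close>

theorem theorem2p1:
  fixes M :: "'x measure"
    and S :: "('x \<Rightarrow> complex) \<Rightarrow> 'x \<Rightarrow> complex"
    and a :: "'x \<Rightarrow> complex"
  assumes "prob_space M"
    and "bounded_operator M S"
    and "\<exists>w\<in>bdd_meas M. S w \<noteq> (\<lambda>x. 0)"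
    and "a \<in> bdd_meas M"
    and "\<forall>x\<in>space M. a x \<in> \<real>"
    and "symmetric_operator M S"
    and "positivity_preserving M S"
  shows "(\<forall>z. 0 < Im z \<longrightarrow> (\<exists>!m. qve_solution M S a z m)) \<and>
    (\<forall>m. (\<forall>z. 0 < Im z \<longrightarrow> qve_solution M S a z (m z)) \<longrightarrow>
      banach_analytic_on M m {z. 0 < Im z} \<and>
      (\<exists>v.
        (\<forall>x\<in>space M.
          v x \<in> finite_borel_measures \<and>
          measure_support (v x) \<subseteq>
            {- (sup_norm M a + 2 * sqrt (op_norm M S)) .. sup_norm M a + 2 * sqrt (op_norm M S)} \<and>
          emeasure (v x) UNIV = ennreal pi \<and>
          (\<forall>z. 0 < Im z \<longrightarrow>
            m z x = complex_of_real (1 / pi) * (LINT t|v x. 1 / (complex_of_real t - z)))) \<and>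
        v \<in> measurable M (borel_of_topology weak_topology) \<and>
        (a = (\<lambda>x. 0) \<longrightarrow>
          (\<forall>z. 0 < Im z \<longrightarrow> m z \<in> L2 M \<and> L2_norm M (m z) \<le> 2 / cmod z) \<and>
          (\<forall>x\<in>space M. \<forall>A\<in>sets borel. emeasure (v x) (uminus ` A) = emeasure (v x) A))))"
proof -
  interpret Q: qve M S a
    using assms by (intro qve.intro qve_axioms.intro)
  show ?thesis
  proof (intro conjI allI impI, goal_cases)
    case (1 z)
    then show ?case using Q.qve_solution_msol Q.qve_solution_eq_msol by blast
  next
    case (2 m)
    then have m: "m z = Q.msol z" if "0 < Im z" for z
      using Q.qve_solution_eq_msol that by blast
    show ?case
    proof (rule Q.cap_banach_analytic)
      show "m z \<in> Q.cap \<eta>" if "0 < \<eta>" "\<eta> \<le> Im z" for \<eta> z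
        using Q.msol_cap_le[OF that] m[of z] that by simp
      show "(\<lambda>z. m z x) holomorphic_on {z. 0 < Im z}" if "x \<in> space M" for x
        using Q.msol_holomorphic[OF that] by (rule holomorphic_transform) (simp add: m)
    qed
  next
    case (3 m)
    then have m: "m z = Q.msol z" if "0 < Im z" for z
      using Q.qve_solution_eq_msol that by blast
    show ?case by (rule Q.representing_measures[OF m])
  qed
qed

end
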